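(* Let $\Gamma=(\Gamma_j)_{j\ge1}$ and $\Gamma'=(\Gamma'_j)_{j\ge1}$ be nested sequences of lattices in $H_3(\mathbb R)$, $\Gamma_1\supset\Gamma_2\supset\cdots$ and $\Gamma'_1\supset\Gamma'_2\supset\cdots$, and let $T$, $T'$ be the $H_3(\mathbb R)$-odometers associated with $\Gamma$ and $\Gamma'$. Then $T$ and $T'$ are f-isomorphic if and only if $S_\Gamma=S_{\Gamma'}$ and $\xi_\Gamma=\xi_{\Gamma'}$.
   Context: $H_3(\mathbb R)$: real $3\times3$ upper triangular unipotent matrices; $c(t)$ denotes the matrix with $(1,3)$ entry $t$ and other off-diagonal entries $0$; for $g$ with $(1,2)$ entry $t_1$ and $(2,3)$ entry $t_2$, $p(g)=(t_1,t_2)$. A lattice is a discrete subgroup of finite covolume. For a lattice $\Lambda$: $\Lambda\cap\{c(t)\}=\{c(m\xi_\Lambda):m\in\mathbb Z\}$ with $\xi_\Lambda>0$; $p(\Lambda)=A\mathbb Z^2$ with $A\in GL_2(\mathbb R)$ and $p(\Lambda)^*:=(A^* )^{-1}\mathbb Z^2$. For a nested sequence $\Gamma$, $S_\Gamma:=\bigcup_j p(\Gamma_j)^*\subset\mathbb R^2$ and $\xi_\Gamma:=\bigcup_j\xi_{\Gamma_j}^{-1}\mathbb Z\subset\mathbb R$. The $H_3(\mathbb R)$-odometer associated with a nested sequence of lattices is the left-translation action on $\varprojlim H_3(\mathbb R)/\Gamma_j$ with the inverse limit of invariant probability measures. Two $H_3(\mathbb R)$-odometers are f-isomorphic if they are associated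 with some nested sequences $(\Lambda_j)$, $(\Lambda'_j)$ of lattices such that $\Lambda_j$ and $\Lambda'_j$ are conjugate in $H_3(\mathbb R)$ for each $j$. *)

theory Defs
  imports "HOL-Analysis.Analysis" "HOL-Probability.Probability"
begin

text \<open>The unipotent upper triangular matrix with (1,2) entry a, (2,3) entry b and
  (1,3) entry c is represented by the triple (a, b, c). Matrix multiplication becomes
  (a,b,c)(a',b',c') = (a+a', b+b', c+c'+a*b'). The topology is that of R^3, and
  Lebesgue measure on R^3 is a Haar measure in these coordinates.\<close>

type_synonym h3 = "real \<times> real \<times> real"

definition hmul :: "h3 \<Rightarrow> h3 \<Rightarrow> h3" where
  "hmul x y = (case x of (a, b, c) \<Rightarrow> case y of (a', b', c') \<Rightarrow>
      (a + a', b + b', c + c' + a * b'))"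

definition hinv :: "h3 \<Rightarrow> h3" where
  "hinv x = (case x of (a, b, c) \<Rightarrow> (- a, - b, a * b - c))"

definition hone :: h3 where "hone = (0, 0, 0)"

definition hc :: "real \<Rightarrow> h3" where "hc t = (0, 0, t)"

definition hp :: "h3 \<Rightarrow> real^2" where
  "hp x = (case x of (a, b, c) \<Rightarrow> vector [a, b])"

definition hsubgroup :: "h3 set \<Rightarrow> bool" where
  "hsubgroup L \<longleftrightarrow> hone \<in> L \<and> (\<forall>x\<in>L. \<forall>y\<in>L. hmul x (hinv y) \<in> L)"

definition hdiscrete :: "h3 set \<Rightarrow> bool" where
  "hdiscrete L \<longleftrightarrow> (\<forall>x\<in>L. \<exists>e>0. \<forall>y\<in>L. dist y x < e \<longrightarrow> y = x)"

text \<open>Finite covolume: there is a Borel fundamental domain for the right action of L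
  on H_3(R) of finite Haar (= Lebesgue) measure.\<close>
definition finite_covolume :: "h3 set \<Rightarrow> bool" where
  "finite_covolume L \<longleftrightarrow> (\<exists>F \<in> sets borel. emeasure lborel F < \<infinity> \<and>
      (\<forall>g. \<exists>!fl. fst fl \<in> F \<and> snd fl \<in> L \<and> g = hmul (fst fl) (snd fl)))"

definition hlattice :: "h3 set \<Rightarrow> bool" where
  "hlattice L \<longleftrightarrow> hsubgroup L \<and> hdiscrete L \<and> finite_covolume L"

definition nested_lattices :: "(nat \<Rightarrow> h3 set) \<Rightarrow> bool" where
  "nested_lattices \<Gamma> \<longleftrightarrow> (\<forall>j. hlattice (\<Gamma> j) \<and> \<Gamma> (Suc j) \<subseteq> \<Gamma> j)"

definition hconjugate :: "h3 set \<Rightarrow> h3 set \<Rightarrow> bool" where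
  "hconjugate L L' \<longleftrightarrow> (\<exists>g. L' = (\<lambda>x. hmul (hmul g x) (hinv g)) ` L)"

definition xi_lat :: "h3 set \<Rightarrow> real" where
  "xi_lat L = (SOME \<xi>. \<xi> > 0 \<and> L \<inter> range hc = {hc (of_int m * \<xi>) | m. True})"

definition int_vecs :: "(real^2) set" where
  "int_vecs = {v. \<forall>i. v $ i \<in> \<int>}"

definition p_dual :: "h3 set \<Rightarrow> (real^2) set" where
  "p_dual L = (SOME S. \<exists>A :: real^2^2. invertible A \<and> hp ` L = (\<lambda>v. A *v v) ` int_vecs \<and>
                  S = (\<lambda>v. matrix_inv (transpose A) *v v) ` int_vecs)"

definition S_seq :: "(nat \<Rightarrow> h3 set) \<Rightarrow> (real^2) set" where
  "S_seq \<Gamma> = (\<Union>j. p_dual (\<Gamma> j))"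

definition xi_seq :: "(nat \<Rightarrow> h3 set) \<Rightarrow> real set" where
  "xi_seq \<Gamma> = (\<Union>j. {of_int m / xi_lat (\<Gamma> j) | m. True})"

definition lcoset :: "h3 \<Rightarrow> h3 set \<Rightarrow> h3 set" where
  "lcoset g L = (\<lambda>l. hmul g l) ` L"

definition hquot :: "h3 set \<Rightarrow> h3 set set" where
  "hquot L = {lcoset g L | g. True}"

definition quot_space :: "h3 set \<Rightarrow> h3 set measure" where
  "quot_space L = sigma (hquot L) {E. E \<subseteq> hquot L \<and> \<Union>E \<in> sets borel}"

definition coset_translate :: "h3 \<Rightarrow> h3 set \<Rightarrow> h3 set" where
  "coset_translate g C = (\<lambda>x. hmul g x) ` C"

definition quot_measure :: "h3 set \<Rightarrow> h3 set measure" where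
  "quot_measure L = (THE \<mu>. prob_space \<mu> \<and> sets \<mu> = sets (quot_space L) \<and>
      (\<forall>g. \<forall>E \<in> sets \<mu>. emeasure \<mu> (coset_translate g -` E \<inter> space \<mu>) = emeasure \<mu> E))"

text \<open>The inverse limit of the H_3(R)/\<Gamma>_j: compatible sequences of cosets.\<close>
definition odo_points :: "(nat \<Rightarrow> h3 set) \<Rightarrow> (nat \<Rightarrow> h3 set) set" where
  "odo_points \<Gamma> = {x. \<forall>j. x j \<in> hquot (\<Gamma> j) \<and> x (Suc j) \<subseteq> x j}"

definition odo_sigma :: "(nat \<Rightarrow> h3 set) \<Rightarrow> (nat \<Rightarrow> h3 set) measure" where
  "odo_sigma \<Gamma> = sigma (odo_points \<Gamma>)
      {(\<lambda>x. x j) -` E \<inter> odo_points \<Gamma> | j E. E \<in> sets (quot_space (\<Gamma> j))}"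

definition odo_measure :: "(nat \<Rightarrow> h3 set) \<Rightarrow> (nat \<Rightarrow> h3 set) measure" where
  "odo_measure \<Gamma> = (THE \<mu>. prob_space \<mu> \<and> sets \<mu> = sets (odo_sigma \<Gamma>) \<and>
      (\<forall>j. distr \<mu> (quot_space (\<Gamma> j)) (\<lambda>x. x j) = quot_measure (\<Gamma> j)))"

definition odo_act :: "h3 \<Rightarrow> (nat \<Rightarrow> h3 set) \<Rightarrow> (nat \<Rightarrow> h3 set)" where
  "odo_act g x = (\<lambda>j. coset_translate g (x j))"

type_synonym 'a hsystem = "'a measure \<times> (h3 \<Rightarrow> 'a \<Rightarrow> 'a)"

definition odometer :: "(nat \<Rightarrow> h3 set) \<Rightarrow> (nat \<Rightarrow> h3 set) hsystem" where
  "odometer \<Gamma> = (odo_measure \<Gamma>, odo_act)"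

definition hsys_iso :: "'a hsystem \<Rightarrow> 'b hsystem \<Rightarrow> bool" where
  "hsys_iso X Y \<longleftrightarrow> (case X of (M, T) \<Rightarrow> case Y of (N, S) \<Rightarrow>
     (\<exists>\<phi> \<psi>. \<phi> \<in> M \<rightarrow>\<^sub>M N \<and> \<psi> \<in> N \<rightarrow>\<^sub>M M \<and> distr M N \<phi> = N \<and>
        (AE x in M. \<psi> (\<phi> x) = x) \<and> (AE y in N. \<phi> (\<psi> y) = y) \<and>
        (\<forall>g. AE x in M. \<phi> (T g x) = S g (\<phi> x))))"

definition associated :: "'a hsystem \<Rightarrow> (nat \<Rightarrow> h3 set) \<Rightarrow> bool" where
  "associated X \<Lambda> \<longleftrightarrow> nested_lattices \<Lambda> \<and> hsys_iso X (odometer \<Lambda>)"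

definition f_isomorphic :: "'a hsystem \<Rightarrow> 'b hsystem \<Rightarrow> bool" where
  "f_isomorphic X Y \<longleftrightarrow> (\<exists>\<Lambda> \<Lambda>'. associated X \<Lambda> \<and> associated Y \<Lambda>' \<and>
      (\<forall>j. hconjugate (\<Lambda> j) (\<Lambda>' j)))"

end

theory Submission
  imports Defs
begin

text \<open>The set \<open>S_seq \<Gamma>\<close> consists of the eigenvalues of the whole odometer action and \<open>xi_seq \<Gamma>\<close>
  of the eigenvalues of the action of the centre, so both are isomorphism invariants. An
  eigenfunction correlates with some level \<open>H/\<Gamma> j\<close>, on which central elements of \<open>\<Gamma> j\<close> act
  trivially and, after averaging over the centre, so do all elements of \<open>\<Gamma> j\<close>; conversely a Borel
  section of \<open>H \<rightarrow> H/\<Gamma> j\<close> yields eigenfunctions. Conjugate lattices have the same projection to the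
  plane and the same centre.

  For the converse, equality of the invariants allows passing to subsequences such that the
  projections and centres of the lattices \<open>\<Gamma> (n 0), \<Gamma>' (n 1), \<Gamma> (n 2), \<dots>\<close> decrease. With
  \<open>G = \<Gamma> (n (2 * i + 2))\<close> and \<open>G' = \<Gamma>' (n (2 * i + 1))\<close>, enlarging \<open>G\<close> by the centre of \<open>G'\<close> and
  restricting \<open>G'\<close> to the projection of \<open>G\<close> gives two lattices with the same projection and the
  same centre; these are conjugate, and the resulting sequences interlace \<open>\<Gamma>\<close> and \<open>\<Gamma>'\<close>, so that they
  define isomorphic odometers.\<close>

subsection \<open>The Heisenberg group and its Haar measure\<close>

text \<open>The measures of an odometer are definite descriptions, so an invariant probability on
  each quotient and a measure on the inverse limit with these marginals must be shown to exist and
  to be unique before anything can be said of the action. Explicit Borel fundamental domains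
  underlie both, and they also give the measurable sections from which eigenfunctions are made. Two
  spectra are needed because a character of the whole group is trivial on commutators and hence on
  the centre: it sees only the projection of a lattice. The action of the centre alone records the
  remaining datum, the central generator. In the converse direction the given lattices cannot be
  conjugated level by level, since lattices with different projections or centres are never
  conjugate. Both sequences are replaced by sequences squeezed between members of the given ones,
  one lattice growing in its centre and the other shrinking in its projection until the two data
  coincide.\<close>

lemma hmul_simp [simp]: "hmul (a, b, c) (a', b', c') = (a + a', b + b', c + c' + a * b')"
  by (simp add: hmul_def)

lemma hinv_simp [simp]: "hinv (a, b, c) = (- a, - b, a * b - c)"
  by (simp add: hinv_def)

lemma hmul_assoc: "hmul (hmul x y) z = hmul x (hmul y z)"
  by (cases x; cases y; cases z) (simp add: algebra_simps)

lemma hmul_hone [simp]: "hmul hone x = x" "hmul x hone = x"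
  by (cases x; simp add: hone_def)+

lemma hmul_hinv [simp]: "hmul x (hinv x) = hone" "hmul (hinv x) x = hone"
  by (cases x; simp add: hone_def)+

lemma hmul_hinv_cancel [simp]:
  "hmul x (hmul (hinv x) y) = y" "hmul (hinv x) (hmul x y) = y"
  by (simp_all flip: hmul_assoc)

lemma hinv_hinv [simp]: "hinv (hinv x) = x"
  by (cases x) simp

lemma hinv_hmul: "hinv (hmul x y) = hmul (hinv y) (hinv x)"
  by (cases x; cases y) (simp add: algebra_simps)

lemma hmul_left_cancel [simp]: "hmul x y = hmul x z \<longleftrightarrow> y = z"
  by (metis hmul_hinv_cancel(2))

lemma hmul_right_cancel [simp]: "hmul y x = hmul z x \<longleftrightarrow> y = z"
  by (metis hmul_assoc hmul_hinv(1) hmul_hone(2))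

lemma hsubgroup_hone: "hsubgroup L \<Longrightarrow> hone \<in> L"
  by (simp add: hsubgroup_def)

lemma hsubgroup_hinv: "hsubgroup L \<Longrightarrow> x \<in> L \<Longrightarrow> hinv x \<in> L"
  unfolding hsubgroup_def by (metis hmul_hone(1))

lemma hsubgroup_hmul: "hsubgroup L \<Longrightarrow> x \<in> L \<Longrightarrow> y \<in> L \<Longrightarrow> hmul x y \<in> L"
  using hsubgroup_hinv[of L y] unfolding hsubgroup_def by (metis hinv_hinv)

lemma hsubgroupI:
  assumes "hone \<in> L" "\<And>x y. x \<in> L \<Longrightarrow> y \<in> L \<Longrightarrow> hmul x y \<in> L"
    "\<And>x. x \<in> L \<Longrightarrow> hinv x \<in> L"
  shows "hsubgroup L"
  using assms by (simp add: hsubgroup_def)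

lemma hmul_mem_iff:
  assumes "hsubgroup L"
  shows "l \<in> L \<Longrightarrow> hmul x l \<in> L \<longleftrightarrow> x \<in> L" "l \<in> L \<Longrightarrow> hmul l x \<in> L \<longleftrightarrow> x \<in> L"
  by (metis assms hmul_assoc hmul_hinv(1) hmul_hone(2) hsubgroup_hinv hsubgroup_hmul,
      metis assms hmul_hinv_cancel(2) hsubgroup_hinv hsubgroup_hmul)

lemma hc_simps: "hmul (hc s) (hc t) = hc (s + t)" "hinv (hc t) = hc (- t)" "hc 0 = hone"
  by (simp_all add: hc_def hone_def)

lemma hc_central: "hmul (hc t) x = hmul x (hc t)"
  by (cases x) (simp add: hc_def)

lemma hc_inject [simp]: "hc s = hc t \<longleftrightarrow> s = t"
  by (simp add: hc_def)

text \<open>The determinant of the two projections. It is the commutator form of the group, and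
  conjugation by \<open>x\<close> adds \<open>hdet x y\<close> to the central coordinate of
  \<open>y\<close>.\<close>

definition hdet :: "h3 \<Rightarrow> h3 \<Rightarrow> real" where
  "hdet x y = fst x * fst (snd y) - fst (snd x) * fst y"

lemma hdet_simp [simp]: "hdet (a, b, c) (a', b', c') = a * b' - b * a'"
  by (simp add: hdet_def)

lemma hmul_commute: "hmul x y = hmul (hmul y x) (hc (hdet x y))"
  by (cases x; cases y) (simp add: hc_def)

lemma hconj_eq: "hmul (hmul g x) (hinv g) = hmul x (hc (hdet g x))"
  by (cases g; cases x) (simp add: hc_def algebra_simps)

lemma hmul_eq: "hmul x y = (fst x + fst y, fst (snd x) + fst (snd y), snd (snd x) + snd (snd y) + fst x * fst (snd y))"
  by (cases x; cases y) simp

lemma fst_hmul [simp]: "fst (hmul x y) = fst x + fst y"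
  and fst_snd_hmul [simp]: "fst (snd (hmul x y)) = fst (snd x) + fst (snd y)"
  by (simp_all add: hmul_eq)

lemma fst_hinv [simp]: "fst (hinv x) = - fst x"
  and fst_snd_hinv [simp]: "fst (snd (hinv x)) = - fst (snd x)"
  by (cases x; simp)+

lemma fst_hc [simp]: "fst (hc t) = 0" and fst_snd_hc [simp]: "fst (snd (hc t)) = 0"
  and snd_snd_hc [simp]: "snd (snd (hc t)) = t"
  by (simp_all add: hc_def)

lemma same_hp_imp_hc:
  assumes "fst x = fst y" "fst (snd x) = fst (snd y)"
  shows "y = hmul x (hc (snd (snd y) - snd (snd x)))"
  using assms by (cases x; cases y) (simp add: hc_def)

lemma measurable_hmul [measurable (raw)]:
  assumes [measurable]: "f \<in> borel_measurable M" "g \<in> borel_measurable M"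
  shows "(\<lambda>x. hmul (f x) (g x)) \<in> borel_measurable M"
proof -
  have "continuous_on UNIV (\<lambda>z::h3 \<times> h3. hmul (fst z) (snd z))"
    unfolding hmul_eq by (intro continuous_intros)
  then have "(\<lambda>z::h3 \<times> h3. hmul (fst z) (snd z)) \<in> borel_measurable borel"
    by (rule borel_measurable_continuous_onI)
  then have "(\<lambda>z::h3 \<times> h3. hmul (fst z) (snd z)) \<in> borel_measurable (borel \<Otimes>\<^sub>M borel)"
    by (simp add: borel_prod)
  from measurable_compose[OF measurable_Pair[OF assms] this] show ?thesis by simp
qed

lemma nn_integral_lborel_shift:
  fixes f :: "real \<Rightarrow> ennreal"
  assumes [measurable]: "f \<in> borel_measurable borel"
  shows "(\<integral>\<^sup>+x. f (c + x) \<partial>lborel) = (\<integral>\<^sup>+x. f x \<partial>lborel)"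
proof -
  have "(\<integral>\<^sup>+x. f x \<partial>lborel) = (\<integral>\<^sup>+x. f x \<partial>distr lborel borel ((+) c))"
    by (simp add: lborel_distr_plus)
  also have "\<dots> = (\<integral>\<^sup>+x. f (c + x) \<partial>lborel)"
    by (rule nn_integral_distr) auto
  finally show ?thesis by simp
qed

lemma nn_integral_h3:
  fixes f :: "h3 \<Rightarrow> ennreal"
  assumes f [measurable]: "f \<in> borel_measurable borel"
  shows "(\<integral>\<^sup>+x. f x \<partial>lborel) = (\<integral>\<^sup>+a. \<integral>\<^sup>+b. \<integral>\<^sup>+c. f (a, b, c) \<partial>lborel \<partial>lborel \<partial>lborel)"
proof -
  have f2: "f \<in> borel_measurable (lborel \<Otimes>\<^sub>M lborel)"
    unfolding lborel_prod by simp
  have f3: "(\<lambda>y. f (a, y)) \<in> borel_measurable (lborel \<Otimes>\<^sub>M lborel)" for a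
    unfolding lborel_prod by simp
  have "(\<integral>\<^sup>+x. f x \<partial>lborel) = (\<integral>\<^sup>+a. \<integral>\<^sup>+y. f (a, y) \<partial>lborel \<partial>lborel)"
    using lborel.nn_integral_fst[OF f2] unfolding lborel_prod by simp
  also have "\<dots> = (\<integral>\<^sup>+a. \<integral>\<^sup>+b. \<integral>\<^sup>+c. f (a, b, c) \<partial>lborel \<partial>lborel \<partial>lborel)"
    using lborel.nn_integral_fst[OF f3] unfolding lborel_prod by simp
  finally show ?thesis .
qed

text \<open>Left multiplication is a translation combined with a shear of the central coordinate, by
  an amount that depends only on the other two. Integrating the central coordinate first removes the
  shear.\<close>

lemma nn_integral_hmul_left:
  fixes f :: "h3 \<Rightarrow> ennreal"
  assumes f: "f \<in> borel_measurable borel"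
  shows "(\<integral>\<^sup>+x. f (hmul g x) \<partial>lborel) = (\<integral>\<^sup>+x. f x \<partial>lborel)"
proof -
  have fm [measurable]: "f \<in> borel_measurable (borel \<Otimes>\<^sub>M borel \<Otimes>\<^sub>M borel)"
    using f by (simp add: borel_prod)
  have fg: "(\<lambda>x. f (hmul g x)) \<in> borel_measurable borel"
    by (rule measurable_compose[OF _ f]) simp
  obtain a b c where g: "g = (a, b, c)" by (cases g)
  have 1: "(\<integral>\<^sup>+z. f (a + x, b + y, c + z + a * y) \<partial>lborel) = (\<integral>\<^sup>+z. f (a + x, b + y, z) \<partial>lborel)" for x y
    using nn_integral_lborel_shift[of "\<lambda>z. f (a + x, b + y, z)" "c + a * y"]
    by (simp add: algebra_simps)
  have 2: "(\<integral>\<^sup>+y. \<integral>\<^sup>+z. f (a + x, b + y, z) \<partial>lborel \<partial>lborel)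
     = (\<integral>\<^sup>+y. \<integral>\<^sup>+z. f (a + x, y, z) \<partial>lborel \<partial>lborel)" for x
    using nn_integral_lborel_shift[of "\<lambda>y. \<integral>\<^sup>+z. f (a + x, y, z) \<partial>lborel" b] by simp
  have 3: "(\<integral>\<^sup>+x. \<integral>\<^sup>+y. \<integral>\<^sup>+z. f (a + x, y, z) \<partial>lborel \<partial>lborel \<partial>lborel)
     = (\<integral>\<^sup>+x. \<integral>\<^sup>+y. \<integral>\<^sup>+z. f (x, y, z) \<partial>lborel \<partial>lborel \<partial>lborel)"
    using nn_integral_lborel_shift[of "\<lambda>x. \<integral>\<^sup>+y. \<integral>\<^sup>+z. f (x, y, z) \<partial>lborel \<partial>lborel" a] by simp
  show ?thesis
    unfolding nn_integral_h3[OF f] nn_integral_h3[OF fg] by (simp add: g 1 2 3)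
qed

text \<open>The same order of integration works on the right, so the group is unimodular; right
  invariance is what makes pieces moved by lattice elements comparable.\<close>

lemma nn_integral_hmul_right:
  fixes f :: "h3 \<Rightarrow> ennreal"
  assumes f: "f \<in> borel_measurable borel"
  shows "(\<integral>\<^sup>+x. f (hmul x g) \<partial>lborel) = (\<integral>\<^sup>+x. f x \<partial>lborel)"
proof -
  have fm [measurable]: "f \<in> borel_measurable (borel \<Otimes>\<^sub>M borel \<Otimes>\<^sub>M borel)"
    using f by (simp add: borel_prod)
  have fg: "(\<lambda>x. f (hmul x g)) \<in> borel_measurable borel"
    by (rule measurable_compose[OF _ f]) simp
  obtain a b c where g: "g = (a, b, c)" by (cases g)
  have 1: "(\<integral>\<^sup>+z. f (x + a, y + b, z + c + x * b) \<partial>lborel) = (\<integral>\<^sup>+z. f (a + x, b + y, z) \<partial>lborel)" for x y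
    using nn_integral_lborel_shift[of "\<lambda>z. f (a + x, b + y, z)" "c + x * b"]
    by (simp add: algebra_simps)
  have 2: "(\<integral>\<^sup>+y. \<integral>\<^sup>+z. f (a + x, b + y, z) \<partial>lborel \<partial>lborel)
     = (\<integral>\<^sup>+y. \<integral>\<^sup>+z. f (a + x, y, z) \<partial>lborel \<partial>lborel)" for x
    using nn_integral_lborel_shift[of "\<lambda>y. \<integral>\<^sup>+z. f (a + x, y, z) \<partial>lborel" b] by simp
  have 3: "(\<integral>\<^sup>+x. \<integral>\<^sup>+y. \<integral>\<^sup>+z. f (a + x, y, z) \<partial>lborel \<partial>lborel \<partial>lborel)
     = (\<integral>\<^sup>+x. \<integral>\<^sup>+y. \<integral>\<^sup>+z. f (x, y, z) \<partial>lborel \<partial>lborel \<partial>lborel)"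
    using nn_integral_lborel_shift[of "\<lambda>x. \<integral>\<^sup>+y. \<integral>\<^sup>+z. f (x, y, z) \<partial>lborel \<partial>lborel" a] by simp
  show ?thesis
    unfolding nn_integral_h3[OF f] nn_integral_h3[OF fg] by (simp add: g 1 2 3)
qed

lemma sets_hmul_vimage [measurable]:
  assumes "A \<in> sets borel"
  shows "hmul g -` A \<in> sets borel" "(\<lambda>x. hmul x g) -` A \<in> sets borel"
proof -
  have "hmul g \<in> borel_measurable borel" "(\<lambda>x. hmul x g) \<in> borel_measurable borel"
    by simp_all
  from this[THEN measurable_sets, OF assms]
  show "hmul g -` A \<in> sets borel" "(\<lambda>x. hmul x g) -` A \<in> sets borel" by simp_all
qed

lemma emeasure_hmul_vimage:
  assumes [measurable]: "A \<in> sets borel"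
  shows "emeasure lborel (hmul g -` A) = emeasure lborel A"
    and "emeasure lborel ((\<lambda>x. hmul x g) -` A) = emeasure lborel A"
proof -
  have *: "emeasure lborel B = (\<integral>\<^sup>+x. indicator B x \<partial>lborel)" if "B \<in> sets borel" for B :: "h3 set"
    using that by simp
  show "emeasure lborel (hmul g -` A) = emeasure lborel A"
    using nn_integral_hmul_left[of "indicator A" g] sets_hmul_vimage[of A g]
    by (simp add: * indicator_vimage del: nn_integral_indicator)
  show "emeasure lborel ((\<lambda>x. hmul x g) -` A) = emeasure lborel A"
    using nn_integral_hmul_right[of "indicator A" g] sets_hmul_vimage[of A g]
    by (simp add: * indicator_vimage del: nn_integral_indicator)
qed

lemma hmul_image_eq_vimage:
  "hmul g ` A = hmul (hinv g) -` A" "(\<lambda>x. hmul x g) ` A = (\<lambda>x. hmul x (hinv g)) -` A"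
proof -
  show "hmul g ` A = hmul (hinv g) -` A"
    by (auto simp: image_iff) (metis hmul_hinv_cancel(1))
  show "(\<lambda>x. hmul x g) ` A = (\<lambda>x. hmul x (hinv g)) -` A"
    by (auto simp: image_iff hmul_assoc) (metis hmul_assoc hmul_hinv(2) hmul_hone(2))
qed

subsection \<open>Fundamental domains\<close>

text \<open>The domains of \<open>finite_covolume\<close> with the bound on the volume split off, so
  that domains of unknown volume can be compared.\<close>

definition fdom :: "h3 set \<Rightarrow> h3 set \<Rightarrow> bool" where
  "fdom L F \<longleftrightarrow> F \<in> sets borel \<and>
     (\<forall>g. \<exists>!fl. fst fl \<in> F \<and> snd fl \<in> L \<and> g = hmul (fst fl) (snd fl))"

lemma fdomI:
  assumes "F \<in> sets borel" "\<And>g. \<exists>f\<in>F. \<exists>l\<in>L. g = hmul f l"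
    "\<And>f f' l l'. \<lbrakk>f \<in> F; f' \<in> F; l \<in> L; l' \<in> L; hmul f l = hmul f' l'\<rbrakk> \<Longrightarrow> f = f'"
  shows "fdom L F"
  unfolding fdom_def
proof (intro conjI allI)
  fix g
  obtain f l where fl: "f \<in> F" "l \<in> L" "g = hmul f l"
    using assms(2) by blast
  show "\<exists>!fl. fst fl \<in> F \<and> snd fl \<in> L \<and> g = hmul (fst fl) (snd fl)"
  proof (rule ex1I[of _ "(f, l)"])
    fix p assume p: "fst p \<in> F \<and> snd p \<in> L \<and> g = hmul (fst p) (snd p)"
    then have "fst p = f"
      using assms(3)[of "fst p" f "snd p" l] fl by auto
    then show "p = (f, l)"
      using p fl by (metis hmul_left_cancel prod.collapse)
  qed (use fl in auto)
qed (use assms in auto)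

lemma fdom_sets: "fdom L F \<Longrightarrow> F \<in> sets borel"
  by (simp add: fdom_def)

lemma fdom_ex: "fdom L F \<Longrightarrow> \<exists>f\<in>F. \<exists>l\<in>L. g = hmul f l"
  unfolding fdom_def by (metis)

lemma fdom_unique:
  assumes "fdom L F" "f \<in> F" "f' \<in> F" "l \<in> L" "l' \<in> L" "hmul f l = hmul f' l'"
  shows "f = f'" "l = l'"
proof -
  have "\<exists>!fl. fst fl \<in> F \<and> snd fl \<in> L \<and> hmul f l = hmul (fst fl) (snd fl)"
    using assms(1) unfolding fdom_def by blast
  then have "(f, l) = (f', l')"
    using assms by (metis fst_conv snd_conv)
  then show "f = f'" "l = l'" by auto
qed

lemma fdom_left_translate:
  assumes "fdom L F" shows "fdom L (hmul g ` F)"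
proof (rule fdomI)
  show "hmul g ` F \<in> sets borel"
    using fdom_sets[OF assms] by (simp add: hmul_image_eq_vimage sets_hmul_vimage)
  fix x
  obtain f l where "f \<in> F" "l \<in> L" "hmul (hinv g) x = hmul f l"
    using fdom_ex[OF assms] by blast
  then show "\<exists>f\<in>hmul g ` F. \<exists>l\<in>L. x = hmul f l"
    by (metis hmul_assoc hmul_hinv_cancel(1) imageI)
next
  fix f f' l l'
  assume "f \<in> hmul g ` F" "f' \<in> hmul g ` F" "l \<in> L" "l' \<in> L" "hmul f l = hmul f' l'"
  then obtain e e' where e: "e \<in> F" "f = hmul g e" "e' \<in> F" "f' = hmul g e'" "hmul e l = hmul e' l'"
    by (auto simp: hmul_assoc simp del: split_paired_Ex)
  then show "f = f'"
    using fdom_unique(1)[OF assms e(1,3) \<open>l \<in> L\<close> \<open>l' \<in> L\<close>] by simp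
qed

definition right_invariant :: "h3 set \<Rightarrow> h3 set \<Rightarrow> bool" where
  "right_invariant L B \<longleftrightarrow> (\<forall>x. \<forall>l\<in>L. hmul x l \<in> B \<longleftrightarrow> x \<in> B)"

text \<open>Both measures unfold to the same sum of the measures of \<open>F1 l \<inter> F2 \<inter> B\<close> over \<open>l \<in> L\<close>.\<close>
lemma fdom_emeasure_eq:
  assumes L: "hsubgroup L" "countable L" and F1: "fdom L F1" and F2: "fdom L F2"
    and B: "B \<in> sets borel" "right_invariant L B"
  shows "emeasure lborel (F1 \<inter> B) = emeasure lborel (F2 \<inter> B)"
proof -
  have unfold: "emeasure lborel (F \<inter> B) = (\<integral>\<^sup>+l. emeasure lborel (F \<inter> B \<inter> (\<lambda>x. hmul x l) -` G) \<partial>count_space L)"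
    if F: "fdom L F" and G: "fdom L G" for F G
  proof -
    have "F \<inter> B = (\<Union>l\<in>L. F \<inter> B \<inter> (\<lambda>x. hmul x l) -` G)"
    proof -
      have "\<exists>l\<in>L. hmul x l \<in> G" for x
        using fdom_ex[OF G, of x] hsubgroup_hinv[OF L(1)]
        by (metis hmul_assoc hmul_hinv(1) hmul_hone(2))
      then show ?thesis by auto
    qed
    moreover have "disjoint_family_on (\<lambda>l. F \<inter> B \<inter> (\<lambda>x. hmul x l) -` G) L"
    proof -
      have "l = l'" if "l \<in> L" "l' \<in> L" "hmul x l \<in> G" "hmul x l' \<in> G" for l l' x
        using fdom_unique(2)[OF G that(3,4), of "hinv l" "hinv l'"] that hsubgroup_hinv[OF L(1)]
        by (metis hinv_hinv hmul_assoc hmul_hinv(1))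
      then show ?thesis by (auto simp: disjoint_family_on_def)
    qed
    ultimately show ?thesis
      using emeasure_UN_countable[of L "\<lambda>l. F \<inter> B \<inter> (\<lambda>x. hmul x l) -` G" lborel]
        fdom_sets[OF F] fdom_sets[OF G] B L by auto
  qed
  have "emeasure lborel (F1 \<inter> B) = (\<integral>\<^sup>+l. emeasure lborel (F1 \<inter> B \<inter> (\<lambda>x. hmul x l) -` F2) \<partial>count_space L)"
    using unfold[OF F1 F2] .
  \<comment> \<open>Right translation by \<open>l\<close> carries the piece of \<open>F1\<close>
    that lands in \<open>F2\<close> onto the piece of \<open>F2\<close> that \<open>hinv l\<close>
    brings back to \<open>F1\<close>; \<open>B\<close> is unaffected and volume is
    preserved.\<close>
  also have "\<dots> = (\<integral>\<^sup>+l. emeasure lborel (F2 \<inter> B \<inter> (\<lambda>x. hmul x (hinv l)) -` F1) \<partial>count_space L)"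
  proof (rule nn_integral_cong)
    fix l assume "l \<in> space (count_space L)"
    then have l: "l \<in> L" by simp
    have eq: "F1 \<inter> B \<inter> (\<lambda>x. hmul x l) -` F2 = (\<lambda>x. hmul x l) -` (F2 \<inter> B \<inter> (\<lambda>x. hmul x (hinv l)) -` F1)"
    proof (rule set_eqI)
      fix x
      have "hmul x l \<in> B \<longleftrightarrow> x \<in> B" using B(2) l unfolding right_invariant_def by blast
      then show "x \<in> F1 \<inter> B \<inter> (\<lambda>x. hmul x l) -` F2 \<longleftrightarrow>
          x \<in> (\<lambda>x. hmul x l) -` (F2 \<inter> B \<inter> (\<lambda>x. hmul x (hinv l)) -` F1)"
        by (simp add: hmul_assoc conj_ac)
    qed
    show "emeasure lborel (F1 \<inter> B \<inter> (\<lambda>x. hmul x l) -` F2) =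
      emeasure lborel (F2 \<inter> B \<inter> (\<lambda>x. hmul x (hinv l)) -` F1)"
      unfolding eq using fdom_sets[OF F1] fdom_sets[OF F2] B
      by (intro emeasure_hmul_vimage(2)) (auto intro!: sets_hmul_vimage)
  qed
  also have "\<dots> = (\<integral>\<^sup>+l. emeasure lborel (F2 \<inter> B \<inter> (\<lambda>x. hmul x l) -` F1) \<partial>count_space L)"
  proof -
    have "bij_betw hinv L L"
      by (rule bij_betw_byWitness[where f'=hinv]) (use hsubgroup_hinv[OF L(1)] in auto)
    from nn_integral_bij_count_space[OF this] show ?thesis .
  qed
  also have "\<dots> = emeasure lborel (F2 \<inter> B)"
    using unfold[OF F2 F1] by simp
  finally show ?thesis .
qed

lemma fdom_cover:
  assumes "fdom L F" "hsubgroup L" "right_invariant L B"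
  shows "B = (\<Union>l\<in>L. (\<lambda>x. hmul x l) -` (F \<inter> B))"
proof -
  have "\<exists>l\<in>L. hmul x l \<in> F" for x
    using fdom_ex[OF assms(1), of x] hsubgroup_hinv[OF assms(2)]
    by (metis hmul_assoc hmul_hinv(1) hmul_hone(2))
  then show ?thesis using assms(3) unfolding right_invariant_def by blast
qed

text \<open>Countably many right translates of \<open>F \<inter> B\<close>, all of the same measure,
  cover \<open>B\<close>.\<close>

lemma fdom_emeasure_pos:
  assumes "fdom L F" "hsubgroup L" "countable L" "right_invariant L B" "B \<in> sets borel" "emeasure lborel B \<noteq> 0"
  shows "emeasure lborel (F \<inter> B) \<noteq> 0"
proof
  assume 0: "emeasure lborel (F \<inter> B) = 0"
  have s: "F \<inter> B \<in> sets borel" using assms fdom_sets by auto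
  have "(\<lambda>x. hmul x l) -` (F \<inter> B) \<in> null_sets lborel" for l
    using emeasure_hmul_vimage(2)[OF s, of l] sets_hmul_vimage(2)[OF s, of l] 0 by (auto intro!: null_setsI)
  then have "(\<Union>l\<in>L. (\<lambda>x. hmul x l) -` (F \<inter> B)) \<in> null_sets lborel"
    using assms(3) by (intro null_sets_UN') auto
  then show False
    using fdom_cover[OF assms(1,2,4)] assms(6) by auto
qed

text \<open>Each point of \<open>L\<close> is cut out by a member of a countable basis of the
  topology.\<close>

lemma hdiscrete_countable:
  assumes "hdiscrete L" shows "countable L"
proof -
  obtain \<B> :: "h3 set set" where \<B>: "countable \<B>" "topological_basis \<B>"
    using ex_countable_basis by blast
  have "\<exists>b\<in>\<B>. b \<inter> L = {x}" if x: "x \<in> L" for x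
  proof -
    obtain e where e: "e > 0" "\<forall>y\<in>L. dist y x < e \<longrightarrow> y = x"
      using assms x unfolding hdiscrete_def by blast
    obtain b where "b \<in> \<B>" "x \<in> b" "b \<subseteq> ball x e"
      using topological_basisE[OF \<B>(2), of "ball x e" x] e(1) by auto
    then show ?thesis
      using e(2) x by (intro bexI[of _ b]) (auto simp: dist_commute subset_eq)
  qed
  then obtain f where f: "\<And>x. x \<in> L \<Longrightarrow> f x \<in> \<B> \<and> f x \<inter> L = {x}"
    by metis
  then have "inj_on f L" "f ` L \<subseteq> \<B>"
    by (metis inj_onI singleton_inject, blast)
  then show ?thesis
    using \<B>(1) countable_image_inj_on countable_subset by blast
qed

lemma finite_covolume_iff: "finite_covolume L \<longleftrightarrow> (\<exists>F. fdom L F \<and> emeasure lborel F < \<infinity>)"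
  unfolding finite_covolume_def fdom_def by blast

text \<open>Otherwise \<open>L\<close> projects into a line. The strips parallel to this line then
  give infinitely many disjoint \<open>L\<close>-invariant slabs, which all meet a fundamental
  domain in the same positive volume, against finite covolume.\<close>

lemma hlattice_hdet_nonzero:
  assumes "hlattice L"
  shows "\<exists>a\<in>L. \<exists>b\<in>L. hdet a b \<noteq> 0"
proof (rule ccontr)
  assume "\<not> ?thesis"
  then have D: "\<And>a b. a \<in> L \<Longrightarrow> b \<in> L \<Longrightarrow> hdet a b = 0" by blast
  have L: "hsubgroup L" "countable L"
    using assms hdiscrete_countable by (auto simp: hlattice_def)
  obtain F where F: "fdom L F" "emeasure lborel F < \<infinity>"
    using assms by (auto simp: hlattice_def finite_covolume_iff)
  \<comment> \<open>\<open>(u, v)\<close> is normal to the line containing the projection of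
    \<open>L\<close>; any nonzero vector serves if that projection is trivial.\<close>
  obtain u v :: real where uv: "(u, v) \<noteq> 0" "\<And>l. l \<in> L \<Longrightarrow> u * fst l + v * fst (snd l) = 0"
  proof (cases "\<exists>a\<in>L. (fst a, fst (snd a)) \<noteq> (0, 0)")
    case True
    then obtain a where a: "a \<in> L" "(fst a, fst (snd a)) \<noteq> (0, 0)" by blast
    show ?thesis
      by (rule that[of "- fst (snd a)" "fst a"])
        (use a D[OF a(1)] in \<open>auto simp: zero_prod_def hdet_def\<close>)
  next
    case False
    show ?thesis by (rule that[of 1 0]) (use False in \<open>auto simp: zero_prod_def\<close>)
  qed
  define w where "w = (\<lambda>g::h3. u * fst g + v * fst (snd g))"
  define slab where "slab n = {g. real_of_int n \<le> w g \<and> w g < real_of_int n + 1}" for n :: int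
  \<comment> \<open>\<open>h n\<close> is the multiple of the normal vector on which
    \<open>w\<close> takes the value \<open>n\<close>, so left translation by it carries
    \<open>slab 0\<close> to \<open>slab n\<close>.\<close>
  define h :: "int \<Rightarrow> h3" where "h n = (n * u / (u\<^sup>2 + v\<^sup>2), n * v / (u\<^sup>2 + v\<^sup>2), 0)" for n
  have w_hmul: "w (hmul x y) = w x + w y" for x y
    by (simp add: w_def algebra_simps)
  have pos: "u\<^sup>2 + v\<^sup>2 \<noteq> 0"
    using uv(1) by (auto simp: zero_prod_def sum_power2_eq_zero_iff)
  have w_h: "w (h n) = n" for n
  proof -
    have "u * (n * u / q) + v * (n * v / q) = n * ((u\<^sup>2 + v\<^sup>2) / q)" for q :: real
      by (simp add: power2_eq_square add_divide_distrib ring_distribs mult_ac)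
    then have "w (h n) = n * ((u\<^sup>2 + v\<^sup>2) / (u\<^sup>2 + v\<^sup>2))"
      unfolding w_def h_def fst_conv snd_conv .
    then show ?thesis using divide_self[OF pos] by (simp only: mult_1_right)
  qed
  have w_L: "w l = 0" if "l \<in> L" for l
    using uv(2)[OF that] by (simp add: w_def)
  have "continuous_on UNIV w"
    unfolding w_def by (intro continuous_intros)
  then have [measurable]: "w \<in> borel_measurable borel"
    by (rule borel_measurable_continuous_onI)
  have slab_sets [measurable]: "slab n \<in> sets borel" for n
  proof -
    have "slab n = w -` {real_of_int n..<real_of_int n + 1} \<inter> space borel"
      by (auto simp: slab_def)
    also have "\<dots> \<in> sets borel" by (rule measurable_sets[of w borel borel]) auto
    finally show ?thesis .
  qed
  have slab_inv: "right_invariant L (slab n)" for n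
    by (auto simp: right_invariant_def slab_def w_hmul w_L)
  have slab_shift: "slab 0 = hmul (h n) -` slab n" for n
    by (auto simp: slab_def w_hmul w_h)
  define V where "V = emeasure lborel (F \<inter> slab 0)"
  have meq: "emeasure lborel (F \<inter> slab n) = V" for n
  proof -
    \<comment> \<open>The domain \<open>F\<close> is exchanged for its translate by
      \<open>h n\<close>, which is a domain as well, and translating back turns
      \<open>slab n\<close> into \<open>slab 0\<close>.\<close>
    have "emeasure lborel (F \<inter> slab n) = emeasure lborel (hmul (h n) ` F \<inter> slab n)"
      by (rule fdom_emeasure_eq[OF L F(1) fdom_left_translate[OF F(1)] slab_sets slab_inv])
    also have "\<dots> = emeasure lborel (hmul (h n) -` (hmul (h n) ` F \<inter> slab n))"
      using fdom_sets[OF fdom_left_translate[OF F(1)]] by (intro emeasure_hmul_vimage(1)[symmetric]) auto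
    also have "hmul (h n) -` (hmul (h n) ` F \<inter> slab n) = F \<inter> slab 0"
      using slab_shift[of n] by auto
    finally show ?thesis unfolding V_def .
  qed
  have "emeasure lborel (slab 0) \<noteq> 0"
  proof
    assume 0: "emeasure lborel (slab 0) = 0"
    have "slab n \<in> null_sets lborel" for n
      using 0 emeasure_hmul_vimage(1)[OF slab_sets, of "h n" n] slab_shift[of n] by (auto intro!: null_setsI)
    then have "(\<Union>n. slab n) \<in> null_sets lborel" by auto
    moreover have "(\<Union>n. slab n) = UNIV"
    proof -
      have "g \<in> slab \<lfloor>w g\<rfloor>" for g by (auto simp: slab_def)
      then show ?thesis by blast
    qed
    ultimately show False by (simp add: null_sets_def)
  qed
  then have nz: "V \<noteq> 0"
    unfolding V_def by (rule fdom_emeasure_pos[OF F(1) L slab_inv slab_sets])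
  have "disjoint_family (\<lambda>n::nat. F \<inter> slab (int n))"
    unfolding disjoint_family_on_def slab_def by auto
  then have "(\<Sum>n. emeasure lborel (F \<inter> slab (int n))) = emeasure lborel (\<Union>n. F \<inter> slab (int n))"
    using fdom_sets[OF F(1)] by (intro suminf_emeasure) auto
  also have "\<dots> \<le> emeasure lborel F"
    using fdom_sets[OF F(1)] by (intro emeasure_mono) auto
  finally have "(\<Sum>n::nat. V) < \<infinity>"
    using F(2) by (simp add: meq)
  moreover have "(\<Sum>n::nat. c) = \<infinity>" if "c \<noteq> 0" for c :: ennreal
  proof -
    have "(\<Sum>n::nat. c) = (\<integral>\<^sup>+n. c \<partial>count_space (UNIV :: nat set))"
      by (rule nn_integral_count_space_nat[symmetric])
    also have "\<dots> = c * \<infinity>"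
      by (simp only: nn_integral_const) simp
    finally show ?thesis using that by (simp add: ennreal_mult_eq_top_iff)
  qed
  ultimately show False using nz by (metis less_irrefl)
qed

subsection \<open>Structure of lattices\<close>

text \<open>The working form of a lattice: \<open>a\<close> and \<open>b\<close> are arbitrary lifts
  of a basis of the projection, and \<open>\<xi>\<close> generates the centre.\<close>

definition lat :: "h3 set \<Rightarrow> h3 \<Rightarrow> h3 \<Rightarrow> real \<Rightarrow> bool" where
  "lat L a b \<xi> \<longleftrightarrow> hsubgroup L \<and> countable L \<and> a \<in> L \<and> b \<in> L \<and> hdet a b \<noteq> 0 \<and> \<xi> > 0 \<and>
     (\<forall>t. hc t \<in> L \<longleftrightarrow> (\<exists>k::int. t = of_int k * \<xi>)) \<and>
     (\<forall>x\<in>L. \<exists>m n :: int. fst x = of_int m * fst a + of_int n * fst b \<and>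
        fst (snd x) = of_int m * fst (snd a) + of_int n * fst (snd b))"

lemma latD:
  assumes "lat L a b \<xi>"
  shows "hsubgroup L" "countable L" "a \<in> L" "b \<in> L" "hdet a b \<noteq> 0" "\<xi> > 0"
    "hc t \<in> L \<longleftrightarrow> (\<exists>k::int. t = of_int k * \<xi>)"
    "x \<in> L \<Longrightarrow> \<exists>m n :: int. fst x = of_int m * fst a + of_int n * fst b \<and>
        fst (snd x) = of_int m * fst (snd a) + of_int n * fst (snd b)"
  using assms unfolding lat_def by blast+

text \<open>Only the projection of the element is recorded: the central coordinate of a power of
  \<open>a\<close> is quadratic in the exponent.\<close>

lemma hsubgroup_int_multiple:
  assumes L: "hsubgroup L" "a \<in> L"
  shows "\<exists>x\<in>L. fst x = of_int m * fst a \<and> fst (snd x) = of_int m * fst (snd a)"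
proof (induction m rule: int_induct[where k = 0])
  case base
  show ?case using hsubgroup_hone[OF L(1)] by (intro bexI[of _ hone]) (auto simp: hone_def)
next
  case (step1 i)
  then obtain x where "x \<in> L" "fst x = of_int i * fst a \<and> fst (snd x) = of_int i * fst (snd a)"
    by blast
  then show ?case
    using hsubgroup_hmul[OF L(1) _ L(2)] by (intro bexI[of _ "hmul x a"]) (auto simp: algebra_simps)
next
  case (step2 i)
  then obtain x where "x \<in> L" "fst x = of_int i * fst a \<and> fst (snd x) = of_int i * fst (snd a)"
    by blast
  then show ?case
    using hsubgroup_hmul[OF L(1) _ hsubgroup_hinv[OF L]]
    by (intro bexI[of _ "hmul x (hinv a)"]) (auto simp: algebra_simps)
qed

lemma hsubgroup_int_combination:
  assumes L: "hsubgroup L" "a \<in> L" "b \<in> L"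
  shows "\<exists>x\<in>L. fst x = of_int m * fst a + of_int n * fst b \<and>
     fst (snd x) = of_int m * fst (snd a) + of_int n * fst (snd b)"
proof -
  obtain x y where "x \<in> L" "fst x = of_int m * fst a" "fst (snd x) = of_int m * fst (snd a)"
    "y \<in> L" "fst y = of_int n * fst b" "fst (snd y) = of_int n * fst (snd b)"
    using hsubgroup_int_multiple[OF L(1,2)] hsubgroup_int_multiple[OF L(1,3)] by metis
  then show ?thesis
    using hsubgroup_hmul[OF L(1)] by (intro bexI[of _ "hmul x y"]) auto
qed

text \<open>\<open>hc (hdet x y)\<close> is the commutator of \<open>x\<close> and \<open>y\<close>.
  Two lattice elements with independent projections therefore produce a nontrivial central
  one.\<close>

lemma hsubgroup_hc_hdet:
  assumes "hsubgroup L" "x \<in> L" "y \<in> L"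
  shows "hc (hdet x y) \<in> L"
  using hmul_commute[of x y] hmul_mem_iff(2)[OF assms(1), of "hmul y x"] hsubgroup_hmul[OF assms(1)] assms
  by metis

text \<open>The generator is the infimum of the positive elements. It is attained, since two
  elements within \<open>e\<close> above it would differ by less than \<open>e\<close>; every other
  element has remainder 0 modulo it by minimality.\<close>

lemma discrete_real_subgroup_cyclic:
  fixes T :: "real set"
  assumes T: "0 \<in> T" "\<And>s t. s \<in> T \<Longrightarrow> t \<in> T \<Longrightarrow> s - t \<in> T"
    and e: "e > 0" "\<And>t. t \<in> T \<Longrightarrow> \<bar>t\<bar> < e \<Longrightarrow> t = 0" and t0: "t0 \<in> T" "t0 \<noteq> 0"
  shows "\<exists>\<xi>>0. T = {of_int k * \<xi> | k. True}"
proof -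
  have neg: "- t \<in> T" if "t \<in> T" for t using T(2)[OF T(1) that] by simp
  have add: "s + t \<in> T" if "s \<in> T" "t \<in> T" for s t using T(2)[OF that(1) neg[OF that(2)]] by simp
  define P where "P = {t \<in> T. t > 0}"
  have "\<bar>t0\<bar> \<in> P" using t0 neg[OF t0(1)] unfolding P_def by (simp add: abs_if)
  then have ne: "P \<noteq> {}" by blast
  have ge: "e \<le> t" if "t \<in> P" for t using e(2)[of t] that unfolding P_def by force
  then have bdd: "bdd_below P" by (rule bdd_belowI)
  define \<xi> where "\<xi> = Inf P"
  have "\<xi> \<ge> e" unfolding \<xi>_def using ne ge by (rule cInf_greatest)
  then have pos: "\<xi> > 0" using e by simp
  have "\<xi> \<in> T"
  proof (rule ccontr)
    assume n: "\<xi> \<notin> T"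
    obtain t where t: "t \<in> P" "t < \<xi> + e"
      using cInf_lessD[OF ne, of "\<xi> + e"] e(1) by (auto simp: \<xi>_def)
    have "\<xi> < t" using cInf_lower[OF t(1) bdd] n t(1) by (auto simp: \<xi>_def P_def less_le)
    then obtain s where s: "s \<in> P" "s < t"
      using cInf_lessD[OF ne, of t] by (auto simp: \<xi>_def)
    have "\<xi> \<le> s" using cInf_lower[OF s(1) bdd] by (simp add: \<xi>_def)
    with e(2)[of "t - s"] T(2)[of t s] s t show False by (auto simp: P_def)
  qed
  have mult: "of_int k * \<xi> \<in> T" for k :: int
  proof (induction k rule: int_induct[where k = 0])
    case base then show ?case using T(1) by simp
  next
    case (step1 i) then show ?case using add[OF step1.IH \<open>\<xi> \<in> T\<close>] by (simp add: ring_distribs)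
  next
    case (step2 i) then show ?case using T(2)[OF step2.IH \<open>\<xi> \<in> T\<close>] by (simp add: left_diff_distrib)
  qed
  have "t = of_int \<lfloor>t / \<xi>\<rfloor> * \<xi>" if "t \<in> T" for t
  proof (rule ccontr)
    define r where "r = t - of_int \<lfloor>t / \<xi>\<rfloor> * \<xi>"
    assume "t \<noteq> of_int \<lfloor>t / \<xi>\<rfloor> * \<xi>"
    then have "r \<noteq> 0" by (simp add: r_def)
    have "0 \<le> r" "r < \<xi>"
      using floor_divide_lower[OF pos, of t] floor_divide_upper[OF pos, of t]
      unfolding r_def by (simp_all add: ring_distribs)
    moreover have "r \<in> T" unfolding r_def by (intro T(2) that mult)
    ultimately have "r \<in> P" using \<open>r \<noteq> 0\<close> by (simp add: P_def)
    from cInf_lower[OF this bdd] \<open>r < \<xi>\<close> show False by (simp add: \<xi>_def)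
  qed
  then have "T = {of_int k * \<xi> | k. True}" using mult by auto
  with pos show ?thesis by blast
qed

text \<open>Cramer's rule for the projections, in a form free of matrices.\<close>

lemma hdet_basis:
  assumes "hdet a b \<noteq> 0"
  shows "fst x = (hdet x b / hdet a b) * fst a + (hdet a x / hdet a b) * fst b"
    "fst (snd x) = (hdet x b / hdet a b) * fst (snd a) + (hdet a x / hdet a b) * fst (snd b)"
proof -
  have "hdet a b * fst x = hdet x b * fst a + hdet a x * fst b"
    "hdet a b * fst (snd x) = hdet x b * fst (snd a) + hdet a x * fst (snd b)"
    unfolding hdet_def by algebra+
  with assms show "fst x = (hdet x b / hdet a b) * fst a + (hdet a x / hdet a b) * fst b"
    "fst (snd x) = (hdet x b / hdet a b) * fst (snd a) + (hdet a x / hdet a b) * fst (snd b)"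
    by (simp_all add: divide_simps mult.commute)
qed

lemma hdet_left_combination:
  assumes "fst x = m * fst a + n * fst b" "fst (snd x) = m * fst (snd a) + n * fst (snd b)"
  shows "hdet x b = m * hdet a b" "hdet a x = n * hdet a b"
  using assms by (simp_all add: hdet_def algebra_simps)

lemma hdet_hmul:
  "hdet (hmul x y) z = hdet x z + hdet y z" "hdet z (hmul x y) = hdet z x + hdet z y"
  by (simp_all add: hdet_def algebra_simps)

lemma hdet_hinv: "hdet (hinv x) z = - hdet x z" "hdet z (hinv x) = - hdet z x"
  by (simp_all add: hdet_def algebra_simps)

lemma hdet_hc: "hdet (hc t) z = 0" "hdet z (hc t) = 0"
  by (simp_all add: hdet_def)

lemma abs_frac_mult_less:
  fixes d :: real assumes "d \<noteq> 0" shows "\<bar>frac r * d\<bar> < \<bar>d\<bar>"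
  using assms frac_lt_1[of r] frac_ge_0[of r] by (simp add: abs_mult)

text \<open>Commutators show that all \<open>hdet x y\<close> are multiples of the central generator, so a pair
  with nonzero determinant of least modulus exists; reducing modulo it leaves nothing.\<close>
lemma hlattice_lat:
  assumes "hlattice L"
  shows "\<exists>a b \<xi>. lat L a b \<xi>"
proof -
  have L: "hsubgroup L" "countable L" "hdiscrete L"
    using assms hdiscrete_countable by (auto simp: hlattice_def)
  obtain a0 b0 where ab0: "a0 \<in> L" "b0 \<in> L" "hdet a0 b0 \<noteq> 0"
    using hlattice_hdet_nonzero[OF assms] by blast
  define T where "T = {t. hc t \<in> L}"
  obtain e where e: "e > 0" "\<forall>y\<in>L. dist y hone < e \<longrightarrow> y = hone"
    using L(1,3) hsubgroup_hone unfolding hdiscrete_def by blast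
  have "\<exists>\<xi>>0. T = {of_int k * \<xi> | k. True}"
  proof (rule discrete_real_subgroup_cyclic[OF _ _ e(1), where ?t0.0 = "hdet a0 b0"])
    show "0 \<in> T" using hsubgroup_hone[OF L(1)] by (simp add: T_def hc_simps)
    show "s - t \<in> T" if "s \<in> T" "t \<in> T" for s t
      using that hsubgroup_hmul[OF L(1), of "hc s" "hinv (hc t)"] hsubgroup_hinv[OF L(1), of "hc t"]
      by (simp add: T_def hc_simps)
    show "t = 0" if "t \<in> T" "\<bar>t\<bar> < e" for t
      using e(2)[rule_format, of "hc t"] that by (simp add: T_def hc_def hone_def dist_Pair_Pair)
    show "hdet a0 b0 \<in> T" using hsubgroup_hc_hdet[OF L(1) ab0(1,2)] by (simp add: T_def)
  qed (use ab0 in auto)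
  then obtain \<xi> where \<xi>: "\<xi> > 0" "T = {of_int k * \<xi> | k. True}" by blast
  \<comment> \<open>Every nonzero determinant of lattice elements has as its modulus a positive
    integer multiple of \<open>\<xi>\<close>, so the least modulus can be sought among natural
    numbers.\<close>
  define Q where "Q n \<longleftrightarrow> n > 0 \<and> (\<exists>a\<in>L. \<exists>b\<in>L. \<bar>hdet a b\<bar> = real n * \<xi>)" for n :: nat
  have Q: "\<exists>n. Q n \<and> \<bar>hdet a b\<bar> = real n * \<xi>" if "a \<in> L" "b \<in> L" "hdet a b \<noteq> 0" for a b
  proof -
    have "hdet a b \<in> T" using hsubgroup_hc_hdet[OF L(1) that(1,2)] by (simp add: T_def)
    then obtain k where k: "hdet a b = of_int k * \<xi>" using \<xi> by blast
    then have "\<bar>hdet a b\<bar> = real (nat \<bar>k\<bar>) * \<xi>" "k \<noteq> 0" using \<xi>(1) that(3) by (auto simp: abs_mult)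
    then show ?thesis using that unfolding Q_def by (intro exI[of _ "nat \<bar>k\<bar>"]) auto
  qed
  define N where "N = (LEAST n. Q n)"
  have "Q N" unfolding N_def using Q[OF ab0] by (auto intro: LeastI)
  then obtain a b where ab: "a \<in> L" "b \<in> L" "\<bar>hdet a b\<bar> = real N * \<xi>" "N > 0"
    unfolding Q_def by blast
  then have nz: "hdet a b \<noteq> 0" using \<xi>(1) by auto
  have min: "hdet x y = 0" if "x \<in> L" "y \<in> L" "\<bar>hdet x y\<bar> < \<bar>hdet a b\<bar>" for x y
  proof (rule ccontr)
    assume "hdet x y \<noteq> 0"
    from Q[OF that(1,2) this] obtain n where n: "Q n" "\<bar>hdet x y\<bar> = real n * \<xi>" by blast
    then have "N \<le> n" unfolding N_def by (intro Least_le)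
    with n(2) ab(3) that(3) \<xi>(1) show False by auto
  qed
  have "\<exists>m n :: int. fst x = of_int m * fst a + of_int n * fst b \<and>
        fst (snd x) = of_int m * fst (snd a) + of_int n * fst (snd b)" if x: "x \<in> L" for x
  proof -
    \<comment> \<open>These are the coordinates of \<open>x\<close> in the basis \<open>a\<close>,
      \<open>b\<close>. Dividing by a lattice element with their integer parts as coordinates leaves
      \<open>z\<close>, whose determinants against \<open>a\<close> and \<open>b\<close> are proper
      fractions of \<open>hdet a b\<close> and so vanish by minimality.\<close>
    define \<alpha> \<beta> where "\<alpha> = hdet x b / hdet a b" and "\<beta> = hdet a x / hdet a b"
    obtain y where y: "y \<in> L" "fst y = of_int \<lfloor>\<alpha>\<rfloor> * fst a + of_int \<lfloor>\<beta>\<rfloor> * fst b"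
       "fst (snd y) = of_int \<lfloor>\<alpha>\<rfloor> * fst (snd a) + of_int \<lfloor>\<beta>\<rfloor> * fst (snd b)"
      using hsubgroup_int_combination[OF L(1) ab(1,2)] by metis
    define z where "z = hmul x (hinv y)"
    have z: "z \<in> L" unfolding z_def using L(1) x y(1) hsubgroup_hmul hsubgroup_hinv by blast
    have 1: "hdet z b = frac \<alpha> * hdet a b" "hdet a z = frac \<beta> * hdet a b"
      using hdet_left_combination[OF y(2,3)] nz
      by (simp_all add: z_def hdet_hmul hdet_hinv \<alpha>_def \<beta>_def frac_def algebra_simps)
    have "hdet z b = 0" "hdet a z = 0"
      by (rule min; use z ab 1 abs_frac_mult_less[OF nz] in simp)+
    with 1 nz have "frac \<alpha> = 0" "frac \<beta> = 0" by auto
    then have "\<alpha> = of_int \<lfloor>\<alpha>\<rfloor>" "\<beta> = of_int \<lfloor>\<beta>\<rfloor>" by (simp_all add: frac_def)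
    with hdet_basis[OF nz, of x] show ?thesis
      unfolding \<alpha>_def[symmetric] \<beta>_def[symmetric] by metis
  qed
  moreover have "hc t \<in> L \<longleftrightarrow> (\<exists>k::int. t = of_int k * \<xi>)" for t
    using \<xi>(2) unfolding T_def by blast
  ultimately have "lat L a b \<xi>"
    unfolding lat_def using L ab nz \<xi>(1) by blast
  then show ?thesis by blast
qed

section \<open>Explicit fundamental domains\<close>

text \<open>A half-open box in the coordinates given by Cramer's rule and the central coordinate.
  Only the projections of \<open>a\<close> and \<open>b\<close> enter, so conjugate lattices share
  it.\<close>

definition Wdom :: "h3 \<Rightarrow> h3 \<Rightarrow> real \<Rightarrow> h3 set" where
  "Wdom a b \<xi> = {g. 0 \<le> hdet g b / hdet a b \<and> hdet g b / hdet a b < 1 \<and>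
     0 \<le> hdet a g / hdet a b \<and> hdet a g / hdet a b < 1 \<and> 0 \<le> snd (snd g) \<and> snd (snd g) < \<xi>}"

lemma Wdom_sets: "Wdom a b \<xi> \<in> sets borel"
proof -
  have 1: "continuous_on UNIV (\<lambda>g. hdet g b / hdet a b)" "continuous_on UNIV (\<lambda>g. hdet a g / hdet a b)"
    "continuous_on UNIV (\<lambda>g::h3. snd (snd g))"
    unfolding hdet_def divide_inverse by (intro continuous_intros)+
  note [measurable] = 1[THEN borel_measurable_continuous_onI]
  have "Wdom a b \<xi> = {g \<in> space borel. 0 \<le> hdet g b / hdet a b \<and> hdet g b / hdet a b < 1 \<and>
     0 \<le> hdet a g / hdet a b \<and> hdet a g / hdet a b < 1 \<and> 0 \<le> snd (snd g) \<and> snd (snd g) < \<xi>}"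
    by (simp add: Wdom_def)
  also have "\<dots> \<in> sets borel" by measurable
  finally show ?thesis .
qed

lemma Wdom_finite:
  assumes "hdet a b \<noteq> 0"
  shows "emeasure lborel (Wdom a b \<xi>) < \<infinity>"
proof -
  define A B where "A = \<bar>fst a\<bar> + \<bar>fst b\<bar>" and "B = \<bar>fst (snd a)\<bar> + \<bar>fst (snd b)\<bar>"
  have bd: "\<bar>s * x + t * y\<bar> \<le> \<bar>x\<bar> + \<bar>y\<bar>" if "0 \<le> s" "s < 1" "0 \<le> t" "t < 1" for s t x y :: real
  proof -
    have "\<bar>s * x\<bar> \<le> \<bar>x\<bar>" "\<bar>t * y\<bar> \<le> \<bar>y\<bar>" using that by (simp_all add: abs_mult mult_left_le_one_le)
    then show ?thesis by linarith
  qed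
  have "g \<in> {-A..A} \<times> {-B..B} \<times> {0..\<xi>}" if "g \<in> Wdom a b \<xi>" for g
  proof -
    have "\<bar>fst g\<bar> \<le> A" "\<bar>fst (snd g)\<bar> \<le> B"
      using that hdet_basis[OF assms, of g] bd[of "hdet g b / hdet a b" "hdet a g / hdet a b"]
      unfolding Wdom_def A_def B_def by (metis (no_types, lifting) mem_Collect_eq)+
    moreover have "0 \<le> snd (snd g)" "snd (snd g) \<le> \<xi>" using that by (auto simp: Wdom_def)
    ultimately show ?thesis by (simp add: mem_Times_iff abs_le_iff)
  qed
  then have "Wdom a b \<xi> \<subseteq> {-A..A} \<times> {-B..B} \<times> {0..\<xi>}" by blast
  then have "bounded (Wdom a b \<xi>)"
    by (rule bounded_subset[rotated]) (intro bounded_Times bounded_closed_interval)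
  then show ?thesis using emeasure_bounded_finite by auto
qed

text \<open>The projection is reduced first: that step disturbs the central coordinate, while the
  central correction afterwards leaves the projection alone. For uniqueness, the lattice element
  relating two representatives of a coset has integer coordinates of modulus below 1, hence is
  central, and then its last coordinate is a multiple of \<open>\<xi>\<close> of modulus below
  \<open>\<xi>\<close>.\<close>

lemma lat_fdom:
  assumes "lat L a b \<xi>"
  shows "fdom L (Wdom a b \<xi>)"
proof (rule fdomI)
  note L = latD[OF assms]
  fix g
  define \<alpha> \<beta> where "\<alpha> = hdet g b / hdet a b" and "\<beta> = hdet a g / hdet a b"
  obtain y where y: "y \<in> L" "fst y = of_int \<lfloor>\<alpha>\<rfloor> * fst a + of_int \<lfloor>\<beta>\<rfloor> * fst b"
     "fst (snd y) = of_int \<lfloor>\<alpha>\<rfloor> * fst (snd a) + of_int \<lfloor>\<beta>\<rfloor> * fst (snd b)"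
    using hsubgroup_int_combination[OF L(1,3,4)] by metis
  define z where "z = hmul g (hinv y)"
  define k where "k = \<lfloor>snd (snd z) / \<xi>\<rfloor>"
  define f where "f = hmul z (hc (- of_int k * \<xi>))"
  have 1: "hdet z b = frac \<alpha> * hdet a b" "hdet a z = frac \<beta> * hdet a b"
    using hdet_left_combination[OF y(2,3)] L(5)
    by (simp_all add: z_def hdet_hmul hdet_hinv \<alpha>_def \<beta>_def frac_def algebra_simps)
  have 2: "hdet f b / hdet a b = frac \<alpha>" "hdet a f / hdet a b = frac \<beta>"
    using 1 L(5) by (simp_all add: f_def hdet_hmul hdet_hc)
  have 3: "snd (snd f) = snd (snd z) - of_int k * \<xi>"
    by (simp add: f_def hmul_eq)
  have "0 \<le> snd (snd f)" "snd (snd f) < \<xi>"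
    using floor_divide_lower[OF L(6), of "snd (snd z)"] floor_divide_upper[OF L(6), of "snd (snd z)"]
    unfolding 3 k_def by (simp_all add: ring_distribs)
  then have "f \<in> Wdom a b \<xi>" unfolding Wdom_def using 2 by (simp add: frac_lt_1)
  moreover have "hmul (hc (of_int k * \<xi>)) y \<in> L"
    using hsubgroup_hmul[OF L(1) _ y(1)] L(7) by blast
  moreover have "g = hmul f (hmul (hc (of_int k * \<xi>)) y)"
  proof -
    have "hmul f (hmul (hc (of_int k * \<xi>)) y)
      = hmul z (hmul (hmul (hc (- of_int k * \<xi>)) (hc (of_int k * \<xi>))) y)"
      by (simp add: f_def hmul_assoc)
    also have "\<dots> = hmul z y" by (simp add: hc_simps)
    also have "\<dots> = g" by (simp add: z_def hmul_assoc)
    finally show ?thesis by simp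
  qed
  ultimately show "\<exists>f\<in>Wdom a b \<xi>. \<exists>l\<in>L. g = hmul f l" by blast
next
  note L = latD[OF assms]
  fix f f' l l'
  assume f: "f \<in> Wdom a b \<xi>" "f' \<in> Wdom a b \<xi>" and l: "l \<in> L" "l' \<in> L" and eq: "hmul f l = hmul f' l'"
  define x where "x = hmul l' (hinv l)"
  have x: "x \<in> L" "f = hmul f' x"
    using l hsubgroup_hmul[OF L(1)] hsubgroup_hinv[OF L(1)] eq
    by (auto simp: x_def simp flip: hmul_assoc) (simp add: eq[symmetric] hmul_assoc)
  obtain m n :: int where mn: "fst x = of_int m * fst a + of_int n * fst b"
        "fst (snd x) = of_int m * fst (snd a) + of_int n * fst (snd b)"
    using L(8)[OF x(1)] by blast
  have "hdet f b / hdet a b = hdet f' b / hdet a b + m" "hdet a f / hdet a b = hdet a f' / hdet a b + n"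
    using hdet_left_combination[OF mn] L(5) by (simp_all add: x(2) hdet_hmul add_divide_distrib)
  with f have "\<bar>real_of_int m\<bar> < 1" "\<bar>real_of_int n\<bar> < 1" unfolding Wdom_def by auto
  then have "m = 0" "n = 0" by linarith+
  with mn have x0: "x = hc (snd (snd x))"
    by (metis add.right_neutral fst_hc fst_snd_hc mult_eq_0_iff of_int_0 prod.collapse snd_snd_hc)
  then obtain k :: int where k: "snd (snd x) = of_int k * \<xi>"
    using L(7)[of "snd (snd x)"] x(1) by auto
  have "snd (snd f) = snd (snd f') + k * \<xi>"
    using k x0 by (subst x(2), subst x0) (simp add: hmul_eq)
  moreover have "\<bar>snd (snd f) - snd (snd f')\<bar> < \<xi>" using f unfolding Wdom_def by auto
  ultimately have "\<bar>real_of_int k\<bar> * \<xi> < 1 * \<xi>" using L(6) by (simp add: abs_mult)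
  then have "k = 0" using L(6) by (simp only: mult_less_cancel_right) linarith
  then show "f = f'" using x(2) x0 k by (simp add: hc_simps)
qed (rule Wdom_sets)

definition hconj :: "h3 \<Rightarrow> h3 set \<Rightarrow> h3 set" where
  "hconj g L = (\<lambda>x. hmul (hmul g x) (hinv g)) ` L"

text \<open>Conjugation multiplies each element by a central factor, so projections persist; it
  fixes the elements with trivial projection, so the centre persists too.\<close>

lemma lat_hconj:
  assumes "lat L a b \<xi>"
  shows "lat (hconj g L) (hmul a (hc (hdet g a))) (hmul b (hc (hdet g b))) \<xi>"
proof -
  note L = latD[OF assms]
  have "hsubgroup (hconj g L)"
  proof (rule hsubgroupI)
    have "hmul (hmul g hone) (hinv g) = hone" by simp
    then show "hone \<in> hconj g L" using hsubgroup_hone[OF L(1)] unfolding hconj_def by (metis imageI)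
    show "hmul x y \<in> hconj g L" if xy: "x \<in> hconj g L" "y \<in> hconj g L" for x y
    proof -
      obtain x' y' where "x' \<in> L" "y' \<in> L" "x = hmul (hmul g x') (hinv g)" "y = hmul (hmul g y') (hinv g)"
        using xy unfolding hconj_def by blast
      then have "hmul x y = hmul (hmul g (hmul x' y')) (hinv g)" "hmul x' y' \<in> L"
        using hsubgroup_hmul[OF L(1)] by (simp_all add: hmul_assoc)
      then show ?thesis unfolding hconj_def by blast
    qed
    show "hinv x \<in> hconj g L" if x: "x \<in> hconj g L" for x
    proof -
      obtain x' where "x' \<in> L" "x = hmul (hmul g x') (hinv g)"
        using x unfolding hconj_def by blast
      then have "hinv x = hmul (hmul g (hinv x')) (hinv g)" "hinv x' \<in> L"
        using hsubgroup_hinv[OF L(1)] by (simp_all add: hmul_assoc hinv_hmul)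
      then show ?thesis unfolding hconj_def by blast
    qed
  qed
  moreover have "hc t \<in> hconj g L \<longleftrightarrow> hc t \<in> L" for t
  proof
    assume "hc t \<in> hconj g L"
    then obtain x where x: "x \<in> L" "hc t = hmul x (hc (hdet g x))"
      unfolding hconj_def hconj_eq by blast
    then have "fst x = 0" "fst (snd x) = 0" by (metis add_0_right fst_hmul fst_hc, metis add_0_right fst_snd_hmul fst_snd_hc)
    then have "hdet g x = 0" by (simp add: hdet_def)
    with x show "hc t \<in> L" by (simp add: hc_simps)
  next
    assume "hc t \<in> L"
    moreover have "hc t = hmul (hc t) (hc (hdet g (hc t)))" by (simp add: hdet_hc hc_simps)
    ultimately show "hc t \<in> hconj g L" unfolding hconj_def hconj_eq by (metis (no_types, lifting) imageI)
  qed
  ultimately show ?thesis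
    using L(2-8) unfolding lat_def
    by (simp add: hconj_def hconj_eq hdet_hmul hdet_hc)
qed

text \<open>The right translate of a set by \<open>y\<close> is a domain for \<open>L\<close> if the
  set itself is one for \<open>hconj y L\<close>, and the box is the same for both lattices.\<close>

lemma lat_fdom_right:
  assumes "lat L a b \<xi>"
  shows "fdom L ((\<lambda>x. hmul x y) ` Wdom a b \<xi>)"
proof -
  have "Wdom (hmul a (hc (hdet y a))) (hmul b (hc (hdet y b))) \<xi> = Wdom a b \<xi>"
    by (simp add: Wdom_def hdet_hmul hdet_hc)
  then have W: "fdom (hconj y L) (Wdom a b \<xi>)"
    using lat_fdom[OF lat_hconj[OF assms, of y]] by simp
  show ?thesis
  proof (rule fdomI)
    show "(\<lambda>x. hmul x y) ` Wdom a b \<xi> \<in> sets borel"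
      using Wdom_sets by (simp add: hmul_image_eq_vimage sets_hmul_vimage)
    fix g
    obtain f l where "f \<in> Wdom a b \<xi>" "l \<in> hconj y L" "hmul g (hinv y) = hmul f l"
      using fdom_ex[OF W] by blast
    then obtain l' where f: "f \<in> Wdom a b \<xi>" "l' \<in> L" "hmul g (hinv y) = hmul f (hmul (hmul y l') (hinv y))"
      unfolding hconj_def by blast
    then have "g = hmul (hmul f y) l'" by (simp flip: hmul_assoc)
    with f show "\<exists>f\<in>(\<lambda>x. hmul x y) ` Wdom a b \<xi>. \<exists>l\<in>L. g = hmul f l" by blast
  next
    fix f f' l l'
    assume "f \<in> (\<lambda>x. hmul x y) ` Wdom a b \<xi>" "f' \<in> (\<lambda>x. hmul x y) ` Wdom a b \<xi>"
      and l: "l \<in> L" "l' \<in> L" "hmul f l = hmul f' l'"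
    then obtain e e' where e: "e \<in> Wdom a b \<xi>" "f = hmul e y" "e' \<in> Wdom a b \<xi>" "f' = hmul e' y" by blast
    have "hmul e (hmul (hmul y l) (hinv y)) = hmul e' (hmul (hmul y l') (hinv y))"
      using l(3) e by (simp flip: hmul_assoc)
    then have "e = e'"
      using fdom_unique(1)[OF W e(1,3)] l(1,2) unfolding hconj_def by blast
    then show "f = f'" using e by simp
  qed
qed

lemma lat_hlattice: "lat L a b \<xi> \<Longrightarrow> hdiscrete L \<Longrightarrow> hlattice L"
  unfolding hlattice_def finite_covolume_iff
  using lat_fdom Wdom_finite latD(1,5) by blast

subsection \<open>The invariant measure on a quotient\<close>

declare split_paired_All [simp del] split_paired_Ex [simp del]

definition qmap :: "h3 set \<Rightarrow> h3 \<Rightarrow> h3 set" where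
  "qmap L y = lcoset y L"

lemma mem_qmap: "x \<in> qmap L y \<longleftrightarrow> hmul (hinv y) x \<in> L"
  unfolding qmap_def lcoset_def by (metis hmul_hinv_cancel image_iff)

lemma hquot_eq_range: "hquot L = range (qmap L)"
  by (auto simp: hquot_def qmap_def)

lemma qmap_in_hquot [simp]: "qmap L y \<in> hquot L"
  by (simp add: hquot_eq_range)

lemma qmap_eq_iff:
  assumes "hsubgroup L"
  shows "qmap L x = qmap L y \<longleftrightarrow> hmul (hinv x) y \<in> L"
proof
  assume "qmap L x = qmap L y"
  then have "y \<in> qmap L x" using hsubgroup_hone[OF assms] by (simp add: mem_qmap)
  then show "hmul (hinv x) y \<in> L" by (simp add: mem_qmap)
next
  assume *: "hmul (hinv x) y \<in> L"
  show "qmap L x = qmap L y"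
  proof (rule set_eqI)
    fix z
    have "hmul (hinv x) z = hmul (hmul (hinv x) y) (hmul (hinv y) z)"
      by (simp add: hmul_assoc)
    then show "z \<in> qmap L x \<longleftrightarrow> z \<in> qmap L y"
      using hmul_mem_iff(2)[OF assms *, of "hmul (hinv y) z"] by (simp only: mem_qmap)
  qed
qed

lemma mem_qmap_iff: "hsubgroup L \<Longrightarrow> x \<in> qmap L y \<longleftrightarrow> qmap L x = qmap L y"
  using qmap_eq_iff[of L y x] by (auto simp: mem_qmap)

lemma qmap_hmul_right: "hsubgroup L \<Longrightarrow> l \<in> L \<Longrightarrow> qmap L (hmul x l) = qmap L x"
  by (metis hmul_hinv_cancel(2) qmap_eq_iff)

lemma coset_translate_qmap [simp]: "coset_translate g (qmap L y) = qmap L (hmul g y)"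
  unfolding coset_translate_def qmap_def lcoset_def image_image by (simp add: hmul_assoc)

lemma Union_eq_vimage_qmap:
  assumes "hsubgroup L" "E \<subseteq> hquot L"
  shows "\<Union>E = qmap L -` E"
proof (rule set_eqI)
  fix x
  have "x \<in> C \<longleftrightarrow> qmap L x = C" if "C \<in> E" for C
    using that assms mem_qmap_iff[OF assms(1)] unfolding hquot_eq_range by blast
  then show "x \<in> \<Union>E \<longleftrightarrow> x \<in> qmap L -` E" by blast
qed

text \<open>The generating family is already a sigma-algebra, because the union of a set of cosets
  is its preimage under the quotient map. It is the final sigma-algebra of that map.\<close>

lemma quot_space_sets:
  assumes L: "hsubgroup L"
  shows "space (quot_space L) = hquot L"
    and "sets (quot_space L) = {E. E \<subseteq> hquot L \<and> qmap L -` E \<in> sets borel}"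
proof -
  have eq: "{E. E \<subseteq> hquot L \<and> \<Union>E \<in> sets borel} = {E. E \<subseteq> hquot L \<and> qmap L -` E \<in> sets borel}"
    using Union_eq_vimage_qmap[OF L] by (metis (no_types, lifting))
  have "sigma_algebra (hquot L) {E. E \<subseteq> hquot L \<and> qmap L -` E \<in> sets borel}"
    unfolding sigma_algebra_iff2
  proof (intro conjI ballI allI impI)
    fix s assume "s \<in> {E. E \<subseteq> hquot L \<and> qmap L -` E \<in> sets borel}"
    then have "qmap L -` s \<in> sets borel" by simp
    then have "space borel - qmap L -` s \<in> sets borel" by (rule sets.compl_sets)
    moreover have "qmap L -` (hquot L - s) = space borel - qmap L -` s" by auto
    ultimately show "hquot L - s \<in> {E. E \<subseteq> hquot L \<and> qmap L -` E \<in> sets borel}" by auto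
  next
    fix A :: "nat \<Rightarrow> h3 set set" assume A: "range A \<subseteq> {E. E \<subseteq> hquot L \<and> qmap L -` E \<in> sets borel}"
    then have "(\<Union>i. qmap L -` A i) \<in> sets borel" by (intro sets.countable_UN) blast
    with A show "(\<Union>i. A i) \<in> {E. E \<subseteq> hquot L \<and> qmap L -` E \<in> sets borel}"
      by (simp add: vimage_UN image_subset_iff SUP_le_iff)
  next
    show "{} \<in> {E. E \<subseteq> hquot L \<and> qmap L -` E \<in> sets borel}" by simp
    show "{E. E \<subseteq> hquot L \<and> qmap L -` E \<in> sets borel} \<subseteq> Pow (hquot L)" by blast
  qed
  then show "sets (quot_space L) = {E. E \<subseteq> hquot L \<and> qmap L -` E \<in> sets borel}"
    unfolding quot_space_def eq by (simp add: sigma_algebra.sets_measure_of_eq)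
  show "space (quot_space L) = hquot L"
    unfolding quot_space_def by (rule space_measure_of) auto
qed

lemma measurable_qmap [measurable]:
  assumes "hsubgroup L" shows "qmap L \<in> borel \<rightarrow>\<^sub>M quot_space L"
  by (rule measurableI) (auto simp: quot_space_sets[OF assms])

text \<open>The universal property of the final sigma-algebra.\<close>

lemma measurable_from_quot:
  assumes L: "hsubgroup L" and f: "(\<lambda>y. f (qmap L y)) \<in> borel \<rightarrow>\<^sub>M N"
  shows "f \<in> quot_space L \<rightarrow>\<^sub>M N"
proof (rule measurableI)
  fix C assume "C \<in> space (quot_space L)"
  then show "f C \<in> space N"
    using measurable_space[OF f] by (auto simp: quot_space_sets[OF L] hquot_eq_range)
next
  fix A assume "A \<in> sets N"
  from measurable_sets[OF f this]
  show "f -` A \<inter> space (quot_space L) \<in> sets (quot_space L)"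
    by (simp add: quot_space_sets[OF L] vimage_def)
qed

section \<open>Borel sections of the quotient map\<close>

definition sec :: "h3 set \<Rightarrow> h3 set \<Rightarrow> h3" where
  "sec F C = (THE f. f \<in> F \<and> f \<in> C)"

lemma fdom_meets:
  assumes "fdom L F" "hsubgroup L"
  shows "\<exists>!f. f \<in> F \<and> f \<in> qmap L y"
proof -
  obtain f l where f: "f \<in> F" "l \<in> L" "y = hmul f l" using fdom_ex[OF assms(1)] by blast
  show ?thesis
  proof (rule ex1I[of _ f])
    show "f \<in> F \<and> f \<in> qmap L y"
      using f hsubgroup_hinv[OF assms(2)] by (simp add: mem_qmap hinv_hmul hmul_assoc)
    fix f' assume f': "f' \<in> F \<and> f' \<in> qmap L y"
    then have "hmul f' hone = hmul f (hmul l (hmul (hinv y) f'))"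
      using f by (simp add: hinv_hmul hmul_assoc)
    then show "f' = f"
      using f' f(1,2) fdom_unique(1)[OF assms(1), of f' f hone "hmul l (hmul (hinv y) f')"]
        hsubgroup_hone[OF assms(2)] hsubgroup_hmul[OF assms(2)] by (simp add: mem_qmap)
  qed
qed

lemma sec_qmap:
  assumes "fdom L F" "hsubgroup L"
  shows "sec F (qmap L y) \<in> F" "qmap L (sec F (qmap L y)) = qmap L y"
    and "f \<in> F \<Longrightarrow> qmap L f = qmap L y \<Longrightarrow> sec F (qmap L y) = f"
proof -
  have *: "sec F (qmap L y) \<in> F \<and> sec F (qmap L y) \<in> qmap L y"
    unfolding sec_def by (rule theI'[OF fdom_meets[OF assms]])
  then show "sec F (qmap L y) \<in> F" "qmap L (sec F (qmap L y)) = qmap L y"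
    using mem_qmap_iff[OF assms(2)] by blast+
  show "sec F (qmap L y) = f" if "f \<in> F" "qmap L f = qmap L y"
    using fdom_meets[OF assms, of y] * that mem_qmap_iff[OF assms(2)] by blast
qed

text \<open>Composed with the quotient map, the preimage of \<open>A\<close> is the saturation of
  \<open>A \<inter> F\<close>, a countable union of right translates by lattice elements.\<close>

lemma measurable_sec:
  assumes F: "fdom L F" and L: "hsubgroup L" "countable L"
  shows "sec F \<in> quot_space L \<rightarrow>\<^sub>M borel"
proof (rule measurable_from_quot[OF L(1)], rule measurableI)
  fix A :: "h3 set" assume A: "A \<in> sets borel"
  have "(\<lambda>y. sec F (qmap L y)) -` A \<inter> space borel = (\<Union>l\<in>L. (\<lambda>y. hmul y l) -` (A \<inter> F))"
  proof (rule set_eqI)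
    fix y
    define l where "l = hmul (hinv y) (sec F (qmap L y))"
    have l: "l \<in> L" "hmul y l = sec F (qmap L y)"
      using sec_qmap(2)[OF F L(1), of y] qmap_eq_iff[OF L(1), of y "sec F (qmap L y)"] by (simp_all add: l_def)
    have "sec F (qmap L y) = hmul y l'" if "l' \<in> L" "hmul y l' \<in> F" for l'
      by (rule sec_qmap(3)[OF F L(1) that(2)]) (rule qmap_hmul_right[OF L(1) that(1)])
    then have "(\<exists>l'\<in>L. hmul y l' \<in> A \<and> hmul y l' \<in> F) \<longleftrightarrow> sec F (qmap L y) \<in> A"
      using l sec_qmap(1)[OF F L(1), of y] by force
    then show "y \<in> (\<lambda>y. sec F (qmap L y)) -` A \<inter> space borel \<longleftrightarrow> y \<in> (\<Union>l\<in>L. (\<lambda>y. hmul y l) -` (A \<inter> F))"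
      by simp
  qed
  also have "\<dots> \<in> sets borel"
    using A fdom_sets[OF F] L(2) by (intro sets.countable_UN' sets_hmul_vimage) auto
  finally show "(\<lambda>y. sec F (qmap L y)) -` A \<inter> space borel \<in> sets borel" .
qed simp

text \<open>Fubini asks for measurability in the group element and the coset jointly, whereas the
  universal property handles the coset alone. The section rewrites the action as multiplication in
  the group, which is jointly measurable.\<close>

lemma measurable_coset_translate_pair:
  assumes F: "fdom L F" and L: "hsubgroup L" "countable L"
  shows "(\<lambda>(g, C). coset_translate g C) \<in> borel \<Otimes>\<^sub>M quot_space L \<rightarrow>\<^sub>M quot_space L"
proof -
  note [measurable] = measurable_sec[OF F L] measurable_qmap[OF L(1)]
  have "(\<lambda>(g, C). qmap L (hmul g (sec F C))) \<in> borel \<Otimes>\<^sub>M quot_space L \<rightarrow>\<^sub>M quot_space L"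
    by measurable
  moreover have "(\<lambda>(g, C). qmap L (hmul g (sec F C))) z = (\<lambda>(g, C). coset_translate g C) z"
    if zs: "z \<in> space (borel \<Otimes>\<^sub>M quot_space L)" for z
  proof -
    have "snd z \<in> range (qmap L)"
      using zs by (simp add: space_pair_measure quot_space_sets[OF L(1)] hquot_eq_range mem_Times_iff)
    then obtain g y where z: "z = (g, qmap L y)" by (metis imageE prod.collapse)
    have "qmap L (hmul g (sec F (qmap L y))) = coset_translate g (qmap L (sec F (qmap L y)))"
      by simp
    then show ?thesis unfolding z using sec_qmap(2)[OF F L(1), of y] by simp
  qed
  ultimately show ?thesis using measurable_cong by blast
qed

lemma measurable_coset_translate [measurable]:
  assumes "hsubgroup L"
  shows "coset_translate g \<in> quot_space L \<rightarrow>\<^sub>M quot_space L"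
proof -
  note [measurable] = measurable_qmap[OF assms]
  show ?thesis by (rule measurable_from_quot[OF assms]) simp
qed

section \<open>Uniqueness and existence of the invariant probability\<close>

definition inv_prob :: "h3 set \<Rightarrow> h3 set measure \<Rightarrow> bool" where
  "inv_prob L \<mu> \<longleftrightarrow> prob_space \<mu> \<and> sets \<mu> = sets (quot_space L) \<and>
      (\<forall>g. \<forall>E \<in> sets \<mu>. emeasure \<mu> (coset_translate g -` E \<inter> space \<mu>) = emeasure \<mu> E)"

lemma right_invariant_vimage_qmap: "hsubgroup L \<Longrightarrow> right_invariant L (qmap L -` E)"
  by (simp add: right_invariant_def qmap_hmul_right)

text \<open>Average the invariance identity over \<open>g\<close> in the fundamental domain \<open>W\<close> and use that every
  right translate of \<open>W\<close> is again a fundamental domain.\<close>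
lemma inv_prob_emeasure:
  assumes lat: "lat L a b \<xi>" and \<mu>: "inv_prob L \<mu>" and E: "E \<in> sets (quot_space L)"
  shows "emeasure \<mu> E * emeasure lborel (Wdom a b \<xi>) = emeasure lborel (Wdom a b \<xi> \<inter> qmap L -` E)"
proof -
  note L = latD(1,2)[OF lat]
  define W where "W = Wdom a b \<xi>"
  have W: "fdom L W" unfolding W_def by (rule lat_fdom[OF lat])
  have [measurable]: "W \<in> sets borel" using fdom_sets[OF W] .
  interpret prob_space \<mu> using \<mu> by (simp add: inv_prob_def)
  interpret pair_sigma_finite lborel \<mu> ..
  have sets_\<mu> [measurable_cong]: "sets \<mu> = sets (quot_space L)" using \<mu> by (simp add: inv_prob_def)
  have sp: "space \<mu> = hquot L"
    using sets_eq_imp_space_eq[OF sets_\<mu>] quot_space_sets(1)[OF L(1)] by simp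
  have E' [measurable]: "E \<in> sets \<mu>" "qmap L -` E \<in> sets borel"
    using E sets_\<mu> by (auto simp: quot_space_sets(2)[OF L(1)])
  note [measurable] = measurable_coset_translate_pair[OF W L]
  have m: "(\<lambda>(g, C). indicator E (coset_translate g C) * indicator W g :: ennreal)
     \<in> borel_measurable (lborel \<Otimes>\<^sub>M \<mu>)"
    by measurable
  have "emeasure \<mu> E * emeasure lborel W = (\<integral>\<^sup>+g. emeasure \<mu> E * indicator W g \<partial>lborel)"
    by (subst nn_integral_cmult_indicator) simp_all
  also have "\<dots> = (\<integral>\<^sup>+g. (\<integral>\<^sup>+C. indicator E (coset_translate g C) * indicator W g \<partial>\<mu>) \<partial>lborel)"
  proof (rule nn_integral_cong)
    fix g
    have ct: "coset_translate g \<in> \<mu> \<rightarrow>\<^sub>M quot_space L"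
      using measurable_coset_translate[OF L(1)] measurable_cong_sets[OF sets_\<mu> refl] by blast
    note [measurable] = ct
    have "emeasure \<mu> E = emeasure \<mu> (coset_translate g -` E \<inter> space \<mu>)"
      using \<mu> E'(1) by (simp add: inv_prob_def)
    also have "\<dots> = (\<integral>\<^sup>+C. indicator (coset_translate g -` E \<inter> space \<mu>) C \<partial>\<mu>)"
      using measurable_sets[OF ct E] by simp
    also have "\<dots> = (\<integral>\<^sup>+C. indicator E (coset_translate g C) \<partial>\<mu>)"
      by (intro nn_integral_cong) (simp split: split_indicator)
    finally show "emeasure \<mu> E * indicator W g = (\<integral>\<^sup>+C. indicator E (coset_translate g C) * indicator W g \<partial>\<mu>)"
      using E by (subst nn_integral_multc) simp_all
  qed
  also have "\<dots> = (\<integral>\<^sup>+C. (\<integral>\<^sup>+g. indicator E (coset_translate g C) * indicator W g \<partial>lborel) \<partial>\<mu>)"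
    using Fubini[OF m] by simp
  \<comment> \<open>For \<open>C = qmap L y\<close> the inner integral is the volume of the
    \<open>g\<close> in \<open>W\<close> for which the coset of \<open>hmul g y\<close> lies in
    \<open>E\<close>; it turns out not to depend on \<open>y\<close>.\<close>
  also have "\<dots> = (\<integral>\<^sup>+C. emeasure lborel (W \<inter> qmap L -` E) \<partial>\<mu>)"
  proof (rule nn_integral_cong)
    fix C assume "C \<in> space \<mu>"
    then obtain y where y: "C = qmap L y" by (auto simp: sp hquot_eq_range)
    have "(\<integral>\<^sup>+g. indicator E (coset_translate g C) * indicator W g \<partial>lborel)
      = (\<integral>\<^sup>+g. indicator (W \<inter> (\<lambda>g. hmul g y) -` (qmap L -` E)) g \<partial>lborel)"
      by (intro nn_integral_cong) (simp add: y split: split_indicator)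
    also have "\<dots> = emeasure lborel (W \<inter> (\<lambda>g. hmul g y) -` (qmap L -` E))"
      using sets_hmul_vimage(2)[OF E'(2), of y] by simp
    also have "W \<inter> (\<lambda>g. hmul g y) -` (qmap L -` E) = (\<lambda>g. hmul g y) -` ((\<lambda>g. hmul g y) ` W \<inter> qmap L -` E)"
      by auto
    also have "emeasure lborel \<dots> = emeasure lborel ((\<lambda>g. hmul g y) ` W \<inter> qmap L -` E)"
      using E'(2) fdom_sets[OF lat_fdom_right[OF lat, of y]]
      by (intro emeasure_hmul_vimage(2)) (auto simp: W_def)
    also have "\<dots> = emeasure lborel (W \<inter> qmap L -` E)"
      by (rule fdom_emeasure_eq[OF L _ W E'(2) right_invariant_vimage_qmap[OF L(1)]])
        (use lat_fdom_right[OF lat, of y] in \<open>simp add: W_def\<close>)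
    finally show "(\<integral>\<^sup>+g. indicator E (coset_translate g C) * indicator W g \<partial>lborel) = emeasure lborel (W \<inter> qmap L -` E)" .
  qed
  also have "\<dots> = emeasure lborel (W \<inter> qmap L -` E)"
    by (simp add: emeasure_space_1)
  finally show ?thesis unfolding W_def .
qed

lemma Wdom_pos: "lat L a b \<xi> \<Longrightarrow> emeasure lborel (Wdom a b \<xi>) \<noteq> 0"
  using fdom_emeasure_pos[where B = UNIV and F = "Wdom a b \<xi>" and L = L] lat_fdom latD(1,2)
  by (simp add: right_invariant_def)

lemma inv_prob_unique:
  assumes "hlattice L" "inv_prob L \<mu>" "inv_prob L \<nu>"
  shows "\<mu> = \<nu>"
proof -
  obtain a b \<xi> where lat: "lat L a b \<xi>" using hlattice_lat[OF assms(1)] by blast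
  show ?thesis
  proof (rule measure_eqI)
    show "sets \<mu> = sets \<nu>" using assms by (simp add: inv_prob_def)
    fix E assume "E \<in> sets \<mu>"
    then have "E \<in> sets (quot_space L)" using assms by (simp add: inv_prob_def)
    from inv_prob_emeasure[OF lat assms(2) this] inv_prob_emeasure[OF lat assms(3) this]
    have "emeasure \<mu> E * emeasure lborel (Wdom a b \<xi>) = emeasure \<nu> E * emeasure lborel (Wdom a b \<xi>)" by simp
    then show "emeasure \<mu> E = emeasure \<nu> E"
      using Wdom_pos[OF lat] Wdom_finite[OF latD(5)[OF lat], of \<xi>]
      by (metis ennreal_mult_divide_eq less_irrefl infinity_ennreal_def)
  qed
qed

text \<open>Left translation by \<open>g\<close> replaces the box by another fundamental domain,
  which meets the \<open>L\<close>-invariant preimage of a set of cosets in the same volume.\<close>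

lemma inv_prob_uniform:
  assumes lat: "lat L a b \<xi>"
  shows "inv_prob L (distr (uniform_measure lborel (Wdom a b \<xi>)) (quot_space L) (qmap L))"
proof -
  note L = latD(1,2)[OF lat]
  define W where "W = Wdom a b \<xi>"
  have W: "fdom L W" unfolding W_def by (rule lat_fdom[OF lat])
  have Ws: "W \<in> sets borel" using fdom_sets[OF W] .
  have Wm: "emeasure lborel W \<noteq> 0" "emeasure lborel W \<noteq> \<infinity>"
    using Wdom_pos[OF lat] Wdom_finite[OF latD(5)[OF lat], of \<xi>] by (auto simp: W_def)
  define U where "U = uniform_measure lborel W"
  interpret U: prob_space U
    unfolding U_def by (rule prob_space_uniform_measure[OF Wm])
  have q: "qmap L \<in> U \<rightarrow>\<^sub>M quot_space L"
    using measurable_qmap[OF L(1)] by (simp add: U_def measurable_def)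
  define \<mu> where "\<mu> = distr U (quot_space L) (qmap L)"
  have em: "emeasure \<mu> E = emeasure lborel (W \<inter> qmap L -` E) / emeasure lborel W"
    if E: "E \<in> sets (quot_space L)" for E
  proof -
    have "emeasure \<mu> E = emeasure U (qmap L -` E)"
      unfolding \<mu>_def using emeasure_distr[OF q E] by (simp add: U_def)
    also have "\<dots> = emeasure lborel (W \<inter> qmap L -` E) / emeasure lborel W"
      unfolding U_def using Ws E by (subst emeasure_uniform_measure) (auto simp: quot_space_sets(2)[OF L(1)])
    finally show ?thesis .
  qed
  have "inv_prob L \<mu>"
    unfolding inv_prob_def
  proof (intro conjI allI ballI)
    show "prob_space \<mu>" unfolding \<mu>_def by (rule U.prob_space_distr[OF q])
    show "sets \<mu> = sets (quot_space L)" by (simp add: \<mu>_def)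
    fix g E assume "E \<in> sets \<mu>"
    then have E: "E \<in> sets (quot_space L)" by (simp add: \<mu>_def)
    have E2: "qmap L -` E \<in> sets borel" using E by (simp add: quot_space_sets(2)[OF L(1)])
    have sp: "space \<mu> = space (quot_space L)" by (simp add: \<mu>_def)
    have v: "qmap L -` (coset_translate g -` E \<inter> space \<mu>) = hmul g -` (qmap L -` E)"
      by (simp add: sp quot_space_sets(1)[OF L(1)] vimage_def)
    have "emeasure lborel (W \<inter> hmul g -` (qmap L -` E))
      = emeasure lborel (hmul g -` (hmul g ` W \<inter> qmap L -` E))"
      by (rule arg_cong[where f = "emeasure lborel"]) auto
    also have "\<dots> = emeasure lborel (hmul g ` W \<inter> qmap L -` E)"
      using E2 fdom_sets[OF fdom_left_translate[OF W]] by (intro emeasure_hmul_vimage(1)) auto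
    also have "\<dots> = emeasure lborel (W \<inter> qmap L -` E)"
      by (rule fdom_emeasure_eq[OF L fdom_left_translate[OF W] W E2 right_invariant_vimage_qmap[OF L(1)]])
    finally show "emeasure \<mu> (coset_translate g -` E \<inter> space \<mu>) = emeasure \<mu> E"
      using em[OF E] em[OF measurable_sets[OF measurable_coset_translate[OF L(1)] E, of g]]
      unfolding sp[symmetric] v by simp
  qed
  then show ?thesis unfolding \<mu>_def U_def W_def .
qed

lemma inv_prob_exists: "hlattice L \<Longrightarrow> \<exists>\<mu>. inv_prob L \<mu>"
  using hlattice_lat inv_prob_uniform by blast

lemma inv_prob_quot_measure:
  assumes "hlattice L"
  shows "inv_prob L (quot_measure L)"
proof -
  have "quot_measure L = (THE \<mu>. inv_prob L \<mu>)"
    unfolding quot_measure_def inv_prob_def ..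
  then show ?thesis
    using theI'[of "inv_prob L"] inv_prob_exists[OF assms] inv_prob_unique[OF assms] by metis
qed

lemma quot_measure_eqI: "hlattice L \<Longrightarrow> inv_prob L \<mu> \<Longrightarrow> \<mu> = quot_measure L"
  using inv_prob_unique inv_prob_quot_measure by blast

subsection \<open>Lifting invariant measures to sublattices\<close>

lemma inv_prob_distr:
  assumes "hsubgroup L" "inv_prob L \<nu>"
  shows "distr \<nu> (quot_space L) (coset_translate g) = \<nu>"
proof (rule measure_eqI)
  have s: "sets \<nu> = sets (quot_space L)" using assms by (simp add: inv_prob_def)
  then show "sets (distr \<nu> (quot_space L) (coset_translate g)) = sets \<nu>" by simp
  fix E assume "E \<in> sets (distr \<nu> (quot_space L) (coset_translate g))"
  then have E: "E \<in> sets (quot_space L)" by simp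
  have "coset_translate g \<in> \<nu> \<rightarrow>\<^sub>M quot_space L"
    using measurable_coset_translate[OF assms(1)] measurable_cong_sets[OF s refl] by blast
  from emeasure_distr[OF this E] show "emeasure (distr \<nu> (quot_space L) (coset_translate g)) E = emeasure \<nu> E"
    using assms(2) E s by (simp add: inv_prob_def)
qed

lemma inv_probI:
  assumes "hsubgroup L" "prob_space \<nu>" "sets \<nu> = sets (quot_space L)"
    "\<And>g. distr \<nu> (quot_space L) (coset_translate g) = \<nu>"
  shows "inv_prob L \<nu>"
  unfolding inv_prob_def
proof (intro conjI allI ballI)
  fix g E assume E: "E \<in> sets \<nu>"
  have "coset_translate g \<in> \<nu> \<rightarrow>\<^sub>M quot_space L"
    using measurable_coset_translate[OF assms(1)] measurable_cong_sets[OF assms(3) refl] by blast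
  from emeasure_distr[OF this, of E] show "emeasure \<nu> (coset_translate g -` E \<inter> space \<nu>) = emeasure \<nu> E"
    using E by (simp add: assms(3,4))
qed (use assms in auto)

text \<open>The natural map from cosets of a sublattice to cosets of \<open>K\<close>. The
  sublattice is not an argument, since any point of the given coset determines the larger
  one.\<close>

definition red :: "h3 set \<Rightarrow> h3 set \<Rightarrow> h3 set" where
  "red K C = qmap K (SOME y. y \<in> C)"

lemma red_qmap:
  assumes "hsubgroup L" "hsubgroup K" "L \<subseteq> K"
  shows "red K (qmap L y) = qmap K y"
proof -
  have "(SOME z. z \<in> qmap L y) \<in> qmap L y"
    by (rule someI[of _ y]) (simp add: mem_qmap hsubgroup_hone[OF assms(1)])
  then have "(SOME z. z \<in> qmap L y) \<in> qmap K y"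
    using assms(3) by (auto simp: mem_qmap)
  then show ?thesis
    unfolding red_def using mem_qmap_iff[OF assms(2)] by blast
qed

lemma measurable_red:
  assumes "hsubgroup L" "hsubgroup K" "L \<subseteq> K"
  shows "red K \<in> quot_space L \<rightarrow>\<^sub>M quot_space K"
  by (rule measurable_from_quot[OF assms(1)])
    (simp add: red_qmap[OF assms] measurable_qmap[OF assms(2)])

text \<open>Reduction commutes with the translations, so the image of the invariant probability is
  again an invariant probability, and uniqueness identifies it.\<close>

lemma distr_red_quot_measure:
  assumes L: "hlattice L" and K: "hlattice K" and LK: "L \<subseteq> K"
  shows "distr (quot_measure L) (quot_space K) (red K) = quot_measure K"
proof (rule quot_measure_eqI[OF K])
  have sL: "hsubgroup L" and sK: "hsubgroup K" using L K by (auto simp: hlattice_def)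
  have inv: "inv_prob L (quot_measure L)" by (rule inv_prob_quot_measure[OF L])
  have s: "sets (quot_measure L) = sets (quot_space L)" using inv by (simp add: inv_prob_def)
  interpret prob_space "quot_measure L" using inv by (simp add: inv_prob_def)
  have m [measurable]: "red K \<in> quot_measure L \<rightarrow>\<^sub>M quot_space K"
    using measurable_red[OF sL sK LK] measurable_cong_sets[OF s refl] by blast
  show "inv_prob K (distr (quot_measure L) (quot_space K) (red K))"
  proof (rule inv_probI[OF sK])
    show "prob_space (distr (quot_measure L) (quot_space K) (red K))" by (rule prob_space_distr[OF m])
    fix g
    have "distr (distr (quot_measure L) (quot_space K) (red K)) (quot_space K) (coset_translate g)
      = distr (quot_measure L) (quot_space K) (coset_translate g \<circ> red K)"
      by (rule distr_distr[OF measurable_coset_translate[OF sK] m])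
    also have "\<dots> = distr (quot_measure L) (quot_space K) (red K \<circ> coset_translate g)"
    proof (rule distr_cong[OF refl refl])
      fix C assume "C \<in> space (quot_measure L)"
      then obtain y where "C = qmap L y"
        using sets_eq_imp_space_eq[OF s] by (auto simp: quot_space_sets[OF sL] hquot_eq_range)
      then show "(coset_translate g \<circ> red K) C = (red K \<circ> coset_translate g) C"
        by (simp add: red_qmap[OF sL sK LK])
    qed
    also have "\<dots> = distr (distr (quot_measure L) (quot_space L) (coset_translate g)) (quot_space K) (red K)"
      using measurable_coset_translate[OF sL] measurable_cong_sets[OF s refl]
      by (intro distr_distr[symmetric] measurable_red[OF sL sK LK]) blast
    finally show "distr (distr (quot_measure L) (quot_space K) (red K)) (quot_space K) (coset_translate g)
       = distr (quot_measure L) (quot_space K) (red K)"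
      by (simp add: inv_prob_distr[OF sL inv])
  qed simp
qed

text \<open>A transversal of \<open>L / L'\<close>: successive choices from such sets are the digits
  in an expansion of a point of the inverse limit.\<close>

definition digits :: "h3 set \<Rightarrow> h3 set \<Rightarrow> h3 set \<Rightarrow> bool" where
  "digits L L' D \<longleftrightarrow> finite D \<and> D \<subseteq> L \<and> (\<forall>l\<in>L. \<exists>!d. d \<in> D \<and> hmul (hinv d) l \<in> L')"

text \<open>Translates of a fundamental domain of \<open>L\<close> by coset representatives form a fundamental
  domain of \<open>L'\<close>, whose finite volume bounds the index.\<close>
lemma digits_exist:
  assumes L: "hlattice L" and L': "hlattice L'" and sub: "L' \<subseteq> L"
  shows "\<exists>D. digits L L' D"
proof -
  obtain a b \<xi> where lat: "lat L a b \<xi>" using hlattice_lat[OF L] by blast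
  obtain a' b' \<xi>' where lat': "lat L' a' b' \<xi>'" using hlattice_lat[OF L'] by blast
  note g = latD(1,2)[OF lat] and g' = latD(1,2)[OF lat']
  define W where "W = Wdom a b \<xi>"
  have W: "fdom L W" unfolding W_def by (rule lat_fdom[OF lat])
  \<comment> \<open>The choice is made from the coset as a set, so \<open>r\<close> is constant on
    cosets and its image on \<open>L\<close> is a transversal.\<close>
  define r where "r l = (SOME d. d \<in> qmap L' l)" for l
  have r: "r l \<in> qmap L' l" for l
    unfolding r_def by (rule someI[of _ l]) (simp add: mem_qmap hsubgroup_hone[OF g'(1)])
  have rL: "r l \<in> L" if "l \<in> L" for l
  proof -
    have "hmul (hinv l) (r l) \<in> L" using r[of l] sub by (auto simp: mem_qmap)
    then show ?thesis using hmul_mem_iff(2)[OF g(1) hsubgroup_hinv[OF g(1) that]] by blast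
  qed
  define D where "D = r ` L"
  have DL: "D \<subseteq> L" using rL by (auto simp: D_def)
  have D_eq: "d = d'" if dd: "d \<in> D" "d' \<in> D" "qmap L' d = qmap L' d'" for d d'
  proof -
    obtain l l' where l: "d = r l" "d' = r l'" using dd(1,2) by (auto simp: D_def)
    have "qmap L' l = qmap L' l'"
      using dd(3) r[of l] r[of l'] mem_qmap_iff[OF g'(1)] unfolding l by metis
    then show ?thesis unfolding l r_def by simp
  qed
  have ex1: "\<exists>!d. d \<in> D \<and> hmul (hinv d) l \<in> L'" if "l \<in> L" for l
  proof (rule ex1I[of _ "r l"])
    show "r l \<in> D \<and> hmul (hinv (r l)) l \<in> L'"
      using r[of l] that mem_qmap_iff[OF g'(1)] qmap_eq_iff[OF g'(1), of "r l" l] by (auto simp: D_def)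
    fix d assume d: "d \<in> D \<and> hmul (hinv d) l \<in> L'"
    then have "qmap L' d = qmap L' (r l)"
      using qmap_eq_iff[OF g'(1), of d l] r[of l] mem_qmap_iff[OF g'(1)] by metis
    then show "d = r l" using D_eq d that by (auto simp: D_def)
  qed
  define T where "T d = (\<lambda>x. hmul x d) ` W" for d
  have Tsets: "T d \<in> sets borel" for d
    unfolding T_def hmul_image_eq_vimage by (rule sets_hmul_vimage[OF fdom_sets[OF W]])
  have Tm: "emeasure lborel (T d) = emeasure lborel W" for d
    unfolding T_def hmul_image_eq_vimage by (rule emeasure_hmul_vimage[OF fdom_sets[OF W]])
  have cD: "countable D" using DL g(2) countable_subset by blast
  have "fdom L' (\<Union>d\<in>D. T d)"
  proof (rule fdomI)
    show "(\<Union>d\<in>D. T d) \<in> sets borel" using cD Tsets by (intro sets.countable_UN') auto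
    fix x
    obtain w l where w: "w \<in> W" "l \<in> L" "x = hmul w l" using fdom_ex[OF W] by blast
    obtain d where d: "d \<in> D" "hmul (hinv d) l \<in> L'" using ex1[OF w(2)] by blast
    have "x = hmul (hmul w d) (hmul (hinv d) l)" by (simp add: w hmul_assoc)
    moreover have "hmul w d \<in> (\<Union>d\<in>D. T d)" using w d unfolding T_def by blast
    ultimately show "\<exists>f\<in>\<Union>d\<in>D. T d. \<exists>l\<in>L'. x = hmul f l" using d by blast
  next
    fix f f' l l' assume "f \<in> (\<Union>d\<in>D. T d)" "f' \<in> (\<Union>d\<in>D. T d)"
      and l: "l \<in> L'" "l' \<in> L'" and eq: "hmul f l = hmul f' l'"
    then obtain w d w' d' where w: "w \<in> W" "d \<in> D" "f = hmul w d" "w' \<in> W" "d' \<in> D" "f' = hmul w' d'"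
      unfolding T_def by blast
    have "hmul w (hmul d l) = hmul w' (hmul d' l')" using eq by (simp add: w hmul_assoc)
    moreover have "hmul d l \<in> L" "hmul d' l' \<in> L"
      using w l DL sub hsubgroup_hmul[OF g(1)] by blast+
    ultimately have e: "w = w'" "hmul d l = hmul d' l'"
      using fdom_unique[OF W w(1,4)] by blast+
    have "qmap L' d = qmap L' d'"
      using qmap_hmul_right[OF g'(1) l(1), of d] qmap_hmul_right[OF g'(1) l(2), of d'] e(2) by simp
    then show "f = f'" using D_eq w e by simp
  qed
  from fdom_emeasure_eq[OF g' this lat_fdom[OF lat'], of UNIV]
  have vol: "emeasure lborel (\<Union>d\<in>D. T d) = emeasure lborel (Wdom a' b' \<xi>')" by (simp add: right_invariant_def)
  have "disjoint_family_on T D"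
    unfolding disjoint_family_on_def
  proof (intro ballI impI equals0I)
    fix d d' x assume d: "d \<in> D" "d' \<in> D" "d \<noteq> d'" and "x \<in> T d \<inter> T d'"
    then obtain w w' where w: "w \<in> W" "w' \<in> W" "hmul w d = hmul w' d'" unfolding T_def by auto
    then have "d = d'" using fdom_unique(2)[OF W w(1,2)] d DL by blast
    with d show False by simp
  qed
  then have "emeasure lborel (\<Union>d\<in>D. T d) = (\<integral>\<^sup>+d. emeasure lborel W \<partial>count_space D)"
    using emeasure_UN_countable[of D T lborel] cD Tsets by (simp add: Tm)
  also have "\<dots> = emeasure lborel W * emeasure (count_space D) D" by simp
  finally have "emeasure lborel W * emeasure (count_space D) D < \<infinity>"
    using vol Wdom_finite[OF latD(5)[OF lat'], of \<xi>'] by simp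
  moreover have "emeasure lborel W \<noteq> 0" using Wdom_pos[OF lat] by (simp add: W_def)
  ultimately have "finite D"
    by (cases "finite D") (auto simp: ennreal_mult_eq_top_iff)
  with DL ex1 have "digits L L' D" unfolding digits_def by simp
  then show ?thesis ..
qed

text \<open>Left multiplication by \<open>l\<close> permutes the cosets of \<open>L'\<close> in
  \<open>L\<close>, hence induces a permutation of the representatives. The sum is therefore a
  function of the coset of \<open>L\<close> that contains \<open>y\<close>.\<close>

lemma digits_sum_invariant:
  assumes D: "digits L L' D" and g: "hsubgroup L" "hsubgroup L'" "L' \<subseteq> L" and l: "l \<in> L"
  shows "(\<Sum>d\<in>D. f (qmap L' (hmul (hmul y l) d))) = (\<Sum>d\<in>D. f (qmap L' (hmul y d)))"
proof -
  have D1: "finite D" "D \<subseteq> L" "\<And>l. l \<in> L \<Longrightarrow> \<exists>!d. d \<in> D \<and> hmul (hinv d) l \<in> L'"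
    using D by (auto simp: digits_def)
  define \<sigma> where "\<sigma> d = (THE e. e \<in> D \<and> hmul (hinv e) (hmul l d) \<in> L')" for d
  have ld: "hmul l d \<in> L" if "d \<in> D" for d using that D1(2) l hsubgroup_hmul[OF g(1)] by blast
  have \<sigma>: "\<sigma> d \<in> D \<and> hmul (hinv (\<sigma> d)) (hmul l d) \<in> L'" if "d \<in> D" for d
    unfolding \<sigma>_def by (rule theI'[OF D1(3)[OF ld[OF that]]])
  then have q: "qmap L' (\<sigma> d) = qmap L' (hmul l d)" if "d \<in> D" for d
    using qmap_eq_iff[OF g(2)] that by blast
  have "inj_on \<sigma> D"
  proof (rule inj_onI)
    fix d e assume d: "d \<in> D" "e \<in> D" "\<sigma> d = \<sigma> e"
    then have "qmap L' (hmul l d) = qmap L' (hmul l e)" using q by metis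
    then have "hmul (hinv d) e \<in> L'"
      by (simp add: qmap_eq_iff[OF g(2)] hinv_hmul hmul_assoc)
    moreover have "hmul (hinv e) e \<in> L'" using hsubgroup_hone[OF g(2)] by simp
    ultimately show "d = e" using D1(3)[of e] d D1(2) by blast
  qed
  moreover have "\<sigma> ` D \<subseteq> D" using \<sigma> by blast
  ultimately have bij: "bij_betw \<sigma> D D"
    using endo_inj_surj[OF D1(1)] by (simp add: bij_betw_def)
  have "(\<Sum>d\<in>D. f (qmap L' (hmul (hmul y l) d))) = (\<Sum>d\<in>D. f (qmap L' (hmul y (\<sigma> d))))"
  proof (rule sum.cong[OF refl])
    fix d assume "d \<in> D"
    then have "coset_translate y (qmap L' (\<sigma> d)) = coset_translate y (qmap L' (hmul l d))"
      using q by simp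
    then show "f (qmap L' (hmul (hmul y l) d)) = f (qmap L' (hmul y (\<sigma> d)))"
      by (simp add: hmul_assoc)
  qed
  also have "\<dots> = (\<Sum>d\<in>D. f (qmap L' (hmul y d)))"
    by (rule sum.reindex_bij_betw[OF bij])
  finally show ?thesis .
qed

text \<open>Choosing a uniformly random coset of \<open>L'\<close> inside a random coset of \<open>L\<close> lifts the
  invariant measure; invariance of the lift is inherited because the number of cosets of \<open>L'\<close>
  inside \<open>C\<close> that lie in a given set depends only on the coset \<open>C\<close> of \<open>L\<close>.\<close>
lemma inv_prob_lift:
  assumes L: "hlattice L" and L': "hlattice L'" and sub: "L' \<subseteq> L" and D: "digits L L' D"
    and P: "prob_space P" and R: "R \<in> P \<rightarrow>\<^sub>M borel"
    and inv: "inv_prob L (distr P (quot_space L) (\<lambda>\<omega>. qmap L (R \<omega>)))"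
  shows "inv_prob L' (distr (uniform_count_measure D \<Otimes>\<^sub>M P) (quot_space L')
           (\<lambda>(d, \<omega>). qmap L' (hmul (R \<omega>) d)))" (is "inv_prob L' ?\<nu>")
proof -
  obtain a b \<xi> where lat: "lat L a b \<xi>" using hlattice_lat[OF L] by blast
  note g = latD(1,2)[OF lat]
  have g': "hsubgroup L'" using L' by (simp add: hlattice_def)
  define W where "W = Wdom a b \<xi>"
  have W: "fdom L W" unfolding W_def by (rule lat_fdom[OF lat])
  have fin: "finite D" using D by (simp add: digits_def)
  have "D \<noteq> {}" using D hsubgroup_hone[OF g(1)] by (auto simp: digits_def)
  interpret P: prob_space P by fact
  interpret U: prob_space "uniform_count_measure D"
    by (rule prob_space_uniform_count_measure[OF fin \<open>D \<noteq> {}\<close>])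
  interpret UP: pair_prob_space "uniform_count_measure D" P ..
  have [measurable]: "(\<lambda>d. d) \<in> uniform_count_measure D \<rightarrow>\<^sub>M (borel :: h3 measure)"
    by (auto simp: measurable_def sets_uniform_count_measure space_uniform_count_measure)
  note [measurable] = R measurable_qmap[OF g(1)] measurable_qmap[OF g'] measurable_sec[OF W g]
     measurable_coset_translate[OF g(1)] measurable_coset_translate[OF g']
  have m [measurable]: "(\<lambda>(d, \<omega>). qmap L' (hmul (R \<omega>) d)) \<in> uniform_count_measure D \<Otimes>\<^sub>M P \<rightarrow>\<^sub>M quot_space L'"
    by measurable
  define \<nu> where "\<nu> = distr P (quot_space L) (\<lambda>\<omega>. qmap L (R \<omega>))"
  define c where "c = ennreal (1 / real (card D))"
  \<comment> \<open>\<open>h f\<close> is the mean of \<open>f\<close> over the cosets of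
    \<open>L'\<close> inside \<open>C\<close>. The section makes it measurable; the invariance of
    the sum makes it computable from any representative.\<close>
  define h where "h f C = (\<Sum>d\<in>D. c * f (qmap L' (hmul (sec W C) d)))" for f :: "h3 set \<Rightarrow> ennreal" and C
  have h_qmap: "h f (qmap L y) = (\<Sum>d\<in>D. c * f (qmap L' (hmul y d)))" for f y
  proof -
    define l where "l = hmul (hinv y) (sec W (qmap L y))"
    have l: "l \<in> L" "hmul y l = sec W (qmap L y)"
      using sec_qmap(2)[OF W g(1), of y] qmap_eq_iff[OF g(1), of y "sec W (qmap L y)"] by (simp_all add: l_def)
    show ?thesis
      unfolding h_def l(2)[symmetric] by (rule digits_sum_invariant[OF D g(1) g' sub l(1)])
  qed
  have h_meas [measurable]: "h f \<in> borel_measurable (quot_space L)"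
    if [measurable]: "f \<in> borel_measurable (quot_space L')" for f
    unfolding h_def by measurable
  have int: "(\<integral>\<^sup>+C. f C \<partial>?\<nu>) = (\<integral>\<^sup>+C. h f C \<partial>\<nu>)"
    if [measurable]: "f \<in> borel_measurable (quot_space L')" for f
  proof -
    have "(\<integral>\<^sup>+C. f C \<partial>?\<nu>) = (\<integral>\<^sup>+z. f (case z of (d, \<omega>) \<Rightarrow> qmap L' (hmul (R \<omega>) d)) \<partial>(uniform_count_measure D \<Otimes>\<^sub>M P))"
      by (rule nn_integral_distr[OF m]) measurable
    also have "\<dots> = (\<integral>\<^sup>+d. \<integral>\<^sup>+\<omega>. f (qmap L' (hmul (R \<omega>) d)) \<partial>P \<partial>uniform_count_measure D)"
      by (subst P.nn_integral_fst[symmetric]) (simp_all add: case_prod_beta)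
    also have "\<dots> = (\<Sum>d\<in>D. c * (\<integral>\<^sup>+\<omega>. f (qmap L' (hmul (R \<omega>) d)) \<partial>P))"
      unfolding uniform_count_measure_def c_def by (rule nn_integral_point_measure_finite[OF fin])
    also have "\<dots> = (\<Sum>d\<in>D. (\<integral>\<^sup>+\<omega>. c * f (qmap L' (hmul (R \<omega>) d)) \<partial>P))"
      by (intro sum.cong refl nn_integral_cmult[symmetric]) measurable
    also have "\<dots> = (\<integral>\<^sup>+\<omega>. (\<Sum>d\<in>D. c * f (qmap L' (hmul (R \<omega>) d))) \<partial>P)"
      by (intro nn_integral_sum[symmetric]) measurable
    also have "\<dots> = (\<integral>\<^sup>+\<omega>. h f (qmap L (R \<omega>)) \<partial>P)" by (simp add: h_qmap)
    also have "\<dots> = (\<integral>\<^sup>+C. h f C \<partial>\<nu>)"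
      unfolding \<nu>_def by (rule nn_integral_distr[symmetric]) measurable
    finally show ?thesis .
  qed
  show ?thesis
  proof (rule inv_probI[OF g'])
    show "prob_space ?\<nu>" by (rule UP.prob_space_distr[OF m])
    show "sets ?\<nu> = sets (quot_space L')" by simp
    fix t
    show "distr ?\<nu> (quot_space L') (coset_translate t) = ?\<nu>"
    proof (rule measure_eqI)
      fix E assume "E \<in> sets (distr ?\<nu> (quot_space L') (coset_translate t))"
      then have E [measurable]: "E \<in> sets (quot_space L')" by simp
      have "emeasure (distr ?\<nu> (quot_space L') (coset_translate t)) E
         = (\<integral>\<^sup>+C. indicator E C \<partial>distr ?\<nu> (quot_space L') (coset_translate t))" by simp
      also have "\<dots> = (\<integral>\<^sup>+C. indicator E (coset_translate t C) \<partial>?\<nu>)"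
        by (rule nn_integral_distr) measurable
      also have "\<dots> = (\<integral>\<^sup>+C. h (\<lambda>C. indicator E (coset_translate t C)) C \<partial>\<nu>)"
        by (rule int) measurable
      \<comment> \<open>Averaging commutes with translation, so invariance on the coarser quotient
        passes to the finer one.\<close>
      also have "\<dots> = (\<integral>\<^sup>+C. h (indicator E) (coset_translate t C) \<partial>\<nu>)"
      proof (rule nn_integral_cong)
        fix C assume "C \<in> space \<nu>"
        then obtain y where "C = qmap L y" by (auto simp: \<nu>_def quot_space_sets[OF g(1)] hquot_eq_range)
        then show "h (\<lambda>C. indicator E (coset_translate t C)) C = h (indicator E) (coset_translate t C)"
          by (simp add: h_qmap hmul_assoc)
      qed
      also have "\<dots> = (\<integral>\<^sup>+C. h (indicator E) C \<partial>distr \<nu> (quot_space L) (coset_translate t))"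
        unfolding \<nu>_def by (rule nn_integral_distr[symmetric]) measurable
      also have "\<dots> = (\<integral>\<^sup>+C. h (indicator E) C \<partial>\<nu>)"
        using inv_prob_distr[OF g(1) inv] by (simp add: \<nu>_def)
      also have "\<dots> = (\<integral>\<^sup>+C. indicator E C \<partial>?\<nu>)" by (rule int[symmetric]) measurable
      also have "\<dots> = emeasure ?\<nu> E" by simp
      finally show "emeasure (distr ?\<nu> (quot_space L') (coset_translate t)) E = emeasure ?\<nu> E" .
    qed simp
  qed
qed

subsection \<open>The measure on the inverse limit\<close>

lemma nestedD:
  assumes "nested_lattices \<Gamma>"
  shows "hlattice (\<Gamma> j)" "hsubgroup (\<Gamma> j)" "i \<le> j \<Longrightarrow> \<Gamma> j \<subseteq> \<Gamma> i"
  using assms lift_Suc_antimono_le[of \<Gamma> i j] by (auto simp: nested_lattices_def hlattice_def)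

text \<open>A representative of the finest of the cosets represents the coarser ones too. One
  \<open>y\<close> for all levels at once need not exist, so arguments work with initial
  segments.\<close>

lemma odo_points_common:
  assumes "nested_lattices \<Gamma>" "x \<in> odo_points \<Gamma>"
  shows "\<exists>y. \<forall>k\<le>i. x k = qmap (\<Gamma> k) y"
proof -
  have x: "x j \<in> hquot (\<Gamma> j)" "x (Suc j) \<subseteq> x j" for j
    using assms(2) by (auto simp: odo_points_def)
  obtain y where y: "x i = qmap (\<Gamma> i) y" using x(1) unfolding hquot_eq_range by blast
  have "x k = qmap (\<Gamma> k) y" if "k \<le> i" for k
  proof -
    have "x i \<subseteq> x k" using lift_Suc_antimono_le[of x k i] x(2) that by auto
    moreover have "y \<in> x i" using y hsubgroup_hone[OF nestedD(2)[OF assms(1)]] by (simp add: mem_qmap)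
    moreover obtain z where "x k = qmap (\<Gamma> k) z" using x(1) unfolding hquot_eq_range by blast
    ultimately show ?thesis
      using mem_qmap_iff[OF nestedD(2)[OF assms(1)], of y k z] by (metis subsetD)
  qed
  then show ?thesis by blast
qed

lemma odo_pointsI:
  assumes "nested_lattices \<Gamma>" "\<And>j. \<exists>y. x j = qmap (\<Gamma> j) y \<and> x (Suc j) = qmap (\<Gamma> (Suc j)) y"
  shows "x \<in> odo_points \<Gamma>"
  unfolding odo_points_def
proof (intro CollectI allI conjI)
  fix j
  obtain y where y: "x j = qmap (\<Gamma> j) y" "x (Suc j) = qmap (\<Gamma> (Suc j)) y" using assms(2) by blast
  show "x j \<in> hquot (\<Gamma> j)" by (simp add: y)
  show "x (Suc j) \<subseteq> x j"
    unfolding y using nestedD(3)[OF assms(1), of j "Suc j"] by (auto simp: mem_qmap)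
qed

definition odo_gen :: "(nat \<Rightarrow> h3 set) \<Rightarrow> (nat \<Rightarrow> h3 set) set set" where
  "odo_gen \<Gamma> = {(\<lambda>x. x j) -` E \<inter> odo_points \<Gamma> | j E. E \<in> sets (quot_space (\<Gamma> j))}"

lemma odo_sigma_space: "space (odo_sigma \<Gamma>) = odo_points \<Gamma>"
  and odo_sigma_sets: "sets (odo_sigma \<Gamma>) = sigma_sets (odo_points \<Gamma>) (odo_gen \<Gamma>)"
proof -
  have "odo_gen \<Gamma> \<subseteq> Pow (odo_points \<Gamma>)" by (auto simp: odo_gen_def)
  then show "space (odo_sigma \<Gamma>) = odo_points \<Gamma>"
    "sets (odo_sigma \<Gamma>) = sigma_sets (odo_points \<Gamma>) (odo_gen \<Gamma>)"
    unfolding odo_sigma_def odo_gen_def[symmetric] by (simp_all add: space_measure_of)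
qed

lemma measurable_odo_coordinate [measurable]:
  assumes "nested_lattices \<Gamma>"
  shows "(\<lambda>x. x j) \<in> odo_sigma \<Gamma> \<rightarrow>\<^sub>M quot_space (\<Gamma> j)"
proof (rule measurableI)
  fix x assume "x \<in> space (odo_sigma \<Gamma>)"
  then show "x j \<in> space (quot_space (\<Gamma> j))"
    by (simp add: odo_sigma_space odo_points_def quot_space_sets[OF nestedD(2)[OF assms]])
next
  fix E assume "E \<in> sets (quot_space (\<Gamma> j))"
  then show "(\<lambda>x. x j) -` E \<inter> space (odo_sigma \<Gamma>) \<in> sets (odo_sigma \<Gamma>)"
    unfolding odo_sigma_sets odo_sigma_space by (intro sigma_sets.Basic) (auto simp: odo_gen_def)
qed

lemma measurable_into_odo:
  assumes "\<And>w. w \<in> space N \<Longrightarrow> f w \<in> odo_points \<Gamma>"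
    and "\<And>j. (\<lambda>w. f w j) \<in> N \<rightarrow>\<^sub>M quot_space (\<Gamma> j)"
  shows "f \<in> N \<rightarrow>\<^sub>M odo_sigma \<Gamma>"
  unfolding odo_sigma_def odo_gen_def[symmetric]
proof (rule measurable_measure_of)
  show "odo_gen \<Gamma> \<subseteq> Pow (odo_points \<Gamma>)" by (auto simp: odo_gen_def)
  show "f \<in> space N \<rightarrow> odo_points \<Gamma>" using assms(1) by blast
  fix A assume "A \<in> odo_gen \<Gamma>"
  then obtain j E where A: "A = (\<lambda>x. x j) -` E \<inter> odo_points \<Gamma>" "E \<in> sets (quot_space (\<Gamma> j))"
    by (auto simp: odo_gen_def)
  have "f -` A \<inter> space N = (\<lambda>w. f w j) -` E \<inter> space N"
    using assms(1) by (auto simp: A)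
  then show "f -` A \<inter> space N \<in> sets N"
    using measurable_sets[OF assms(2) A(2)] by simp
qed

text \<open>The set is pulled back along the reduction, so finitely many cylinders can be moved to
  one common level.\<close>

lemma odo_gen_lift:
  assumes \<Gamma>: "nested_lattices \<Gamma>" and "i \<le> j" and E: "E \<in> sets (quot_space (\<Gamma> i))"
  shows "\<exists>E'\<in>sets (quot_space (\<Gamma> j)). (\<lambda>x. x i) -` E \<inter> odo_points \<Gamma> = (\<lambda>x. x j) -` E' \<inter> odo_points \<Gamma>"
proof
  note red = nestedD(2)[OF \<Gamma>] nestedD(2)[OF \<Gamma>] nestedD(3)[OF \<Gamma> assms(2)]
  show "red (\<Gamma> i) -` E \<inter> space (quot_space (\<Gamma> j)) \<in> sets (quot_space (\<Gamma> j))"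
    by (rule measurable_sets[OF measurable_red[OF red] E])
  have "x i = red (\<Gamma> i) (x j)" "x j \<in> space (quot_space (\<Gamma> j))" if x: "x \<in> odo_points \<Gamma>" for x
  proof -
    obtain y where "\<forall>k\<le>j. x k = qmap (\<Gamma> k) y" using odo_points_common[OF \<Gamma> x] by blast
    then show "x i = red (\<Gamma> i) (x j)" "x j \<in> space (quot_space (\<Gamma> j))"
      using assms(2) by (auto simp: red_qmap[OF red] quot_space_sets[OF nestedD(2)[OF \<Gamma>]])
  qed
  then show "(\<lambda>x. x i) -` E \<inter> odo_points \<Gamma> =
      (\<lambda>x. x j) -` (red (\<Gamma> i) -` E \<inter> space (quot_space (\<Gamma> j))) \<inter> odo_points \<Gamma>" by auto
qed

lemma odo_gen_Int_stable:
  assumes \<Gamma>: "nested_lattices \<Gamma>"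
  shows "Int_stable (odo_gen \<Gamma>)"
proof (rule Int_stableI)
  fix A B assume "A \<in> odo_gen \<Gamma>" "B \<in> odo_gen \<Gamma>"
  then obtain i E j F where AB: "A = (\<lambda>x. x i) -` E \<inter> odo_points \<Gamma>" "E \<in> sets (quot_space (\<Gamma> i))"
      "B = (\<lambda>x. x j) -` F \<inter> odo_points \<Gamma>" "F \<in> sets (quot_space (\<Gamma> j))"
    unfolding odo_gen_def by blast
  obtain E' where E': "E' \<in> sets (quot_space (\<Gamma> (max i j)))" "A = (\<lambda>x. x (max i j)) -` E' \<inter> odo_points \<Gamma>"
    using odo_gen_lift[OF \<Gamma> max.cobounded1 AB(2), of j] AB(1) by auto
  obtain F' where F': "F' \<in> sets (quot_space (\<Gamma> (max i j)))" "B = (\<lambda>x. x (max i j)) -` F' \<inter> odo_points \<Gamma>"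
    using odo_gen_lift[OF \<Gamma> max.cobounded2 AB(4), of i] AB(3) by auto
  have "A \<inter> B = (\<lambda>x. x (max i j)) -` (E' \<inter> F') \<inter> odo_points \<Gamma>" using E' F' by blast
  moreover have "E' \<inter> F' \<in> sets (quot_space (\<Gamma> (max i j)))" using E'(1) F'(1) by blast
  ultimately show "A \<inter> B \<in> odo_gen \<Gamma>" unfolding odo_gen_def by blast
qed

lemma odo_points_gen:
  assumes "nested_lattices \<Gamma>"
  shows "odo_points \<Gamma> \<in> odo_gen \<Gamma>"
proof -
  have "odo_points \<Gamma> = (\<lambda>x. x 0) -` space (quot_space (\<Gamma> 0)) \<inter> odo_points \<Gamma>"
    by (auto simp: quot_space_sets(1)[OF nestedD(2)[OF assms]] odo_points_def)
  moreover have "space (quot_space (\<Gamma> 0)) \<in> sets (quot_space (\<Gamma> 0))" by (rule sets.top)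
  ultimately show ?thesis unfolding odo_gen_def by blast
qed

definition odo_prob :: "(nat \<Rightarrow> h3 set) \<Rightarrow> (nat \<Rightarrow> h3 set) measure \<Rightarrow> bool" where
  "odo_prob \<Gamma> \<mu> \<longleftrightarrow> prob_space \<mu> \<and> sets \<mu> = sets (odo_sigma \<Gamma>) \<and>
      (\<forall>j. distr \<mu> (quot_space (\<Gamma> j)) (\<lambda>x. x j) = quot_measure (\<Gamma> j))"

text \<open>Cylinders are an intersection stable generator, and the marginals prescribe their
  measures.\<close>

lemma odo_prob_unique:
  assumes \<Gamma>: "nested_lattices \<Gamma>" and "odo_prob \<Gamma> \<mu>" "odo_prob \<Gamma> \<nu>"
  shows "\<mu> = \<nu>"
proof (rule measure_eqI_generator_eq[where E = "odo_gen \<Gamma>" and \<Omega> = "odo_points \<Gamma>" and A = "\<lambda>_. odo_points \<Gamma>"])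
  have em: "emeasure \<rho> ((\<lambda>x. x j) -` E \<inter> odo_points \<Gamma>) = emeasure (quot_measure (\<Gamma> j)) E"
    if \<rho>: "odo_prob \<Gamma> \<rho>" and E: "E \<in> sets (quot_space (\<Gamma> j))" for \<rho> j E
  proof -
    have s: "sets \<rho> = sets (odo_sigma \<Gamma>)" using \<rho> by (simp add: odo_prob_def)
    then have "(\<lambda>x. x j) \<in> \<rho> \<rightarrow>\<^sub>M quot_space (\<Gamma> j)"
      using measurable_odo_coordinate[OF \<Gamma>] measurable_cong_sets[OF s refl] by blast
    from emeasure_distr[OF this E] show ?thesis
      using \<rho> sets_eq_imp_space_eq[OF s] by (simp add: odo_prob_def odo_sigma_space)
  qed
  show "emeasure \<mu> X = emeasure \<nu> X" if "X \<in> odo_gen \<Gamma>" for X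
    using that em assms(2,3) unfolding odo_gen_def by auto
  show "emeasure \<mu> (odo_points \<Gamma>) \<noteq> \<infinity>"
  proof -
    interpret prob_space \<mu> using assms(2) by (simp add: odo_prob_def)
    show ?thesis by simp
  qed
  show "Int_stable (odo_gen \<Gamma>)" by (rule odo_gen_Int_stable[OF \<Gamma>])
  show "odo_gen \<Gamma> \<subseteq> Pow (odo_points \<Gamma>)" by (auto simp: odo_gen_def)
  show "sets \<mu> = sigma_sets (odo_points \<Gamma>) (odo_gen \<Gamma>)" "sets \<nu> = sigma_sets (odo_points \<Gamma>) (odo_gen \<Gamma>)"
    using assms(2,3) by (simp_all add: odo_prob_def odo_sigma_sets)
  show "range (\<lambda>_::nat. odo_points \<Gamma>) \<subseteq> odo_gen \<Gamma>" using odo_points_gen[OF \<Gamma>] by blast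
  show "(\<Union>_::nat. odo_points \<Gamma>) = odo_points \<Gamma>" by simp
qed

primrec partial_prod :: "nat \<Rightarrow> (nat \<Rightarrow> h3) \<Rightarrow> h3" where
  "partial_prod 0 \<omega> = \<omega> 0"
| "partial_prod (Suc j) \<omega> = hmul (partial_prod j \<omega>) (\<omega> (Suc j))"

lemma partial_prod_cong: "(\<And>i. i \<le> j \<Longrightarrow> \<omega> i = \<omega>' i) \<Longrightarrow> partial_prod j \<omega> = partial_prod j \<omega>'"
  by (induction j) auto

text \<open>A random point of the inverse limit is the sequence of cosets of the partial products
  \<open>\<omega> 0, \<omega> 0 \<omega> 1, \<dots>\<close>, where \<open>\<omega> 0\<close> is uniform in a fundamental domain of \<open>\<Gamma> 0\<close> and, independently,
  \<open>\<omega> (Suc j)\<close> is a uniform representative of \<open>\<Gamma> j / \<Gamma> (Suc j)\<close>.\<close>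
lemma odo_prob_exists:
  assumes \<Gamma>: "nested_lattices \<Gamma>"
  shows "\<exists>\<mu>. odo_prob \<Gamma> \<mu>"
proof -
  have "\<exists>D. digits (\<Gamma> j) (\<Gamma> (Suc j)) D" for j
    using digits_exist[OF nestedD(1)[OF \<Gamma>] nestedD(1)[OF \<Gamma>] nestedD(3)[OF \<Gamma>]] by simp
  then obtain D where D: "\<And>j. digits (\<Gamma> j) (\<Gamma> (Suc j)) (D j)" by metis
  obtain a b \<xi> where lat: "lat (\<Gamma> 0) a b \<xi>" using hlattice_lat[OF nestedD(1)[OF \<Gamma>]] by blast
  define M where "M n = (case n of 0 \<Rightarrow> uniform_measure lborel (Wdom a b \<xi>)
     | Suc j \<Rightarrow> uniform_count_measure (D j))" for n
  have fin: "finite (D j)" "D j \<noteq> {}" "D j \<subseteq> \<Gamma> j" for j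
    using D[of j] hsubgroup_hone[OF nestedD(2)[OF \<Gamma>], of j] by (auto simp: digits_def)
  have M_prob: "prob_space (M n)" for n
    using prob_space_uniform_measure[OF Wdom_pos[OF lat]] Wdom_finite[OF latD(5)[OF lat], of \<xi>]
      prob_space_uniform_count_measure[OF fin(1,2)] by (auto simp: M_def split: nat.split)
  interpret product_prob_space M UNIV
    by (intro product_prob_spaceI M_prob)
  have M_borel: "(\<lambda>x. x) \<in> M n \<rightarrow>\<^sub>M borel" for n
    by (auto simp: M_def measurable_def sets_uniform_count_measure space_uniform_count_measure split: nat.split)
  have comp [measurable]: "(\<lambda>\<omega>. \<omega> n) \<in> PiM I M \<rightarrow>\<^sub>M borel" if "n \<in> I" for n I
    using measurable_compose[OF measurable_component_singleton[OF that] M_borel] by simp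
  have pp [measurable]: "partial_prod j \<in> PiM I M \<rightarrow>\<^sub>M borel" if "{..j} \<subseteq> I" for j I
    using that
  proof (induction j)
    case 0
    then show ?case using comp[of 0 I] by simp
  next
    case (Suc j)
    then have [measurable]: "partial_prod j \<in> PiM I M \<rightarrow>\<^sub>M borel" "(\<lambda>\<omega>. \<omega> (Suc j)) \<in> PiM I M \<rightarrow>\<^sub>M borel"
      using comp[of "Suc j" I] Suc.IH by (simp_all add: atMost_Suc)
    show ?case unfolding partial_prod.simps by measurable
  qed
  have qp: "(\<lambda>\<omega>. qmap (\<Gamma> j) (partial_prod j \<omega>)) \<in> PiM I M \<rightarrow>\<^sub>M quot_space (\<Gamma> j)" if "{..j} \<subseteq> I" for j I
    using measurable_compose[OF pp[OF that] measurable_qmap[OF nestedD(2)[OF \<Gamma>]]] .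
  have fin_prob: "prob_space (PiM I M)" for I
    by (intro prob_space_PiM M_prob)
  have law: "inv_prob (\<Gamma> j) (distr (PiM {..j} M) (quot_space (\<Gamma> j)) (\<lambda>\<omega>. qmap (\<Gamma> j) (partial_prod j \<omega>)))" for j
  proof (induction j)
    case 0
    have "distr (PiM {..0} M) (quot_space (\<Gamma> 0)) (\<lambda>\<omega>. qmap (\<Gamma> 0) (partial_prod 0 \<omega>))
      = distr (distr (PiM {..0} M) (M 0) (\<lambda>\<omega>. \<omega> 0)) (quot_space (\<Gamma> 0)) (qmap (\<Gamma> 0))"
      using measurable_compose[OF M_borel[of 0] measurable_qmap[OF nestedD(2)[OF \<Gamma>]]]
      by (subst distr_distr) (auto simp: comp_def)
    also have "distr (PiM {..0} M) (M 0) (\<lambda>\<omega>. \<omega> 0) = M 0"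
      by (rule distr_PiM_component) (auto intro: M_prob)
    finally show ?case using inv_prob_uniform[OF lat] by (simp add: M_def)
  next
    case (Suc j)
    have ins: "{..Suc j} = insert (Suc j) {..j}" by auto
    have up: "(\<lambda>(x, X). X(Suc j := x)) \<in> M (Suc j) \<Otimes>\<^sub>M PiM {..j} M \<rightarrow>\<^sub>M PiM (insert (Suc j) {..j}) M"
      using measurable_compose[OF measurable_pair_swap' measurable_add_dim] by (simp add: case_prod_beta)
    \<comment> \<open>The last digit is split off as an independent factor, so that the law at level
      \<open>Suc j\<close> is the lift of the law at level \<open>j\<close>.\<close>
    have "PiM {..Suc j} M = distr (M (Suc j) \<Otimes>\<^sub>M PiM {..j} M) (PiM (insert (Suc j) {..j}) M) (\<lambda>(x, X). X(Suc j := x))"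
      unfolding ins by (rule distr_pair_PiM_eq_PiM[symmetric]) (auto intro: M_prob)
    then have "distr (PiM {..Suc j} M) (quot_space (\<Gamma> (Suc j))) (\<lambda>\<omega>. qmap (\<Gamma> (Suc j)) (partial_prod (Suc j) \<omega>))
      = distr (distr (M (Suc j) \<Otimes>\<^sub>M PiM {..j} M) (PiM (insert (Suc j) {..j}) M) (\<lambda>(x, X). X(Suc j := x)))
         (quot_space (\<Gamma> (Suc j))) (\<lambda>\<omega>. qmap (\<Gamma> (Suc j)) (partial_prod (Suc j) \<omega>))" by simp
    also have "\<dots> = distr (M (Suc j) \<Otimes>\<^sub>M PiM {..j} M) (quot_space (\<Gamma> (Suc j)))
        ((\<lambda>\<omega>. qmap (\<Gamma> (Suc j)) (partial_prod (Suc j) \<omega>)) \<circ> (\<lambda>(x, X). X(Suc j := x)))"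
      by (rule distr_distr[OF _ up], rule qp) auto
    also have "\<dots> = distr (M (Suc j) \<Otimes>\<^sub>M PiM {..j} M) (quot_space (\<Gamma> (Suc j)))
        (\<lambda>(d, \<omega>). qmap (\<Gamma> (Suc j)) (hmul (partial_prod j \<omega>) d))"
    proof (rule arg_cong[where f = "distr _ _"], rule ext)
      fix z
      have "partial_prod j ((snd z)(Suc j := fst z)) = partial_prod j (snd z)"
        by (rule partial_prod_cong) auto
      then show "((\<lambda>\<omega>. qmap (\<Gamma> (Suc j)) (partial_prod (Suc j) \<omega>)) \<circ> (\<lambda>(x, X). X(Suc j := x))) z =
        (case z of (d, \<omega>) \<Rightarrow> qmap (\<Gamma> (Suc j)) (hmul (partial_prod j \<omega>) d))"
        by (simp add: case_prod_beta)
    qed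
    also have "M (Suc j) = uniform_count_measure (D j)" by (simp add: M_def)
    finally show ?case
      using inv_prob_lift[OF nestedD(1)[OF \<Gamma>] nestedD(1)[OF \<Gamma>] nestedD(3)[OF \<Gamma>] D fin_prob pp Suc.IH]
      by simp
  qed
  define \<Phi> where "\<Phi> \<omega> = (\<lambda>j. qmap (\<Gamma> j) (partial_prod j \<omega>))" for \<omega>
  have \<Phi>: "\<Phi> \<in> PiM UNIV M \<rightarrow>\<^sub>M odo_sigma \<Gamma>"
  proof (rule measurable_into_odo)
    fix \<omega> assume "\<omega> \<in> space (PiM UNIV M)"
    \<comment> \<open>The space of each digit measure is \<open>D j\<close> itself, so every point
      of the product gives a compatible sequence, with no exceptional null set.\<close>
    then have "\<omega> (Suc j) \<in> space (M (Suc j))" for j by (auto simp: space_PiM)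
    then have d: "\<omega> (Suc j) \<in> \<Gamma> j" for j
      using fin(3)[of j] by (auto simp: M_def space_uniform_count_measure)
    show "\<Phi> \<omega> \<in> odo_points \<Gamma>"
    proof (rule odo_pointsI[OF \<Gamma>], rule exI, rule conjI)
      fix j
      show "\<Phi> \<omega> (Suc j) = qmap (\<Gamma> (Suc j)) (partial_prod (Suc j) \<omega>)" by (simp add: \<Phi>_def)
      show "\<Phi> \<omega> j = qmap (\<Gamma> j) (partial_prod (Suc j) \<omega>)"
        by (simp add: \<Phi>_def qmap_hmul_right[OF nestedD(2)[OF \<Gamma>] d])
    qed
  next
    fix j show "(\<lambda>\<omega>. \<Phi> \<omega> j) \<in> PiM UNIV M \<rightarrow>\<^sub>M quot_space (\<Gamma> j)" unfolding \<Phi>_def by (rule qp) simp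
  qed
  have "odo_prob \<Gamma> (distr (PiM UNIV M) (odo_sigma \<Gamma>) \<Phi>)"
    unfolding odo_prob_def
  proof (intro conjI allI)
    show "prob_space (distr (PiM UNIV M) (odo_sigma \<Gamma>) \<Phi>)"
      by (rule prob_space.prob_space_distr[OF fin_prob \<Phi>])
    fix j
    have "distr (distr (PiM UNIV M) (odo_sigma \<Gamma>) \<Phi>) (quot_space (\<Gamma> j)) (\<lambda>x. x j)
       = distr (PiM UNIV M) (quot_space (\<Gamma> j)) (\<lambda>\<omega>. qmap (\<Gamma> j) (partial_prod j \<omega>))"
      by (subst distr_distr[OF measurable_odo_coordinate[OF \<Gamma>] \<Phi>]) (simp add: comp_def \<Phi>_def)
    \<comment> \<open>\<open>partial_prod j\<close> reads only the coordinates up to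
      \<open>j\<close>, so the infinite product may be replaced by the finite one whose law is
      known.\<close>
    also have "\<dots> = distr (PiM UNIV M) (quot_space (\<Gamma> j)) ((\<lambda>\<omega>. qmap (\<Gamma> j) (partial_prod j \<omega>)) \<circ> (\<lambda>x. restrict x {..j}))"
    proof (rule arg_cong[where f = "distr _ _"], rule ext)
      fix \<omega> show "qmap (\<Gamma> j) (partial_prod j \<omega>) = ((\<lambda>\<omega>. qmap (\<Gamma> j) (partial_prod j \<omega>)) \<circ> (\<lambda>x. restrict x {..j})) \<omega>"
        using partial_prod_cong[of j \<omega> "restrict \<omega> {..j}"] by simp
    qed
    also have "\<dots> = distr (distr (PiM UNIV M) (PiM {..j} M) (\<lambda>x. restrict x {..j})) (quot_space (\<Gamma> j))
        (\<lambda>\<omega>. qmap (\<Gamma> j) (partial_prod j \<omega>))"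
      by (rule distr_distr[symmetric, OF qp measurable_restrict_subset]) auto
    also have "distr (PiM UNIV M) (PiM {..j} M) (\<lambda>x. restrict x {..j}) = PiM {..j} M"
      by (rule distr_PiM_restrict_finite) auto
    finally show "distr (distr (PiM UNIV M) (odo_sigma \<Gamma>) \<Phi>) (quot_space (\<Gamma> j)) (\<lambda>x. x j) = quot_measure (\<Gamma> j)"
      using quot_measure_eqI[OF nestedD(1)[OF \<Gamma>] law] by simp
  qed simp
  then show ?thesis by blast
qed

lemma odo_prob_odo_measure:
  assumes "nested_lattices \<Gamma>"
  shows "odo_prob \<Gamma> (odo_measure \<Gamma>)"
proof -
  have "odo_measure \<Gamma> = (THE \<mu>. odo_prob \<Gamma> \<mu>)"
    unfolding odo_measure_def odo_prob_def ..
  then show ?thesis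
    using theI'[of "odo_prob \<Gamma>"] odo_prob_exists[OF assms] odo_prob_unique[OF assms] by metis
qed

lemma odo_measure_sets:
  assumes "nested_lattices \<Gamma>"
  shows "sets (odo_measure \<Gamma>) = sets (odo_sigma \<Gamma>)" "space (odo_measure \<Gamma>) = odo_points \<Gamma>"
    "prob_space (odo_measure \<Gamma>)"
    "distr (odo_measure \<Gamma>) (quot_space (\<Gamma> j)) (\<lambda>x. x j) = quot_measure (\<Gamma> j)"
  using odo_prob_odo_measure[OF assms] sets_eq_imp_space_eq[of "odo_measure \<Gamma>" "odo_sigma \<Gamma>"]
  by (auto simp: odo_prob_def odo_sigma_space)

lemma measurable_odo_measure:
  assumes "nested_lattices \<Gamma>"
  shows "measurable (odo_measure \<Gamma>) N = measurable (odo_sigma \<Gamma>) N"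
    "measurable N (odo_measure \<Gamma>) = measurable N (odo_sigma \<Gamma>)"
  by (intro measurable_cong_sets odo_measure_sets[OF assms] refl)+

lemma odo_distr_eqI:
  assumes \<Gamma>: "nested_lattices \<Gamma>" and M: "prob_space M" and f: "f \<in> M \<rightarrow>\<^sub>M odo_sigma \<Gamma>"
    and marg: "\<And>j. distr M (quot_space (\<Gamma> j)) (\<lambda>x. f x j) = quot_measure (\<Gamma> j)"
  shows "distr M (odo_measure \<Gamma>) f = odo_measure \<Gamma>"
proof (rule odo_prob_unique[OF \<Gamma> _ odo_prob_odo_measure[OF \<Gamma>]])
  have f': "f \<in> M \<rightarrow>\<^sub>M odo_measure \<Gamma>" using f by (simp add: measurable_odo_measure[OF \<Gamma>])
  show "odo_prob \<Gamma> (distr M (odo_measure \<Gamma>) f)"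
    unfolding odo_prob_def
  proof (intro conjI allI)
    show "prob_space (distr M (odo_measure \<Gamma>) f)" by (rule prob_space.prob_space_distr[OF M f'])
    show "sets (distr M (odo_measure \<Gamma>) f) = sets (odo_sigma \<Gamma>)" by (simp add: odo_measure_sets[OF \<Gamma>])
    fix j
    have "(\<lambda>x. x j) \<in> odo_measure \<Gamma> \<rightarrow>\<^sub>M quot_space (\<Gamma> j)"
      using measurable_odo_coordinate[OF \<Gamma>] by (simp add: measurable_odo_measure[OF \<Gamma>])
    from distr_distr[OF this f'] marg[of j]
    show "distr (distr M (odo_measure \<Gamma>) f) (quot_space (\<Gamma> j)) (\<lambda>x. x j) = quot_measure (\<Gamma> j)"
      by (simp add: comp_def)
  qed
qed

lemma odo_act_points:
  assumes \<Gamma>: "nested_lattices \<Gamma>" and x: "x \<in> odo_points \<Gamma>"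
  shows "odo_act g x \<in> odo_points \<Gamma>"
proof (rule odo_pointsI[OF \<Gamma>])
  fix j
  obtain y where "\<forall>k\<le>Suc j. x k = qmap (\<Gamma> k) y" using odo_points_common[OF \<Gamma> x] by blast
  then show "\<exists>y. odo_act g x j = qmap (\<Gamma> j) y \<and> odo_act g x (Suc j) = qmap (\<Gamma> (Suc j)) y"
    by (intro exI[of _ "hmul g y"]) (simp add: odo_act_def)
qed

lemma measurable_odo_act:
  assumes \<Gamma>: "nested_lattices \<Gamma>"
  shows "odo_act g \<in> odo_measure \<Gamma> \<rightarrow>\<^sub>M odo_measure \<Gamma>"
  unfolding measurable_odo_measure[OF \<Gamma>]
proof (rule measurable_into_odo)
  show "odo_act g w \<in> odo_points \<Gamma>" if "w \<in> space (odo_sigma \<Gamma>)" for w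
    using that odo_act_points[OF \<Gamma>] by (simp add: odo_sigma_space)
  show "(\<lambda>w. odo_act g w j) \<in> odo_sigma \<Gamma> \<rightarrow>\<^sub>M quot_space (\<Gamma> j)" for j
    unfolding odo_act_def
    by (rule measurable_compose[OF measurable_odo_coordinate[OF \<Gamma>] measurable_coset_translate[OF nestedD(2)[OF \<Gamma>]]])
qed

lemma odo_act_measure_preserving:
  assumes \<Gamma>: "nested_lattices \<Gamma>"
  shows "distr (odo_measure \<Gamma>) (odo_measure \<Gamma>) (odo_act g) = odo_measure \<Gamma>"
proof (rule odo_distr_eqI[OF \<Gamma> odo_measure_sets(3)[OF \<Gamma>]])
  show "odo_act g \<in> odo_measure \<Gamma> \<rightarrow>\<^sub>M odo_sigma \<Gamma>"
    using measurable_odo_act[OF \<Gamma>] by (simp add: measurable_odo_measure(2)[OF \<Gamma>])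
  fix j
  have "(\<lambda>x. x j) \<in> odo_measure \<Gamma> \<rightarrow>\<^sub>M quot_space (\<Gamma> j)"
    using measurable_odo_coordinate[OF \<Gamma>] by (simp add: measurable_odo_measure[OF \<Gamma>])
  from distr_distr[OF measurable_coset_translate[OF nestedD(2)[OF \<Gamma>]] this, of g]
  have "distr (odo_measure \<Gamma>) (quot_space (\<Gamma> j)) (\<lambda>x. odo_act g x j)
     = distr (quot_measure (\<Gamma> j)) (quot_space (\<Gamma> j)) (coset_translate g)"
    by (simp add: odo_measure_sets[OF \<Gamma>] odo_act_def comp_def)
  then show "distr (odo_measure \<Gamma>) (quot_space (\<Gamma> j)) (\<lambda>x. odo_act g x j) = quot_measure (\<Gamma> j)"
    using inv_prob_distr[OF nestedD(2)[OF \<Gamma>] inv_prob_quot_measure[OF nestedD(1)[OF \<Gamma>]]] by simp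
qed

subsection \<open>Isomorphisms of odometers\<close>

text \<open>Level \<open>k\<close> of the image is read from level \<open>J k\<close> of the
  argument. \<open>J\<close> may be any function, monotone or not, because a representative valid up
  to the deeper of two levels serves both.\<close>

definition odo_map :: "(nat \<Rightarrow> h3 set) \<Rightarrow> (nat \<Rightarrow> nat) \<Rightarrow> (nat \<Rightarrow> h3 set) \<Rightarrow> nat \<Rightarrow> h3 set" where
  "odo_map \<Lambda> J x = (\<lambda>k. red (\<Lambda> k) (x (J k)))"

context
  fixes \<Gamma> \<Lambda> :: "nat \<Rightarrow> h3 set" and J :: "nat \<Rightarrow> nat"
  assumes \<Gamma>: "nested_lattices \<Gamma>" and \<Lambda>: "nested_lattices \<Lambda>" and J: "\<And>k. \<Gamma> (J k) \<subseteq> \<Lambda> k"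
begin

lemma odo_map_eq: "x (J k) = qmap (\<Gamma> (J k)) y \<Longrightarrow> odo_map \<Lambda> J x k = qmap (\<Lambda> k) y"
  by (simp add: odo_map_def red_qmap[OF nestedD(2)[OF \<Gamma>] nestedD(2)[OF \<Lambda>] J])

lemma odo_map_points:
  assumes x: "x \<in> odo_points \<Gamma>"
  shows "odo_map \<Lambda> J x \<in> odo_points \<Lambda>"
proof (rule odo_pointsI[OF \<Lambda>])
  fix k
  obtain y where y: "\<forall>i\<le>max (J k) (J (Suc k)). x i = qmap (\<Gamma> i) y"
    using odo_points_common[OF \<Gamma> x] by blast
  show "\<exists>y. odo_map \<Lambda> J x k = qmap (\<Lambda> k) y \<and> odo_map \<Lambda> J x (Suc k) = qmap (\<Lambda> (Suc k)) y"
    by (intro exI[of _ y] conjI odo_map_eq) (simp_all add: y)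
qed

lemma measurable_odo_map: "odo_map \<Lambda> J \<in> odo_measure \<Gamma> \<rightarrow>\<^sub>M odo_sigma \<Lambda>"
  unfolding measurable_odo_measure(1)[OF \<Gamma>]
proof (rule measurable_into_odo)
  show "odo_map \<Lambda> J w \<in> odo_points \<Lambda>" if "w \<in> space (odo_sigma \<Gamma>)" for w
    using that odo_map_points by (simp add: odo_sigma_space)
  show "(\<lambda>w. odo_map \<Lambda> J w k) \<in> odo_sigma \<Gamma> \<rightarrow>\<^sub>M quot_space (\<Lambda> k)" for k
    unfolding odo_map_def
    by (rule measurable_compose[OF measurable_odo_coordinate[OF \<Gamma>]
          measurable_red[OF nestedD(2)[OF \<Gamma>] nestedD(2)[OF \<Lambda>] J]])
qed

lemma distr_odo_map: "distr (odo_measure \<Gamma>) (odo_measure \<Lambda>) (odo_map \<Lambda> J) = odo_measure \<Lambda>"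
proof (rule odo_distr_eqI[OF \<Lambda> odo_measure_sets(3)[OF \<Gamma>] measurable_odo_map])
  fix k
  have m: "(\<lambda>x. x (J k)) \<in> odo_measure \<Gamma> \<rightarrow>\<^sub>M quot_space (\<Gamma> (J k))"
    using measurable_odo_coordinate[OF \<Gamma>] by (simp add: measurable_odo_measure[OF \<Gamma>])
  have "distr (odo_measure \<Gamma>) (quot_space (\<Lambda> k)) (\<lambda>x. odo_map \<Lambda> J x k)
    = distr (distr (odo_measure \<Gamma>) (quot_space (\<Gamma> (J k))) (\<lambda>x. x (J k))) (quot_space (\<Lambda> k)) (red (\<Lambda> k))"
    by (subst distr_distr[OF measurable_red[OF nestedD(2)[OF \<Gamma>] nestedD(2)[OF \<Lambda>] J] m])
      (simp add: comp_def odo_map_def)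
  then show "distr (odo_measure \<Gamma>) (quot_space (\<Lambda> k)) (\<lambda>x. odo_map \<Lambda> J x k) = quot_measure (\<Lambda> k)"
    by (simp add: odo_measure_sets(4)[OF \<Gamma>] distr_red_quot_measure[OF nestedD(1)[OF \<Gamma>] nestedD(1)[OF \<Lambda>] J])
qed

lemma odo_map_equivariant:
  assumes x: "x \<in> odo_points \<Gamma>"
  shows "odo_map \<Lambda> J (odo_act g x) = odo_act g (odo_map \<Lambda> J x)"
proof
  fix k
  obtain y where y: "x (J k) = qmap (\<Gamma> (J k)) y"
    using odo_points_common[OF \<Gamma> x, of "J k"] by blast
  then have "odo_act g x (J k) = qmap (\<Gamma> (J k)) (hmul g y)" by (simp add: odo_act_def)
  from odo_map_eq[of "odo_act g x" k, OF this] odo_map_eq[of x k, OF y]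
  show "odo_map \<Lambda> J (odo_act g x) k = odo_act g (odo_map \<Lambda> J x) k" by (simp add: odo_act_def)
qed

end

lemma odo_map_inverse:
  assumes \<Gamma>: "nested_lattices \<Gamma>" and \<Lambda>: "nested_lattices \<Lambda>"
    and J: "\<And>k. \<Gamma> (J k) \<subseteq> \<Lambda> k" and K: "\<And>k. \<Lambda> (K k) \<subseteq> \<Gamma> k" and x: "x \<in> odo_points \<Gamma>"
  shows "odo_map \<Gamma> K (odo_map \<Lambda> J x) = x"
proof
  fix j
  obtain y where y: "\<forall>i\<le>max j (J (K j)). x i = qmap (\<Gamma> i) y"
    using odo_points_common[OF \<Gamma> x] by blast
  have "odo_map \<Lambda> J x (K j) = qmap (\<Lambda> (K j)) y"
    by (rule odo_map_eq[OF \<Gamma> \<Lambda> J]) (simp add: y)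
  from odo_map_eq[OF \<Lambda> \<Gamma> K, of "odo_map \<Lambda> J x" j, OF this] show "odo_map \<Gamma> K (odo_map \<Lambda> J x) j = x j" by (simp add: y)
qed

text \<open>Each sequence is cofinal in the other, so the limits coincide. The maps are inverse and
  equivariant at every point.\<close>

lemma interlaced_hsys_iso:
  assumes \<Gamma>: "nested_lattices \<Gamma>" and \<Lambda>: "nested_lattices \<Lambda>"
    and J: "\<And>k. \<Gamma> (J k) \<subseteq> \<Lambda> k" and K: "\<And>k. \<Lambda> (K k) \<subseteq> \<Gamma> k"
  shows "hsys_iso (odometer \<Gamma>) (odometer \<Lambda>)"
  unfolding hsys_iso_def odometer_def prod.case
proof (rule exI[of _ "odo_map \<Lambda> J"], rule exI[of _ "odo_map \<Gamma> K"], intro conjI allI AE_I2)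
  show "odo_map \<Lambda> J \<in> odo_measure \<Gamma> \<rightarrow>\<^sub>M odo_measure \<Lambda>"
    using measurable_odo_map[OF \<Gamma> \<Lambda> J] by (simp add: measurable_odo_measure(2)[OF \<Lambda>])
  show "odo_map \<Gamma> K \<in> odo_measure \<Lambda> \<rightarrow>\<^sub>M odo_measure \<Gamma>"
    using measurable_odo_map[OF \<Lambda> \<Gamma> K] by (simp add: measurable_odo_measure(2)[OF \<Gamma>])
  show "distr (odo_measure \<Gamma>) (odo_measure \<Lambda>) (odo_map \<Lambda> J) = odo_measure \<Lambda>"
    by (rule distr_odo_map[OF \<Gamma> \<Lambda> J])
  show "odo_map \<Gamma> K (odo_map \<Lambda> J x) = x" if "x \<in> space (odo_measure \<Gamma>)" for x
    using that odo_map_inverse[OF \<Gamma> \<Lambda> J K] by (simp add: odo_measure_sets(2)[OF \<Gamma>])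
  show "odo_map \<Lambda> J (odo_map \<Gamma> K x) = x" if "x \<in> space (odo_measure \<Lambda>)" for x
    using that odo_map_inverse[OF \<Lambda> \<Gamma> K J] by (simp add: odo_measure_sets(2)[OF \<Lambda>])
  show "odo_map \<Lambda> J (odo_act g x) = odo_act g (odo_map \<Lambda> J x)" if "x \<in> space (odo_measure \<Gamma>)" for g x
    using that odo_map_equivariant[OF \<Gamma> \<Lambda> J] by (simp add: odo_measure_sets(2)[OF \<Gamma>])
qed

text \<open>\<open>hsys_iso\<close> demands equivariance and measure preservation of
  \<open>\<phi>\<close> only. For \<open>\<psi>\<close> equivariance holds off null sets, which stay
  null when pulled back along \<open>\<psi>\<close> or the action.\<close>

lemma hsys_iso_odometer_sym:
  assumes \<Gamma>: "nested_lattices \<Gamma>" and \<Lambda>: "nested_lattices \<Lambda>"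
    and iso: "hsys_iso (odometer \<Gamma>) (odometer \<Lambda>)"
  shows "hsys_iso (odometer \<Lambda>) (odometer \<Gamma>)"
proof -
  define M N where "M = odo_measure \<Gamma>" and "N = odo_measure \<Lambda>"
  obtain \<phi> \<psi> where \<phi>: "\<phi> \<in> M \<rightarrow>\<^sub>M N" and \<psi>: "\<psi> \<in> N \<rightarrow>\<^sub>M M" and d: "distr M N \<phi> = N"
    and 1: "AE x in M. \<psi> (\<phi> x) = x" and 2: "AE y in N. \<phi> (\<psi> y) = y"
    and eq: "\<And>g. AE x in M. \<phi> (odo_act g x) = odo_act g (\<phi> x)"
    using iso unfolding hsys_iso_def odometer_def prod.case M_def N_def by blast
  have actM: "odo_act g \<in> M \<rightarrow>\<^sub>M M" "distr M M (odo_act g) = M" for g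
    unfolding M_def by (rule measurable_odo_act[OF \<Gamma>], rule odo_act_measure_preserving[OF \<Gamma>])
  have d': "distr N M \<psi> = M"
  proof -
    have "distr N M \<psi> = distr (distr M N \<phi>) M \<psi>" by (simp add: d)
    also have "\<dots> = distr M M (\<psi> \<circ> \<phi>)" by (rule distr_distr[OF \<psi> \<phi>])
    also have "\<dots> = distr M M (\<lambda>x. x)"
      using 1 measurable_comp[OF \<phi> \<psi>] by (intro distr_cong_AE) auto
    finally show ?thesis by (simp add: distr_id)
  qed
  have pull: "AE y in N. P (\<psi> y)" if "AE x in M. P x" for P
    by (rule AE_distrD[OF \<psi>, of P]) (simp only: d' that)
  have "AE y in N. \<psi> (odo_act g y) = odo_act g (\<psi> y)" for g
  proof -
    \<comment> \<open>The identity \<open>\<psi> (\<phi> x) = x\<close> is needed at the translated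
      point; invariance of the measure moves the null set.\<close>
    have "AE x in M. \<psi> (\<phi> (odo_act g x)) = odo_act g x"
      by (rule AE_distrD[OF actM(1), of "\<lambda>x. \<psi> (\<phi> x) = x" g]) (simp only: actM(2) 1)
    from pull[OF this] pull[OF eq[of g]] 2 show ?thesis
    proof eventually_elim
      case (elim y)
      then show ?case by metis
    qed
  qed
  with \<phi> \<psi> d' 1 2 show ?thesis
    unfolding hsys_iso_def odometer_def prod.case M_def N_def by blast
qed

subsection \<open>Eigenvalues\<close>

definition expi :: "real \<Rightarrow> complex" where
  "expi t = cis (2 * pi * t)"

lemma expi_add: "expi (s + t) = expi s * expi t"
  by (simp add: expi_def cis_mult ring_distribs)

lemma norm_expi [simp]: "norm (expi t) = 1"
  by (simp add: expi_def)

lemma expi_eq_1_iff: "expi t = 1 \<longleftrightarrow> t \<in> \<int>"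
proof
  assume "expi t = 1"
  then obtain n :: int where "2 * pi * t = of_int (2 * n) * pi"
    unfolding expi_def cis_conv_exp exp_eq_1 by auto
  then have "t = of_int n" by simp
  then show "t \<in> \<int>" by simp
qed (simp add: expi_def)

lemma measurable_expi [measurable]: "expi \<in> borel_measurable borel"
  unfolding expi_def by (intro borel_measurable_continuous_onI continuous_intros)

lemma hp_inner: "s \<bullet> hp x = s $ 1 * fst x + s $ 2 * fst (snd x)"
  by (cases x) (simp add: hp_def inner_vec_def sum_2)

lemma hp_inner_hmul: "s \<bullet> hp (hmul x y) = s \<bullet> hp x + s \<bullet> hp y"
  by (simp add: hp_inner algebra_simps)

text \<open>The acting set \<open>G\<close> is a parameter so that one transfer lemma covers both
  the whole group and its centre.\<close>

definition eigenvalue :: "(nat \<Rightarrow> h3 set) \<Rightarrow> h3 set \<Rightarrow> (h3 \<Rightarrow> complex) \<Rightarrow> bool" where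
  "eigenvalue \<Gamma> G \<kappa> \<longleftrightarrow> (\<exists>f \<in> borel_measurable (odo_measure \<Gamma>).
      (\<forall>x\<in>space (odo_measure \<Gamma>). norm (f x) = 1) \<and>
      (\<forall>g\<in>G. AE x in odo_measure \<Gamma>. f (odo_act g x) = \<kappa> g * f x))"

lemma eigenvalue_transfer:
  assumes iso: "hsys_iso (odometer \<Gamma>) (odometer \<Lambda>)" and eig: "eigenvalue \<Lambda> G \<kappa>"
  shows "eigenvalue \<Gamma> G \<kappa>"
proof -
  define M N where "M = odo_measure \<Gamma>" and "N = odo_measure \<Lambda>"
  obtain \<phi> where \<phi>: "\<phi> \<in> M \<rightarrow>\<^sub>M N" and d: "distr M N \<phi> = N"
    and eq: "\<And>g. AE x in M. \<phi> (odo_act g x) = odo_act g (\<phi> x)"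
    using iso unfolding hsys_iso_def odometer_def prod.case M_def N_def by blast
  obtain f where f: "f \<in> borel_measurable N" "\<And>x. x \<in> space N \<Longrightarrow> norm (f x) = 1"
    "\<And>g. g \<in> G \<Longrightarrow> AE x in N. f (odo_act g x) = \<kappa> g * f x"
    using eig unfolding eigenvalue_def N_def by blast
  have "AE x in M. f (\<phi> (odo_act g x)) = \<kappa> g * f (\<phi> x)" if "g \<in> G" for g
  proof -
    have "AE x in M. f (odo_act g (\<phi> x)) = \<kappa> g * f (\<phi> x)"
      by (rule AE_distrD[OF \<phi>, of "\<lambda>x. f (odo_act g x) = \<kappa> g * f x"]) (simp only: d f(3)[OF that])
    with eq[of g] show ?thesis by eventually_elim simp
  qed
  moreover have "norm (f (\<phi> x)) = 1" if "x \<in> space M" for x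
    using f(2) measurable_space[OF \<phi> that] by blast
  ultimately show ?thesis
    unfolding eigenvalue_def M_def[symmetric]
    using measurable_compose[OF \<phi> f(1)] by (intro bexI[of _ "\<lambda>x. f (\<phi> x)"] conjI ballI) simp_all
qed

text \<open>The section fails to be equivariant only by a lattice element on the right, which a
  character trivial on the lattice ignores.\<close>

lemma lat_sec_coset_translate:
  assumes lat: "lat L a b \<xi>"
  shows "\<exists>l\<in>L. sec (Wdom a b \<xi>) (qmap L (hmul g y)) = hmul (hmul g (sec (Wdom a b \<xi>) (qmap L y))) l"
proof -
  note W = lat_fdom[OF lat] and L = latD(1)[OF lat]
  define w where "w = sec (Wdom a b \<xi>) (qmap L y)"
  define w' where "w' = sec (Wdom a b \<xi>) (qmap L (hmul g y))"
  have "qmap L w' = qmap L (hmul g y)" unfolding w'_def by (rule sec_qmap(2)[OF W L])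
  also have "\<dots> = coset_translate g (qmap L y)" by simp
  also have "\<dots> = coset_translate g (qmap L w)" unfolding w_def by (simp only: sec_qmap(2)[OF W L])
  also have "\<dots> = qmap L (hmul g w)" by simp
  finally have "hmul (hinv (hmul g w)) w' \<in> L" by (metis qmap_eq_iff[OF L])
  then show ?thesis
    unfolding w_def[symmetric] w'_def[symmetric]
    by (intro bexI[of _ "hmul (hinv (hmul g w)) w'"]) simp_all
qed

text \<open>A central translation keeps the representative over the same point of the plane, and
  reducing its last coordinate modulo \<open>\<xi>\<close> brings it back into the box.\<close>

lemma lat_sec_central:
  assumes lat: "lat L a b \<xi>"
  shows "\<exists>k::int. snd (snd (sec (Wdom a b \<xi>) (qmap L (hmul (hc t) y))))
     = snd (snd (sec (Wdom a b \<xi>) (qmap L y))) + t - of_int k * \<xi>"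
proof -
  note W = lat_fdom[OF lat] and L = latD[OF lat]
  define w where "w = sec (Wdom a b \<xi>) (qmap L y)"
  have w: "w \<in> Wdom a b \<xi>" "qmap L w = qmap L y" unfolding w_def using sec_qmap[OF W L(1)] by blast+
  define k where "k = \<lfloor>(snd (snd w) + t) / \<xi>\<rfloor>"
  define v where "v = hmul w (hc (t - of_int k * \<xi>))"
  have v3: "snd (snd v) = snd (snd w) + t - of_int k * \<xi>" by (simp add: v_def hmul_eq)
  have "0 \<le> snd (snd v)" "snd (snd v) < \<xi>"
    using floor_divide_lower[OF L(6), of "snd (snd w) + t"] floor_divide_upper[OF L(6), of "snd (snd w) + t"]
    unfolding v3 k_def by (simp_all add: ring_distribs)
  then have vW: "v \<in> Wdom a b \<xi>"
    using w(1) unfolding Wdom_def by (simp add: v_def hdet_hmul hdet_hc)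
  have vt: "v = hmul (hmul (hc t) w) (hc (of_int (- k) * \<xi>))"
    by (simp add: v_def hc_central[of t w] hmul_assoc hc_simps)
  have "qmap L v = qmap L (hmul (hc t) w)"
    unfolding vt by (rule qmap_hmul_right[OF L(1)]) (use L(7) in blast)
  also have "\<dots> = coset_translate (hc t) (qmap L w)" by simp
  also have "\<dots> = qmap L (hmul (hc t) y)" by (simp add: w(2))
  finally have "sec (Wdom a b \<xi>) (qmap L (hmul (hc t) y)) = v"
    by (rule sec_qmap(3)[OF W L(1) vW])
  then show ?thesis unfolding w_def[symmetric] using v3 by auto
qed

lemma measurable_odo_sec:
  assumes \<Gamma>: "nested_lattices \<Gamma>" and lat: "lat (\<Gamma> j) a b \<xi>"
  shows "(\<lambda>x. sec (Wdom a b \<xi>) (x j)) \<in> odo_measure \<Gamma> \<rightarrow>\<^sub>M borel"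
  unfolding measurable_odo_measure(1)[OF \<Gamma>]
  by (rule measurable_compose[OF measurable_odo_coordinate[OF \<Gamma>] measurable_sec[OF lat_fdom[OF lat] latD(1,2)[OF lat]]])

lemma odo_act_coordinate:
  assumes "nested_lattices \<Gamma>" "x \<in> space (odo_measure \<Gamma>)"
  shows "\<exists>y. x j = qmap (\<Gamma> j) y \<and> odo_act g x j = qmap (\<Gamma> j) (hmul g y)"
proof -
  obtain y where "x j = qmap (\<Gamma> j) y"
    using odo_points_common[OF assms(1), of x j] assms(2) by (auto simp: odo_measure_sets(2)[OF assms(1)])
  then show ?thesis by (intro exI[of _ y]) (simp add: odo_act_def)
qed

lemma eigenvalueI_dual:
  assumes \<Gamma>: "nested_lattices \<Gamma>" and s: "\<And>x. x \<in> \<Gamma> j \<Longrightarrow> s \<bullet> hp x \<in> \<int>"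
  shows "eigenvalue \<Gamma> UNIV (\<lambda>g. expi (s \<bullet> hp g))"
proof -
  obtain a b \<xi> where lat: "lat (\<Gamma> j) a b \<xi>" using hlattice_lat[OF nestedD(1)[OF \<Gamma>]] by blast
  define f where "f x = expi (s \<bullet> hp (sec (Wdom a b \<xi>) (x j)))" for x :: "nat \<Rightarrow> h3 set"
  have "continuous_on UNIV (\<lambda>g. s \<bullet> hp g)" unfolding hp_inner by (intro continuous_intros)
  then have [measurable]: "(\<lambda>g. s \<bullet> hp g) \<in> borel_measurable borel" by (rule borel_measurable_continuous_onI)
  note [measurable] = measurable_odo_sec[OF \<Gamma> lat]
  have "f \<in> borel_measurable (odo_measure \<Gamma>)" unfolding f_def by measurable
  moreover have "f (odo_act g x) = expi (s \<bullet> hp g) * f x" if x: "x \<in> space (odo_measure \<Gamma>)" for g x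
  proof -
    obtain y where y: "x j = qmap (\<Gamma> j) y" "odo_act g x j = qmap (\<Gamma> j) (hmul g y)"
      using odo_act_coordinate[OF \<Gamma> x] by blast
    obtain l where l: "l \<in> \<Gamma> j" "sec (Wdom a b \<xi>) (qmap (\<Gamma> j) (hmul g y)) = hmul (hmul g (sec (Wdom a b \<xi>) (qmap (\<Gamma> j) y))) l"
      using lat_sec_coset_translate[OF lat] by blast
    have "expi (s \<bullet> hp l) = 1" using s[OF l(1)] by (simp add: expi_eq_1_iff)
    then show ?thesis unfolding f_def y l(2) by (simp add: hp_inner_hmul expi_add)
  qed
  moreover have "norm (f x) = 1" for x by (simp add: f_def)
  ultimately show ?thesis unfolding eigenvalue_def by (intro bexI[of _ f]) auto
qed

text \<open>The central coordinate modulo \<open>\<xi>\<close> does not in general descend to the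
  quotient, so it is read off the chosen representative. Translations by the centre shift this
  reading by a constant modulo \<open>\<xi>\<close>, hence the restriction to
  \<open>range hc\<close>.\<close>

lemma eigenvalueI_central:
  assumes \<Gamma>: "nested_lattices \<Gamma>" and lat: "lat (\<Gamma> j) a b \<xi>" and \<theta>: "\<theta> * \<xi> \<in> \<int>"
  shows "eigenvalue \<Gamma> (range hc) (\<lambda>g. expi (\<theta> * snd (snd g)))"
proof -
  define f where "f x = expi (\<theta> * snd (snd (sec (Wdom a b \<xi>) (x j))))" for x :: "nat \<Rightarrow> h3 set"
  have "continuous_on UNIV (\<lambda>g::h3. \<theta> * snd (snd g))" by (intro continuous_intros)
  then have [measurable]: "(\<lambda>g::h3. \<theta> * snd (snd g)) \<in> borel_measurable borel" by (rule borel_measurable_continuous_onI)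
  note [measurable] = measurable_odo_sec[OF \<Gamma> lat]
  have "f \<in> borel_measurable (odo_measure \<Gamma>)"
    unfolding f_def by (rule measurable_compose[OF measurable_odo_sec[OF \<Gamma> lat]]) measurable
  moreover have "f (odo_act (hc t) x) = expi (\<theta> * snd (snd (hc t))) * f x"
    if x: "x \<in> space (odo_measure \<Gamma>)" for t x
  proof -
    obtain y where y: "x j = qmap (\<Gamma> j) y" "odo_act (hc t) x j = qmap (\<Gamma> j) (hmul (hc t) y)"
      using odo_act_coordinate[OF \<Gamma> x] by blast
    obtain k :: int where k: "snd (snd (sec (Wdom a b \<xi>) (qmap (\<Gamma> j) (hmul (hc t) y))))
     = snd (snd (sec (Wdom a b \<xi>) (qmap (\<Gamma> j) y))) + t - of_int k * \<xi>"
      using lat_sec_central[OF lat] by blast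
    define z where "z = snd (snd (sec (Wdom a b \<xi>) (qmap (\<Gamma> j) y)))"
    have "of_int (- k) * (\<theta> * \<xi>) \<in> \<int>" by (rule Ints_mult[OF Ints_of_int \<theta>])
    then have "expi (of_int (- k) * (\<theta> * \<xi>)) = 1" by (simp only: expi_eq_1_iff)
    moreover have "\<theta> * (z + t - of_int k * \<xi>) = \<theta> * t + \<theta> * z + of_int (- k) * (\<theta> * \<xi>)"
      by (simp add: algebra_simps)
    ultimately show ?thesis unfolding f_def y k z_def[symmetric] by (simp only: expi_add snd_snd_hc mult_1_right)
  qed
  moreover have "norm (f x) = 1" for x by (simp add: f_def)
  ultimately show ?thesis unfolding eigenvalue_def by (intro bexI[of _ f]) auto
qed

section \<open>Eigenvalues are detected at a finite level\<close>

text \<open>Were every such integral zero, the complex measure with density \<open>f\<close> would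
  vanish on the cylinders, hence on the generated sigma-algebra, and \<open>f\<close> would be zero
  almost everywhere.\<close>

lemma eigenfunction_level:
  fixes f :: "(nat \<Rightarrow> h3 set) \<Rightarrow> complex"
  assumes \<Gamma>: "nested_lattices \<Gamma>" and f: "f \<in> borel_measurable (odo_measure \<Gamma>)"
    and norm: "\<And>x. x \<in> space (odo_measure \<Gamma>) \<Longrightarrow> norm (f x) = 1"
  shows "\<exists>j. \<exists>E\<in>sets (quot_space (\<Gamma> j)). (\<integral>x. f x * of_real (indicator E (x j)) \<partial>odo_measure \<Gamma>) \<noteq> 0"
proof (rule ccontr)
  assume "\<not> ?thesis"
  then have 0: "(\<integral>x. f x * of_real (indicator E (x j)) \<partial>odo_measure \<Gamma>) = 0"
    if "E \<in> sets (quot_space (\<Gamma> j))" for j E using that by blast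
  define M where "M = odo_measure \<Gamma>"
  interpret prob_space M unfolding M_def by (rule odo_measure_sets(3)[OF \<Gamma>])
  have int: "integrable M f"
    using f norm by (intro integrable_const_bound[where B = 1]) (auto simp: M_def)
  have sint: "set_integrable M A f" if "A \<in> sets M" for A
    using int that unfolding set_integrable_def by (simp add: integrable_mult_indicator)
  have gen: "set_lebesgue_integral M A f = 0" if A: "A \<in> odo_gen \<Gamma>" for A
  proof -
    obtain j E where E: "A = (\<lambda>x. x j) -` E \<inter> odo_points \<Gamma>" "E \<in> sets (quot_space (\<Gamma> j))"
      using A unfolding odo_gen_def by blast
    have "set_lebesgue_integral M A f = (\<integral>x. f x * of_real (indicator E (x j)) \<partial>M)"
      unfolding set_lebesgue_integral_def
      by (intro Bochner_Integration.integral_cong)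
        (auto simp: M_def odo_measure_sets(2)[OF \<Gamma>] E split: split_indicator)
    then show ?thesis using 0[OF E(2)] by (simp add: M_def)
  qed
  have Msets: "sets M = sigma_sets (odo_points \<Gamma>) (odo_gen \<Gamma>)"
    by (simp add: M_def odo_measure_sets(1)[OF \<Gamma>] odo_sigma_sets)
  have spM: "space M = odo_points \<Gamma>" by (simp add: M_def odo_measure_sets(2)[OF \<Gamma>])
  have closed: "odo_gen \<Gamma> \<subseteq> Pow (odo_points \<Gamma>)" by (auto simp: odo_gen_def)
  have all: "set_lebesgue_integral M A f = 0" if "A \<in> sets M" for A
    using odo_gen_Int_stable[OF \<Gamma>] closed that[unfolded Msets]
  proof (induction rule: sigma_sets_induct_disjoint)
    case (basic A) then show ?case by (rule gen)
  next
    case empty show ?case by (simp add: set_lebesgue_integral_def)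
  next
    case (compl A)
    have A: "A \<in> sets M" using compl by (simp add: Msets)
    have "set_lebesgue_integral M (A \<union> (space M - A)) f
      = set_lebesgue_integral M A f + set_lebesgue_integral M (space M - A) f"
      using A by (intro set_integral_Un sint) auto
    moreover have "A \<union> (space M - A) = odo_points \<Gamma>" using sets.sets_into_space[OF A] spM by auto
    ultimately show ?case using gen[OF odo_points_gen[OF \<Gamma>]] compl.IH by (simp add: spM)
  next
    case (union A)
    have A: "\<And>i. A i \<in> sets M" using union(2) by (auto simp: Msets)
    have "set_lebesgue_integral M (\<Union>i. A i) f = (\<Sum>i. set_lebesgue_integral M (A i) f)"
      using A union(1) by (intro lebesgue_integral_countable_add sint) (auto simp: disjoint_family_on_def)
    then show ?case using union(3) by simp
  qed
  have "AE x in M. f x = 0" by (rule density_zero[OF int all])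
  moreover have "AE x in M. norm (f x) = 1" using norm by (intro AE_I2) (simp add: M_def)
  ultimately have "AE x in M. False" by eventually_elim simp
  then show False by simp
qed

text \<open>Invariance of the measure allows \<open>odo_act g x\<close> in place of
  \<open>x\<close>; the factor \<open>c\<close> comes from \<open>f\<close>, and the translation is
  left on the test function.\<close>

lemma eigenfunction_shift:
  fixes f :: "(nat \<Rightarrow> h3 set) \<Rightarrow> complex" and u :: "h3 set \<Rightarrow> real"
  assumes \<Gamma>: "nested_lattices \<Gamma>" and f: "f \<in> borel_measurable (odo_measure \<Gamma>)"
    and u: "u \<in> borel_measurable (quot_space (\<Gamma> j))"
    and eig: "AE x in odo_measure \<Gamma>. f (odo_act g x) = c * f x"
  shows "(\<integral>x. f x * of_real (u (x j)) \<partial>odo_measure \<Gamma>)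
    = c * (\<integral>x. f x * of_real (u (coset_translate g (x j))) \<partial>odo_measure \<Gamma>)"
proof -
  define M where "M = odo_measure \<Gamma>"
  have [measurable]: "(\<lambda>x. x j) \<in> M \<rightarrow>\<^sub>M quot_space (\<Gamma> j)"
    using measurable_odo_coordinate[OF \<Gamma>] by (simp add: M_def measurable_odo_measure[OF \<Gamma>])
  have act [measurable]: "odo_act g \<in> M \<rightarrow>\<^sub>M M" unfolding M_def by (rule measurable_odo_act[OF \<Gamma>])
  note [measurable] = f[folded M_def] u measurable_coset_translate[OF nestedD(2)[OF \<Gamma>]]
  have "(\<integral>x. f x * of_real (u (x j)) \<partial>M) = (\<integral>x. f x * of_real (u (x j)) \<partial>distr M M (odo_act g))"
    by (simp add: M_def odo_act_measure_preserving[OF \<Gamma>])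
  also have "\<dots> = (\<integral>x. f (odo_act g x) * of_real (u (odo_act g x j)) \<partial>M)"
    by (rule integral_distr) measurable
  also have "\<dots> = (\<integral>x. c * (f x * of_real (u (coset_translate g (x j)))) \<partial>M)"
  proof (rule integral_cong_AE)
    show "(\<lambda>x. f (odo_act g x) * of_real (u (odo_act g x j))) \<in> borel_measurable M"
      by (rule measurable_compose[OF act]) measurable
    show "AE x in M. f (odo_act g x) * of_real (u (odo_act g x j)) = c * (f x * of_real (u (coset_translate g (x j))))"
      using eig unfolding M_def[symmetric] by eventually_elim (simp add: odo_act_def)
  qed measurable
  finally show ?thesis by (simp add: M_def)
qed

lemma eigenvalueD_central:
  assumes \<Gamma>: "nested_lattices \<Gamma>" and eig: "eigenvalue \<Gamma> (range hc) (\<lambda>g. expi (\<theta> * snd (snd g)))"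
  shows "\<exists>j. \<forall>t. hc t \<in> \<Gamma> j \<longrightarrow> \<theta> * t \<in> \<int>"
proof -
  define M where "M = odo_measure \<Gamma>"
  obtain f where f: "f \<in> borel_measurable M" "\<And>x. x \<in> space M \<Longrightarrow> norm (f x) = 1"
    and fe: "\<And>t. AE x in M. f (odo_act (hc t) x) = expi (\<theta> * t) * f x"
    using eig unfolding eigenvalue_def M_def by fastforce
  obtain j E where E: "E \<in> sets (quot_space (\<Gamma> j))" and nz: "(\<integral>x. f x * of_real (indicator E (x j)) \<partial>M) \<noteq> 0"
    using eigenfunction_level[OF \<Gamma> f[unfolded M_def]] unfolding M_def by blast
  have "\<theta> * t \<in> \<int>" if t: "hc t \<in> \<Gamma> j" for t
  proof -
    have "(\<integral>x. f x * of_real (indicator E (x j)) \<partial>M)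
       = expi (\<theta> * t) * (\<integral>x. f x * of_real (indicator E (coset_translate (hc t) (x j))) \<partial>M)"
      unfolding M_def
      by (rule eigenfunction_shift[OF \<Gamma> f(1)[unfolded M_def] borel_measurable_indicator[OF E] fe[unfolded M_def]])
    also have "(\<integral>x. f x * of_real (indicator E (coset_translate (hc t) (x j))) \<partial>M)
       = (\<integral>x. f x * of_real (indicator E (x j)) \<partial>M)"
    proof (rule Bochner_Integration.integral_cong[OF refl])
      fix x assume "x \<in> space M"
      then obtain y where "x j = qmap (\<Gamma> j) y"
        using odo_act_coordinate[OF \<Gamma>] unfolding M_def by blast
      then have "coset_translate (hc t) (x j) = x j"
        by (simp add: hc_central qmap_hmul_right[OF nestedD(2)[OF \<Gamma>] t])
      then show "f x * of_real (indicator E (coset_translate (hc t) (x j))) = f x * of_real (indicator E (x j))" by simp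
    qed
    finally have "expi (\<theta> * t) = 1" using nz by simp
    then show ?thesis by (simp add: expi_eq_1_iff)
  qed
  then show ?thesis by blast
qed

lemma emeasure_lborel_shift:
  fixes A :: "real set" assumes "A \<in> sets borel"
  shows "emeasure lborel ((+) c -` A) = emeasure lborel A"
proof -
  have "emeasure lborel A = emeasure (distr lborel borel ((+) c)) A" by (simp add: lborel_distr_plus)
  also have "\<dots> = emeasure lborel ((+) c -` A)" using assms by (subst emeasure_distr) auto
  finally show ?thesis by simp
qed

text \<open>The period absorbs the integer part of \<open>\<tau>\<close>. The remaining window from
  \<open>r\<close> to \<open>r + 1\<close> is cut at 1 and its upper part moved down by one
  period.\<close>

lemma periodic_emeasure_shift:
  fixes A :: "real set"
  assumes [measurable]: "A \<in> sets borel" and per: "\<And>t. t + 1 \<in> A \<longleftrightarrow> t \<in> A"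
  shows "emeasure lborel ({0..<1} \<inter> (+) \<tau> -` A) = emeasure lborel ({0..<1} \<inter> A)"
proof -
  have peri: "t + of_int n \<in> A \<longleftrightarrow> t \<in> A" for t n
  proof (induction n rule: int_induct[where k = 0])
    case (step1 i) then show ?case using per[of "t + of_int i"] by (simp add: add.assoc)
  next
    case (step2 i) then show ?case using per[of "t + of_int i - 1"] by (simp add: algebra_simps)
  qed simp
  define r where "r = frac \<tau>"
  have r: "0 \<le> r" "r < 1" by (simp_all add: r_def frac_lt_1)
  have "(+) \<tau> -` A = (+) r -` A"
  proof (rule set_eqI)
    fix t
    have "\<tau> + t = (r + t) + of_int \<lfloor>\<tau>\<rfloor>" by (simp add: r_def frac_def)
    then show "t \<in> (+) \<tau> -` A \<longleftrightarrow> t \<in> (+) r -` A" using peri[of "r + t" "\<lfloor>\<tau>\<rfloor>"] by (simp only: vimage_eq)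
  qed
  then have "emeasure lborel ({0..<1} \<inter> (+) \<tau> -` A) = emeasure lborel ((+) r -` ({r..<r + 1} \<inter> A))"
    by (intro arg_cong[where f = "emeasure lborel"]) auto
  also have "\<dots> = emeasure lborel ({r..<r + 1} \<inter> A)" by (rule emeasure_lborel_shift) simp
  also have "{r..<r + 1} \<inter> A = ({r..<1} \<inter> A) \<union> ({1..<r + 1} \<inter> A)" using r by auto
  also have "emeasure lborel \<dots> = emeasure lborel ({r..<1} \<inter> A) + emeasure lborel ({1..<r + 1} \<inter> A)"
    by (intro plus_emeasure[symmetric]) auto
  also have "emeasure lborel ({1..<r + 1} \<inter> A) = emeasure lborel ((+) 1 -` ({1..<r + 1} \<inter> A))"
    by (intro emeasure_lborel_shift[symmetric]) simp
  also have "(+) 1 -` ({1..<r + 1} \<inter> A) = {0..<r} \<inter> A"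
  proof (rule set_eqI)
    fix t show "t \<in> (+) 1 -` ({1..<r + 1} \<inter> A) \<longleftrightarrow> t \<in> {0..<r} \<inter> A"
      using per[of t] by (simp add: add.commute[of 1])
  qed
  also have "emeasure lborel ({r..<1} \<inter> A) + emeasure lborel ({0..<r} \<inter> A)
     = emeasure lborel (({r..<1} \<inter> A) \<union> ({0..<r} \<inter> A))"
    by (intro plus_emeasure) auto
  also have "({r..<1} \<inter> A) \<union> ({0..<r} \<inter> A) = {0..<1} \<inter> A" using r by auto
  finally show ?thesis .
qed

text \<open>The test function is averaged over the centre first: on functions invariant under the
  centre, left translation by an element of \<open>\<Gamma> j\<close> acts trivially.\<close>
lemma eigenvalueD_dual:
  assumes \<Gamma>: "nested_lattices \<Gamma>" and eig: "eigenvalue \<Gamma> UNIV (\<lambda>g. expi (s \<bullet> hp g))"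
  shows "\<exists>j. \<forall>x\<in>\<Gamma> j. s \<bullet> hp x \<in> \<int>"
proof -
  define M where "M = odo_measure \<Gamma>"
  obtain f where f [measurable]: "f \<in> borel_measurable M" and norm: "\<And>x. x \<in> space M \<Longrightarrow> norm (f x) = 1"
    and fe: "\<And>g. AE x in M. f (odo_act g x) = expi (s \<bullet> hp g) * f x"
    using eig unfolding eigenvalue_def M_def by fastforce
  obtain j E where E: "E \<in> sets (quot_space (\<Gamma> j))" and nz: "(\<integral>x. f x * of_real (indicator E (x j)) \<partial>M) \<noteq> 0"
    using eigenfunction_level[OF \<Gamma> f[unfolded M_def] norm[unfolded M_def]] unfolding M_def by blast
  obtain a b \<xi> where lat: "lat (\<Gamma> j) a b \<xi>" using hlattice_lat[OF nestedD(1)[OF \<Gamma>]] by blast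
  note L = latD[OF lat]
  define P where "P = uniform_measure lborel {0..<1::real}"
  interpret M: prob_space M unfolding M_def by (rule odo_measure_sets(3)[OF \<Gamma>])
  interpret P: prob_space P unfolding P_def by (rule prob_space_uniform_measure) simp_all
  interpret MP: pair_prob_space M P ..
  have [measurable_cong]: "sets P = sets borel" by (simp add: P_def)
  have coord [measurable]: "(\<lambda>x. x j) \<in> M \<rightarrow>\<^sub>M quot_space (\<Gamma> j)"
    using measurable_odo_coordinate[OF \<Gamma>] by (simp add: M_def measurable_odo_measure[OF \<Gamma>])
  have [measurable]: "hc \<in> borel_measurable borel"
    unfolding hc_def by (intro borel_measurable_continuous_onI continuous_intros)
  note E [measurable]
  note pair [measurable] = measurable_coset_translate_pair[OF lat_fdom[OF lat] L(1,2)]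
  \<comment> \<open>\<open>U\<close> is the mean of the indicator over one full turn of the central
    circle through \<open>C\<close>: the factor \<open>\<xi>\<close> makes \<open>t\<close> range
    over one period, as \<open>hc \<xi>\<close> acts trivially.\<close>
  define U :: "h3 set \<Rightarrow> real" where "U C = (\<integral>t. indicator E (coset_translate (hc (t * \<xi>)) C) \<partial>P)" for C :: "h3 set"
  have m2 [measurable]: "(\<lambda>z. coset_translate (hc (snd z * \<xi>)) (fst z)) \<in> quot_space (\<Gamma> j) \<Otimes>\<^sub>M P \<rightarrow>\<^sub>M quot_space (\<Gamma> j)"
  proof -
    have "(\<lambda>z. (hc (snd z * \<xi>), fst z)) \<in> quot_space (\<Gamma> j) \<Otimes>\<^sub>M P \<rightarrow>\<^sub>M borel \<Otimes>\<^sub>M quot_space (\<Gamma> j)" by measurable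
    from measurable_compose[OF this pair] show ?thesis by simp
  qed
  have U_meas: "U \<in> borel_measurable (quot_space (\<Gamma> j))"
    unfolding U_def by (rule P.borel_measurable_lebesgue_integral) (simp add: case_prod_beta)
  have mF: "(\<lambda>z. f (fst z) * of_real (indicator E (coset_translate (hc (snd z * \<xi>)) (fst z j))))
      \<in> borel_measurable (M \<Otimes>\<^sub>M P)"
  proof -
    have "(\<lambda>z. (fst z j, snd z)) \<in> M \<Otimes>\<^sub>M P \<rightarrow>\<^sub>M quot_space (\<Gamma> j) \<Otimes>\<^sub>M P" by measurable
    from measurable_compose[OF this m2]
    have [measurable]: "(\<lambda>z. coset_translate (hc (snd z * \<xi>)) (fst z j)) \<in> M \<Otimes>\<^sub>M P \<rightarrow>\<^sub>M quot_space (\<Gamma> j)" by simp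
    show ?thesis by measurable
  qed
  have intF: "integrable (M \<Otimes>\<^sub>M P) (\<lambda>(x, t). f x * of_real (indicator E (coset_translate (hc (t * \<xi>)) (x j))))"
  proof (rule MP.integrable_const_bound[where B = 1])
    show "AE z in M \<Otimes>\<^sub>M P. norm (case z of (x, t) \<Rightarrow> f x * of_real (indicator E (coset_translate (hc (t * \<xi>)) (x j)))) \<le> 1"
      using norm by (intro AE_I2) (auto simp: space_pair_measure norm_mult split: split_indicator)
  qed (use mF in \<open>simp add: case_prod_beta\<close>)
  have "(\<integral>x. f x * of_real (U (x j)) \<partial>M)
      = (\<integral>x. (\<integral>t. f x * of_real (indicator E (coset_translate (hc (t * \<xi>)) (x j))) \<partial>P) \<partial>M)"
    unfolding U_def by (simp add: integral_complex_of_real)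
  also have "\<dots> = (\<integral>t. (\<integral>x. f x * of_real (indicator E (coset_translate (hc (t * \<xi>)) (x j))) \<partial>M) \<partial>P)"
    by (rule MP.Fubini_integral[symmetric, OF intF])
  also have "\<dots> = (\<integral>t. (\<integral>x. f x * of_real (indicator E (x j)) \<partial>M) \<partial>P)"
  proof (rule Bochner_Integration.integral_cong[OF refl])
    fix t
    \<comment> \<open>The character is trivial on the centre, so averaging does not change the
      correlation with \<open>f\<close>.\<close>
    have "expi (s \<bullet> hp (hc (t * \<xi>))) = 1" by (simp add: hp_inner expi_def)
    then show "(\<integral>x. f x * of_real (indicator E (coset_translate (hc (t * \<xi>)) (x j))) \<partial>M)
       = (\<integral>x. f x * of_real (indicator E (x j)) \<partial>M)"
      using eigenfunction_shift[OF \<Gamma> f[unfolded M_def] borel_measurable_indicator[OF E] fe[unfolded M_def, of "hc (t * \<xi>)"]]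
      by (simp add: M_def)
  qed
  also have "\<dots> = (\<integral>x. f x * of_real (indicator E (x j)) \<partial>M)" by (simp add: P.prob_space)
  finally have nzU: "(\<integral>x. f x * of_real (U (x j)) \<partial>M) \<noteq> 0" using nz by simp
  have U_inv: "U (coset_translate \<gamma> (qmap (\<Gamma> j) y)) = U (qmap (\<Gamma> j) y)" if \<gamma>: "\<gamma> \<in> \<Gamma> j" for \<gamma> y
  proof -
    define A where "A = {t. qmap (\<Gamma> j) (hmul (hc (t * \<xi>)) y) \<in> E}"
    \<comment> \<open>\<open>hmul \<gamma> y\<close> equals \<open>hmul y \<gamma>\<close> up to the
      central factor \<open>hc (hdet \<gamma> y)\<close>. Moving the coset of \<open>y\<close> by
      \<open>\<gamma>\<close> is thus a rotation of its central circle, by \<open>\<tau>\<close>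
      when one period has length 1.\<close>
    define \<tau> where "\<tau> = hdet \<gamma> y / \<xi>"
    have [measurable]: "qmap (\<Gamma> j) \<in> borel \<rightarrow>\<^sub>M quot_space (\<Gamma> j)" by (rule measurable_qmap[OF L(1)])
    have "(\<lambda>t. qmap (\<Gamma> j) (hmul (hc (t * \<xi>)) y)) -` E \<inter> space borel \<in> sets borel"
      by (rule measurable_sets[OF _ E]) measurable
    then have A [measurable]: "A \<in> sets borel" by (simp add: A_def vimage_def)
    have per: "t + 1 \<in> A \<longleftrightarrow> t \<in> A" for t
    proof -
      have "hmul (hc ((t + 1) * \<xi>)) y = hmul (hmul (hc (t * \<xi>)) y) (hc (of_int 1 * \<xi>))"
        by (simp add: hmul_assoc hc_central[symmetric]) (simp add: hc_simps ring_distribs flip: hmul_assoc)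
      moreover have "hc (of_int 1 * \<xi>) \<in> \<Gamma> j" using L(7) by blast
      ultimately show ?thesis unfolding A_def by (simp add: qmap_hmul_right[OF L(1)])
    qed
    have UA: "U (qmap (\<Gamma> j) y) = measure lborel ({0..<1} \<inter> A)"
    proof -
      have "U (qmap (\<Gamma> j) y) = (\<integral>t. indicator A t \<partial>P)"
        unfolding U_def by (intro Bochner_Integration.integral_cong refl) (simp add: A_def split: split_indicator)
      also have "\<dots> = measure P A" by (simp add: P_def)
      also have "\<dots> = measure lborel ({0..<1} \<inter> A)" unfolding P_def by (subst measure_uniform_measure) auto
      finally show ?thesis .
    qed
    have UA': "U (coset_translate \<gamma> (qmap (\<Gamma> j) y)) = measure lborel ({0..<1} \<inter> (+) \<tau> -` A)"
    proof -
      have "coset_translate (hc (t * \<xi>)) (coset_translate \<gamma> (qmap (\<Gamma> j) y)) = qmap (\<Gamma> j) (hmul (hc ((\<tau> + t) * \<xi>)) y)" for t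
      proof -
        have "\<tau> * \<xi> = hdet \<gamma> y" using L(6) by (simp add: \<tau>_def)
        then have "hmul (hc (t * \<xi>)) (hmul \<gamma> y) = hmul (hmul (hc ((\<tau> + t) * \<xi>)) y) \<gamma>"
          by (cases \<gamma>; cases y) (simp add: hc_def algebra_simps)
        then show ?thesis by (simp add: qmap_hmul_right[OF L(1) \<gamma>])
      qed
      then have "U (coset_translate \<gamma> (qmap (\<Gamma> j) y)) = (\<integral>t. indicator ((+) \<tau> -` A) t \<partial>P)"
        unfolding U_def by (intro Bochner_Integration.integral_cong refl) (simp add: A_def split: split_indicator)
      also have "\<dots> = measure P ((+) \<tau> -` A)" by (simp add: P_def)
      also have "\<dots> = measure lborel ({0..<1} \<inter> (+) \<tau> -` A)"
        unfolding P_def using measurable_sets_borel[of "(+) \<tau>" borel A]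
        by (subst measure_uniform_measure) auto
      finally show ?thesis .
    qed
    show ?thesis
      unfolding UA UA' measure_def by (simp add: periodic_emeasure_shift[OF A per])
  qed
  have "s \<bullet> hp \<gamma> \<in> \<int>" if \<gamma>: "\<gamma> \<in> \<Gamma> j" for \<gamma>
  proof -
    have "(\<integral>x. f x * of_real (U (x j)) \<partial>M)
      = expi (s \<bullet> hp \<gamma>) * (\<integral>x. f x * of_real (U (coset_translate \<gamma> (x j))) \<partial>M)"
      unfolding M_def
      by (rule eigenfunction_shift[OF \<Gamma> f[unfolded M_def] U_meas fe[unfolded M_def]])
    also have "(\<integral>x. f x * of_real (U (coset_translate \<gamma> (x j))) \<partial>M) = (\<integral>x. f x * of_real (U (x j)) \<partial>M)"
    proof (rule Bochner_Integration.integral_cong[OF refl])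
      fix x assume "x \<in> space M"
      then obtain y where "x j = qmap (\<Gamma> j) y"
        using odo_act_coordinate[OF \<Gamma>] unfolding M_def by blast
      then show "f x * of_real (U (coset_translate \<gamma> (x j))) = f x * of_real (U (x j))"
        using U_inv[OF \<gamma>, of y] by (simp del: coset_translate_qmap)
    qed
    finally have "expi (s \<bullet> hp \<gamma>) = 1" using nzU by simp
    then show ?thesis by (simp add: expi_eq_1_iff)
  qed
  then show ?thesis by blast
qed

subsection \<open>Lattices with prescribed projection and centre\<close>

lemma hp_eq_iff: "hp x = hp y \<longleftrightarrow> fst x = fst y \<and> fst (snd x) = fst (snd y)"
  by (cases x; cases y) (simp add: hp_def vec_eq_iff forall_2)

text \<open>Two positive generators are integer multiples of each other, so the choice in
  \<open>xi_lat\<close> is determined.\<close>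

lemma lat_xi_lat:
  assumes "lat L a b \<xi>"
  shows "xi_lat L = \<xi>"
  unfolding xi_lat_def
proof (rule some_equality)
  note L = latD[OF assms]
  have eq: "L \<inter> range hc = {hc (of_int m * \<xi>) | m. True}"
  proof (rule set_eqI)
    fix x
    show "x \<in> L \<inter> range hc \<longleftrightarrow> x \<in> {hc (of_int m * \<xi>) | m. True}" by (auto simp: L(7))
  qed
  with L(6) show "\<xi> > 0 \<and> L \<inter> range hc = {hc (of_int m * \<xi>) | m. True}" by blast
  fix \<zeta> assume \<zeta>: "\<zeta> > 0 \<and> L \<inter> range hc = {hc (of_int m * \<zeta>) | m. True}"
  have "hc (of_int 1 * \<zeta>) \<in> {hc (of_int m * \<xi>) | m. True}" using \<zeta> unfolding eq[symmetric] by blast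
  then obtain k :: int where k: "\<zeta> = of_int k * \<xi>" by auto
  have "hc (of_int 1 * \<xi>) \<in> {hc (of_int m * \<zeta>) | m. True}"
    using \<zeta> unfolding eq by (metis (mono_tags, lifting) mem_Collect_eq)
  then obtain l :: int where l: "\<xi> = of_int l * \<zeta>" by auto
  have kl: "real_of_int (l * k) * \<xi> = 1 * \<xi>" using k l by (simp add: mult.assoc)
  have "real_of_int (l * k) = 1" using kl L(6) by (metis mult_right_cancel less_irrefl)
  then have "l * k = 1" by linarith
  moreover have "k > 0" using k \<zeta> L(6) by (metis of_int_0_less_iff zero_less_mult_pos2)
  ultimately have "k = 1" by (auto simp: zmult_eq_1_iff)
  then show "\<zeta> = \<xi>" using k by simp
qed

text \<open>The right-hand side depends on the lattice alone and not on the matrix chosen for it,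
  which makes the choice in \<open>p_dual\<close> harmless.\<close>

lemma dual_lattice_eq:
  fixes A :: "real^2^2"
  assumes "invertible A"
  shows "(\<lambda>v. matrix_inv (transpose A) *v v) ` int_vecs = {s. \<forall>v\<in>int_vecs. s \<bullet> (A *v v) \<in> \<int>}"
proof -
  have inv: "invertible (transpose A)" using assms by (rule transpose_invertible)
  have "transpose A ** matrix_inv (transpose A) = mat 1 \<and> matrix_inv (transpose A) ** transpose A = mat 1"
    unfolding matrix_inv_def by (rule someI_ex) (use inv in \<open>simp add: invertible_def\<close>)
  then have inv_right: "transpose A ** matrix_inv (transpose A) = mat 1"
    and inv_left: "matrix_inv (transpose A) ** transpose A = mat 1" by blast+
  have key: "(\<forall>v\<in>int_vecs. w \<bullet> v \<in> \<int>) \<longleftrightarrow> w \<in> int_vecs" for w :: "real^2"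
  proof
    assume *: "\<forall>v\<in>int_vecs. w \<bullet> v \<in> \<int>"
    have "w $ i \<in> \<int>" for i
    proof -
      have "axis i 1 \<in> int_vecs" by (simp add: int_vecs_def axis_def)
      with * have "w \<bullet> axis i 1 \<in> \<int>" by blast
      then show ?thesis by (simp add: inner_axis)
    qed
    then show "w \<in> int_vecs" by (simp add: int_vecs_def)
  next
    assume "w \<in> int_vecs"
    then show "\<forall>v\<in>int_vecs. w \<bullet> v \<in> \<int>"
      by (auto simp: int_vecs_def inner_vec_def sum_2 intro!: Ints_add Ints_mult)
  qed
  have adj: "s \<bullet> (A *v v) = (transpose A *v s) \<bullet> v" for s v
    by (metis dot_lmul_matrix vector_transpose_matrix transpose_transpose inner_commute)
  have "s \<in> (\<lambda>v. matrix_inv (transpose A) *v v) ` int_vecs \<longleftrightarrow> transpose A *v s \<in> int_vecs" for s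
  proof
    assume "s \<in> (\<lambda>v. matrix_inv (transpose A) *v v) ` int_vecs"
    then obtain v where v: "v \<in> int_vecs" "s = matrix_inv (transpose A) *v v" by blast
    then have "transpose A *v s = v"
      by (simp add: matrix_vector_mul_assoc inv_right)
    then show "transpose A *v s \<in> int_vecs" using v by simp
  next
    assume "transpose A *v s \<in> int_vecs"
    moreover have "s = matrix_inv (transpose A) *v (transpose A *v s)"
      by (simp only: matrix_vector_mul_assoc inv_left matrix_vector_mul_lid)
    ultimately show "s \<in> (\<lambda>v. matrix_inv (transpose A) *v v) ` int_vecs" by blast
  qed
  then show ?thesis unfolding adj key by blast
qed

lemma lat_p_dual:
  assumes "lat L a b \<xi>"
  shows "p_dual L = {s. \<forall>x\<in>L. s \<bullet> hp x \<in> \<int>}"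
proof -
  note L = latD[OF assms]
  \<comment> \<open>The columns are the projections of \<open>a\<close> and
    \<open>b\<close>.\<close>
  define A :: "real^2^2" where "A = transpose (vector [hp a, hp b])"
  have Av: "A *v v = vector [v $ 1 * fst a + v $ 2 * fst b, v $ 1 * fst (snd a) + v $ 2 * fst (snd b)]" for v
    by (cases a; cases b)
      (simp add: A_def vec_eq_iff forall_2 matrix_vector_mult_def transpose_def sum_2 hp_def mult.commute)
  have "det A = hdet a b"
    by (cases a; cases b) (simp add: A_def det_2 transpose_def hp_def algebra_simps)
  then have inv: "invertible A" using L(5) by (simp add: invertible_det_nz)
  have img: "hp ` L = (\<lambda>v. A *v v) ` int_vecs"
  proof (intro equalityI subsetI)
    fix p assume "p \<in> hp ` L"
    then obtain x where x: "x \<in> L" "p = hp x" by blast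
    obtain m n :: int where mn: "fst x = of_int m * fst a + of_int n * fst b"
        "fst (snd x) = of_int m * fst (snd a) + of_int n * fst (snd b)"
      using L(8)[OF x(1)] by blast
    have "p = A *v vector [of_int m, of_int n]"
      using x(2) mn by (cases x) (simp add: Av hp_def)
    moreover have "(vector [of_int m, of_int n] :: real^2) \<in> int_vecs" by (simp add: int_vecs_def forall_2)
    ultimately show "p \<in> (\<lambda>v. A *v v) ` int_vecs" by blast
  next
    fix p assume "p \<in> (\<lambda>v. A *v v) ` int_vecs"
    then obtain v where v: "v \<in> int_vecs" "p = A *v v" by blast
    then have "v $ 1 \<in> \<int>" "v $ 2 \<in> \<int>" by (auto simp: int_vecs_def)
    then obtain m n :: int where mn: "v $ 1 = of_int m" "v $ 2 = of_int n" by (metis Ints_cases)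
    obtain x where x: "x \<in> L" "fst x = of_int m * fst a + of_int n * fst b"
        "fst (snd x) = of_int m * fst (snd a) + of_int n * fst (snd b)"
      using hsubgroup_int_combination[OF L(1,3,4)] by blast
    have "p = hp x" using v(2) mn x by (cases x) (simp add: Av hp_def)
    then show "p \<in> hp ` L" using x(1) by blast
  qed
  have "S = {s. \<forall>x\<in>L. s \<bullet> hp x \<in> \<int>}"
    if "invertible B \<and> hp ` L = (\<lambda>v. B *v v) ` int_vecs \<and> S = (\<lambda>v. matrix_inv (transpose B) *v v) ` int_vecs"
    for S and B :: "real^2^2"
  proof -
    have "S = {s. \<forall>v\<in>int_vecs. s \<bullet> (B *v v) \<in> \<int>}" using that dual_lattice_eq by blast
    also have "\<dots> = {s. \<forall>p\<in>hp ` L. s \<bullet> p \<in> \<int>}" using that by simp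
    finally show ?thesis by simp
  qed
  note unique = this
  show ?thesis
    unfolding p_dual_def
  proof (rule some_equality)
    show "\<exists>A :: real^2^2. invertible A \<and> hp ` L = (\<lambda>v. A *v v) ` int_vecs \<and>
        {s. \<forall>x\<in>L. s \<bullet> hp x \<in> \<int>} = (\<lambda>v. matrix_inv (transpose A) *v v) ` int_vecs"
      using inv img unique[of A] by blast
  qed (use unique in blast)
qed

lemma S_seq_iff:
  assumes "nested_lattices \<Gamma>"
  shows "s \<in> S_seq \<Gamma> \<longleftrightarrow> (\<exists>j. \<forall>x\<in>\<Gamma> j. s \<bullet> hp x \<in> \<int>)"
proof -
  have "p_dual (\<Gamma> j) = {s. \<forall>x\<in>\<Gamma> j. s \<bullet> hp x \<in> \<int>}" for j
    using hlattice_lat[OF nestedD(1)[OF assms]] lat_p_dual by blast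
  then show ?thesis by (simp add: S_seq_def)
qed

text \<open>This brings \<open>xi_seq\<close> into the form of \<open>S_seq_iff\<close>, integrality
  on a single level, which is what the eigenvalue lemmas consume and produce.\<close>

lemma xi_seq_iff:
  assumes "nested_lattices \<Gamma>"
  shows "\<theta> \<in> xi_seq \<Gamma> \<longleftrightarrow> (\<exists>j. \<forall>t. hc t \<in> \<Gamma> j \<longrightarrow> \<theta> * t \<in> \<int>)"
proof -
  have "\<theta> \<in> {of_int m / xi_lat (\<Gamma> j) | m. True} \<longleftrightarrow> (\<forall>t. hc t \<in> \<Gamma> j \<longrightarrow> \<theta> * t \<in> \<int>)" for j
  proof -
    obtain a b \<xi> where lat: "lat (\<Gamma> j) a b \<xi>" using hlattice_lat[OF nestedD(1)[OF assms]] by blast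
    note L = latD[OF lat]
    show ?thesis
      unfolding lat_xi_lat[OF lat]
    proof
      assume "\<theta> \<in> {of_int m / \<xi> | m. True}"
      then obtain m :: int where m: "\<theta> = of_int m / \<xi>" by blast
      show "\<forall>t. hc t \<in> \<Gamma> j \<longrightarrow> \<theta> * t \<in> \<int>"
      proof (intro allI impI)
        fix t assume "hc t \<in> \<Gamma> j"
        then obtain k :: int where "t = of_int k * \<xi>" using L(7) by blast
        then have "\<theta> * t = of_int (m * k)" using m L(6) by simp
        then show "\<theta> * t \<in> \<int>" by (metis Ints_of_int)
      qed
    next
      assume *: "\<forall>t. hc t \<in> \<Gamma> j \<longrightarrow> \<theta> * t \<in> \<int>"
      have "hc (of_int 1 * \<xi>) \<in> \<Gamma> j" using L(7) by blast
      then have "\<theta> * \<xi> \<in> \<int>" using * by simp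
      then obtain m where "\<theta> * \<xi> = of_int m" by (rule Ints_cases)
      then have "\<theta> = of_int m / \<xi>" using L(6) by (simp add: field_simps)
      then show "\<theta> \<in> {of_int m / \<xi> | m. True}" by blast
    qed
  qed
  then show ?thesis unfolding xi_seq_def by blast
qed

lemma S_seq_iff_eigenvalue:
  assumes "nested_lattices \<Gamma>"
  shows "s \<in> S_seq \<Gamma> \<longleftrightarrow> eigenvalue \<Gamma> UNIV (\<lambda>g. expi (s \<bullet> hp g))"
  unfolding S_seq_iff[OF assms]
  using eigenvalueI_dual[OF assms] eigenvalueD_dual[OF assms] by blast

lemma xi_seq_iff_eigenvalue:
  assumes \<Gamma>: "nested_lattices \<Gamma>"
  shows "\<theta> \<in> xi_seq \<Gamma> \<longleftrightarrow> eigenvalue \<Gamma> (range hc) (\<lambda>g. expi (\<theta> * snd (snd g)))"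
proof
  assume "\<theta> \<in> xi_seq \<Gamma>"
  then obtain j where j: "\<forall>t. hc t \<in> \<Gamma> j \<longrightarrow> \<theta> * t \<in> \<int>" unfolding xi_seq_iff[OF \<Gamma>] by blast
  obtain a b \<xi> where lat: "lat (\<Gamma> j) a b \<xi>" using hlattice_lat[OF nestedD(1)[OF \<Gamma>]] by blast
  have "hc (of_int 1 * \<xi>) \<in> \<Gamma> j" using latD(7)[OF lat] by blast
  then have "\<theta> * \<xi> \<in> \<int>" using j by simp
  then show "eigenvalue \<Gamma> (range hc) (\<lambda>g. expi (\<theta> * snd (snd g)))"
    by (rule eigenvalueI_central[OF \<Gamma> lat])
qed (use eigenvalueD_central[OF \<Gamma>] xi_seq_iff[OF \<Gamma>] in blast)

lemma hsys_iso_invariants: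
  assumes \<Gamma>: "nested_lattices \<Gamma>" and \<Lambda>: "nested_lattices \<Lambda>" and iso: "hsys_iso (odometer \<Gamma>) (odometer \<Lambda>)"
  shows "S_seq \<Gamma> = S_seq \<Lambda>" "xi_seq \<Gamma> = xi_seq \<Lambda>"
proof -
  have "eigenvalue \<Gamma> G \<kappa> \<longleftrightarrow> eigenvalue \<Lambda> G \<kappa>" for G \<kappa>
    using eigenvalue_transfer[OF iso] eigenvalue_transfer[OF hsys_iso_odometer_sym[OF \<Gamma> \<Lambda> iso]] by blast
  then show "S_seq \<Gamma> = S_seq \<Lambda>" "xi_seq \<Gamma> = xi_seq \<Lambda>"
    by (simp_all add: set_eq_iff S_seq_iff_eigenvalue \<Gamma> \<Lambda> xi_seq_iff_eigenvalue)
qed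

lemma hconjugate_invariants:
  assumes "hlattice L" "hconjugate L L'"
  shows "p_dual L' = p_dual L" "xi_lat L' = xi_lat L"
proof -
  obtain g where g: "L' = hconj g L" using assms(2) by (auto simp: hconjugate_def hconj_def)
  obtain a b \<xi> where lat: "lat L a b \<xi>" using hlattice_lat[OF assms(1)] by blast
  note lat' = lat_hconj[OF lat, of g]
  show "xi_lat L' = xi_lat L" unfolding g using lat_xi_lat[OF lat] lat_xi_lat[OF lat'] by simp
  have "s \<bullet> hp (hmul x (hc t)) = s \<bullet> hp x" for s x t by (simp add: hp_inner)
  then show "p_dual L' = p_dual L"
    unfolding g lat_p_dual[OF lat] lat_p_dual[OF lat'] by (simp add: hconj_def hconj_eq)
qed

section \<open>Conjugacy and interlacing of lattices\<close>

text \<open>By symmetry a lattice is determined by lifts of a basis and its central generator. Over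
  each point of the projection the two subgroups contain a common element, and what remains of
  \<open>x\<close> is central.\<close>

lemma lat_subset:
  assumes "lat L a b \<xi>" "lat L' a b \<xi>"
  shows "L \<subseteq> L'"
proof
  note L = latD[OF assms(1)] and L' = latD[OF assms(2)]
  fix x assume x: "x \<in> L"
  obtain m n :: int where mn: "fst x = of_int m * fst a + of_int n * fst b"
        "fst (snd x) = of_int m * fst (snd a) + of_int n * fst (snd b)"
    using L(8)[OF x] by blast
  have "hsubgroup (L \<inter> L')" using L(1) L'(1) by (simp add: hsubgroup_def)
  then obtain y where y: "y \<in> L \<inter> L'" "fst y = fst x" "fst (snd y) = fst (snd x)"
    using hsubgroup_int_combination[of "L \<inter> L'" a b m n] L(3,4) L'(3,4) mn by (metis IntI)
  obtain t where t: "x = hmul y (hc t)" using same_hp_imp_hc[OF y(2,3)] by blast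
  have "hc t \<in> L" using x y(1) hmul_mem_iff(2)[OF L(1), of y "hc t"] t by blast
  then have "hc t \<in> L'" using L(7) L'(7) by blast
  then show "x \<in> L'" using hsubgroup_hmul[OF L'(1)] y(1) t by blast
qed

text \<open>Conjugation by \<open>g\<close> adds the linear functional \<open>hdet g\<close> to the central coordinate, and such a
  functional can be prescribed freely on the basis \<open>a\<close>, \<open>b\<close>.\<close>
lemma lat_hconjugate:
  assumes lat: "lat L a b \<xi>" and lat': "lat L' a' b' \<xi>"
    and a: "fst a = fst a'" "fst (snd a) = fst (snd a')" and b: "fst b = fst b'" "fst (snd b) = fst (snd b')"
  shows "hconjugate L L'"
proof -
  define D where "D = hdet a b"
  have D: "D \<noteq> 0" using latD(5)[OF lat] by (simp add: D_def)
  \<comment> \<open>With \<open>g\<close> over the combination of \<open>a\<close> and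
    \<open>b\<close> with these coefficients, \<open>hdet g a\<close> is
    \<open>- \<beta> * D\<close> and \<open>hdet g b\<close> is \<open>\<alpha> * D\<close>, so each
    coefficient is fixed by one of the two central differences.\<close>
  define \<alpha> \<beta> where "\<alpha> = (snd (snd b') - snd (snd b)) / D" and "\<beta> = - (snd (snd a') - snd (snd a)) / D"
  define g :: h3 where "g = (\<alpha> * fst a + \<beta> * fst b, \<alpha> * fst (snd a) + \<beta> * fst (snd b), 0)"
  have "hdet g a = - \<beta> * D" "hdet g b = \<alpha> * D" by (simp_all add: g_def hdet_def D_def algebra_simps)
  then have "hdet g a = snd (snd a') - snd (snd a)" "hdet g b = snd (snd b') - snd (snd b)"
    using D by (simp_all add: \<alpha>_def \<beta>_def)
  then have "hmul a (hc (hdet g a)) = a'" "hmul b (hc (hdet g b)) = b'"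
    using same_hp_imp_hc[OF a] same_hp_imp_hc[OF b] by simp_all
  then have "lat (hconj g L) a' b' \<xi>" using lat_hconj[OF lat, of g] by simp
  then have "hconj g L = L'" using lat_subset[OF _ lat'] lat_subset[OF lat'] by blast
  then show ?thesis unfolding hconjugate_def hconj_def by blast
qed

text \<open>Members of different sequences need not contain one another, so the comparison is by the
  two data that the invariants control.\<close>

definition dominated :: "h3 set \<Rightarrow> h3 set \<Rightarrow> bool" where
  "dominated K L \<longleftrightarrow> hp ` K \<subseteq> hp ` L \<and> (\<forall>t. hc t \<in> K \<longrightarrow> hc t \<in> L)"

text \<open>A basis of the dual of the projection and \<open>1 / \<xi>\<close> are finitely many
  members of the invariants. Each is integral on some level of \<open>\<Gamma>'\<close>, hence on
  all later ones, and integrality against them says precisely that projection and centre lie in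
  those of \<open>\<Gamma> j\<close>.\<close>

lemma eventually_dominated:
  assumes \<Gamma>: "nested_lattices \<Gamma>" and \<Gamma>': "nested_lattices \<Gamma>'"
    and S: "S_seq \<Gamma> \<subseteq> S_seq \<Gamma>'" and X: "xi_seq \<Gamma> \<subseteq> xi_seq \<Gamma>'"
  shows "\<exists>k0. \<forall>k\<ge>k0. dominated (\<Gamma>' k) (\<Gamma> j)"
proof -
  obtain a b \<xi> where lat: "lat (\<Gamma> j) a b \<xi>" using hlattice_lat[OF nestedD(1)[OF \<Gamma>]] by blast
  note L = latD[OF lat]
  define D where "D = hdet a b"
  \<comment> \<open>The basis dual to the projections of \<open>a\<close> and \<open>b\<close>:
    pairing with \<open>hp x\<close> gives the coordinates of \<open>x\<close> in Cramer's
    rule.\<close>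
  define s1 s2 :: "real^2" where "s1 = vector [fst (snd b) / D, - fst b / D]"
    and "s2 = vector [- fst (snd a) / D, fst a / D]"
  have s: "s1 \<bullet> hp x = hdet x b / D" "s2 \<bullet> hp x = hdet a x / D" for x
    by (simp_all add: hp_inner s1_def s2_def hdet_def diff_divide_distrib mult.commute)
  have "s1 \<bullet> hp x \<in> \<int> \<and> s2 \<bullet> hp x \<in> \<int>" if x: "x \<in> \<Gamma> j" for x
  proof -
    obtain m n :: int where mn: "fst x = of_int m * fst a + of_int n * fst b"
        "fst (snd x) = of_int m * fst (snd a) + of_int n * fst (snd b)"
      using L(8)[OF x] by blast
    from hdet_left_combination[OF mn] show ?thesis using L(5) by (simp add: s D_def)
  qed
  then have "s1 \<in> S_seq \<Gamma>" "s2 \<in> S_seq \<Gamma>" unfolding S_seq_iff[OF \<Gamma>] by blast+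
  then obtain k1 k2 where k12: "\<forall>x\<in>\<Gamma>' k1. s1 \<bullet> hp x \<in> \<int>" "\<forall>x\<in>\<Gamma>' k2. s2 \<bullet> hp x \<in> \<int>"
    using S S_seq_iff[OF \<Gamma>'] by blast
  have "1 / \<xi> \<in> xi_seq \<Gamma>"
    unfolding xi_seq_iff[OF \<Gamma>]
  proof (intro exI[of _ j] allI impI)
    fix t assume "hc t \<in> \<Gamma> j"
    then obtain k :: int where "t = of_int k * \<xi>" using L(7) by blast
    then show "1 / \<xi> * t \<in> \<int>" using L(6) by simp
  qed
  then obtain k3 where k3: "\<forall>t. hc t \<in> \<Gamma>' k3 \<longrightarrow> 1 / \<xi> * t \<in> \<int>" using X xi_seq_iff[OF \<Gamma>'] by blast
  have "dominated (\<Gamma>' k) (\<Gamma> j)" if k: "k \<ge> max k1 (max k2 k3)" for k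
    unfolding dominated_def
  proof (intro conjI subsetI allI impI)
    fix p assume "p \<in> hp ` \<Gamma>' k"
    then obtain x where x: "x \<in> \<Gamma>' k" "p = hp x" by blast
    have "x \<in> \<Gamma>' k1" "x \<in> \<Gamma>' k2" using x nestedD(3)[OF \<Gamma>'] k by (meson max.boundedE subsetD)+
    then have "hdet x b / D \<in> \<int>" "hdet a x / D \<in> \<int>" using k12 s by metis+
    then obtain m n :: int where mn: "hdet x b / D = of_int m" "hdet a x / D = of_int n" by (metis Ints_cases)
    obtain y where "y \<in> \<Gamma> j" "fst y = of_int m * fst a + of_int n * fst b"
       "fst (snd y) = of_int m * fst (snd a) + of_int n * fst (snd b)"
      using hsubgroup_int_combination[OF L(1,3,4)] by blast
    then have "hp y = hp x" "y \<in> \<Gamma> j"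
      using hdet_basis[OF L(5), of x] mn unfolding D_def hp_eq_iff by simp_all
    then show "p \<in> hp ` \<Gamma> j" using x by (metis imageI)
  next
    fix t assume "hc t \<in> \<Gamma>' k"
    then have "hc t \<in> \<Gamma>' k3" using nestedD(3)[OF \<Gamma>'] k by (meson max.boundedE subsetD)
    then have "1 / \<xi> * t \<in> \<int>" using k3 by blast
    then obtain m where "1 / \<xi> * t = of_int m" by (rule Ints_cases)
    then have "t = of_int m * \<xi>" using L(6) by (simp add: field_simps)
    then show "hc t \<in> \<Gamma> j" using L(7) by blast
  qed
  then show ?thesis by blast
qed

lemma hdiscrete_subset: "hdiscrete L \<Longrightarrow> K \<subseteq> L \<Longrightarrow> hdiscrete K"
  unfolding hdiscrete_def by (meson subsetD)

text \<open>The first domination keeps the enlarged lattice inside \<open>G0\<close>. The second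
  provides lifts to \<open>G'\<close> of the basis of \<open>G\<close> and keeps the centre of the
  enlargement from exceeding that of \<open>G'\<close>. The third puts \<open>G2'\<close> into the
  thinned lattice.\<close>

lemma intermediate_lattices:
  assumes L: "hlattice G0" "hlattice G" "hlattice G'" "hlattice G2'"
    and sub: "G \<subseteq> G0" "G2' \<subseteq> G'"
    and dom: "dominated G' G0" "dominated G G'" "dominated G2' G"
  shows "\<exists>K K'. hlattice K \<and> hlattice K' \<and> G \<subseteq> K \<and> K \<subseteq> G0 \<and> G2' \<subseteq> K' \<and> K' \<subseteq> G' \<and> hconjugate K K'"
proof -
  obtain a b \<xi>0 where lat: "lat G a b \<xi>0" using hlattice_lat[OF L(2)] by blast
  obtain a0 b0 \<xi> where lat': "lat G' a0 b0 \<xi>" using hlattice_lat[OF L(3)] by blast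
  note G = latD[OF lat] and G' = latD[OF lat']
  have disc: "hdiscrete G0" "hdiscrete G'" and G0: "hsubgroup G0" using L by (auto simp: hlattice_def)
  define K where "K = {hmul x (hc t) | x t. x \<in> G \<and> hc t \<in> G'}"
  define K' where "K' = {x \<in> G'. hp x \<in> hp ` G}"
  have "K \<subseteq> G0"
  proof
    fix z assume "z \<in> K"
    then obtain x t where z: "z = hmul x (hc t)" "x \<in> G" "hc t \<in> G'" unfolding K_def by blast
    have "hc t \<in> G0" using dom(1) z(3) by (simp add: dominated_def)
    then show "z \<in> G0" using z sub(1) hsubgroup_hmul[OF G0] by blast
  qed
  have "G \<subseteq> K"
  proof
    fix x assume "x \<in> G"
    moreover have "hc 0 \<in> G'" using hsubgroup_hone[OF G'(1)] by (simp add: hc_simps)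
    moreover have "x = hmul x (hc 0)" by (simp add: hc_simps)
    ultimately show "x \<in> K" unfolding K_def by blast
  qed
  have "K' \<subseteq> G'" by (auto simp: K'_def)
  have "G2' \<subseteq> K'" using sub(2) dom(3) by (auto simp: K'_def dominated_def)
  have sK: "hsubgroup K"
  proof (rule hsubgroupI)
    show "hone \<in> K" using \<open>G \<subseteq> K\<close> hsubgroup_hone[OF G(1)] by blast
    show "hmul z w \<in> K" if z: "z \<in> K" and w: "w \<in> K" for z w
    proof -
      obtain x t where x: "z = hmul x (hc t)" "x \<in> G" "hc t \<in> G'" using z unfolding K_def by blast
      obtain y s where y: "w = hmul y (hc s)" "y \<in> G" "hc s \<in> G'" using w unfolding K_def by blast
      have "hmul z w = hmul (hmul x (hmul (hc t) y)) (hc s)" by (simp add: x y hmul_assoc)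
      also have "\<dots> = hmul (hmul x y) (hmul (hc t) (hc s))" by (simp only: hc_central[of t y] hmul_assoc)
      also have "\<dots> = hmul (hmul x y) (hc (t + s))" by (simp only: hc_simps)
      finally have "hmul z w = hmul (hmul x y) (hc (t + s))" .
      moreover have "hmul x y \<in> G" using x y hsubgroup_hmul[OF G(1)] by blast
      moreover have "hc (t + s) \<in> G'" using hsubgroup_hmul[OF G'(1) x(3) y(3)] by (simp add: hc_simps)
      ultimately show ?thesis unfolding K_def by blast
    qed
    show "hinv z \<in> K" if z: "z \<in> K" for z
    proof -
      obtain x t where x: "z = hmul x (hc t)" "x \<in> G" "hc t \<in> G'" using z unfolding K_def by blast
      have "hinv z = hmul (hinv x) (hc (- t))" by (simp add: x hinv_hmul hc_simps hc_central[of "- t" "hinv x"])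
      moreover have "hinv x \<in> G" using x hsubgroup_hinv[OF G(1)] by blast
      moreover have "hc (- t) \<in> G'" using hsubgroup_hinv[OF G'(1) x(3)] by (simp add: hc_simps)
      ultimately show ?thesis unfolding K_def by blast
    qed
  qed
  have cK: "hc t \<in> K \<longleftrightarrow> hc t \<in> G'" for t
  proof
    assume "hc t \<in> K"
    then obtain x s where x: "hc t = hmul x (hc s)" "x \<in> G" "hc s \<in> G'" unfolding K_def by blast
    have "hmul (hc t) (hinv (hc s)) = x" unfolding x(1) by (simp add: hmul_assoc)
    then have "x = hc (t - s)" by (simp add: hc_simps)
    then have "x \<in> G'" using dom(2) x(2) by (simp add: dominated_def)
    then show "hc t \<in> G'" unfolding x(1) using hsubgroup_hmul[OF G'(1) _ x(3)] by blast
  next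
    assume "hc t \<in> G'"
    moreover have "hc t = hmul hone (hc t)" by simp
    ultimately show "hc t \<in> K" using hsubgroup_hone[OF G(1)] unfolding K_def by blast
  qed
  have latK: "lat K a b \<xi>"
    unfolding lat_def
  proof (intro conjI allI ballI)
    show "countable K" using \<open>K \<subseteq> G0\<close> hdiscrete_countable[OF disc(1)] countable_subset by blast
    show "a \<in> K" "b \<in> K" using G(3,4) \<open>G \<subseteq> K\<close> by blast+
    show "hc t \<in> K \<longleftrightarrow> (\<exists>k::int. t = of_int k * \<xi>)" for t unfolding cK by (rule G'(7))
    fix z assume "z \<in> K"
    then obtain x t where x: "z = hmul x (hc t)" "x \<in> G" unfolding K_def by blast
    then have "fst z = fst x" "fst (snd z) = fst (snd x)" by simp_all
    then show "\<exists>m n::int. fst z = of_int m * fst a + of_int n * fst b \<and>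
       fst (snd z) = of_int m * fst (snd a) + of_int n * fst (snd b)" using G(8)[OF x(2)] by simp
  qed (use sK G(5) G'(6) in auto)
  \<comment> \<open>The basis of \<open>G\<close> is lifted to \<open>G'\<close>, so that the
    thinned lattice gets the same projected basis as \<open>K\<close>.\<close>
  have "hp a \<in> hp ` G'" "hp b \<in> hp ` G'" using dom(2) G(3,4) by (auto simp: dominated_def)
  then obtain a' b' where ab': "a' \<in> G'" "b' \<in> G'" "hp a = hp a'" "hp b = hp b'" by blast
  then have abf: "fst a = fst a'" "fst (snd a) = fst (snd a')" "fst b = fst b'" "fst (snd b) = fst (snd b')"
    by (simp_all add: hp_eq_iff)
  have sK': "hsubgroup K'"
  proof -
    have K'_iff: "z \<in> K' \<longleftrightarrow> z \<in> G' \<and> (\<exists>x\<in>G. hp z = hp x)" for z unfolding K'_def by blast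
    show ?thesis
    proof (rule hsubgroupI)
      show "hone \<in> K'" using hsubgroup_hone[OF G(1)] hsubgroup_hone[OF G'(1)] unfolding K'_iff by blast
      show "hmul z w \<in> K'" if z: "z \<in> K'" and w: "w \<in> K'" for z w
      proof -
        obtain x y where "x \<in> G" "y \<in> G" "hp z = hp x" "hp w = hp y" using z w unfolding K'_iff by blast
        then have "hmul x y \<in> G" "hp (hmul z w) = hp (hmul x y)"
          using hsubgroup_hmul[OF G(1)] by (simp_all add: hp_eq_iff)
        then show ?thesis using z w hsubgroup_hmul[OF G'(1)] unfolding K'_iff by blast
      qed
      show "hinv z \<in> K'" if z: "z \<in> K'" for z
      proof -
        obtain x where "x \<in> G" "hp z = hp x" using z unfolding K'_iff by blast
        then have "hinv x \<in> G" "hp (hinv z) = hp (hinv x)"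
          using hsubgroup_hinv[OF G(1)] by (simp_all add: hp_eq_iff)
        then show ?thesis using z hsubgroup_hinv[OF G'(1)] unfolding K'_iff by blast
      qed
    qed
  qed
  have latK': "lat K' a' b' \<xi>"
    unfolding lat_def
  proof (intro conjI allI ballI)
    show "countable K'" using \<open>K' \<subseteq> G'\<close> G'(2) countable_subset by blast
    show "a' \<in> K'" "b' \<in> K'" using ab' G(3,4) unfolding K'_def by (metis (mono_tags, lifting) imageI mem_Collect_eq)+
    show "hdet a' b' \<noteq> 0" using G(5) by (simp add: hdet_def abf)
    have "hp (hc t) = hp hone" for t by (simp add: hp_eq_iff hone_def)
    then have "hc t \<in> K' \<longleftrightarrow> hc t \<in> G'" for t
      using hsubgroup_hone[OF G(1)] unfolding K'_def by (metis (mono_tags, lifting) imageI mem_Collect_eq)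
    then show "hc t \<in> K' \<longleftrightarrow> (\<exists>k::int. t = of_int k * \<xi>)" for t using G'(7) by blast
    fix z assume "z \<in> K'"
    then obtain x where x: "x \<in> G" "hp z = hp x" unfolding K'_def by blast
    then have "fst z = fst x" "fst (snd z) = fst (snd x)" by (simp_all add: hp_eq_iff)
    then show "\<exists>m n::int. fst z = of_int m * fst a' + of_int n * fst b' \<and>
       fst (snd z) = of_int m * fst (snd a') + of_int n * fst (snd b')" using G(8)[OF x(1)] by (simp add: abf)
  qed (use sK' G'(6) in auto)
  have "hlattice K" "hlattice K'"
    using lat_hlattice[OF latK hdiscrete_subset[OF disc(1) \<open>K \<subseteq> G0\<close>]]
      lat_hlattice[OF latK' hdiscrete_subset[OF disc(2) \<open>K' \<subseteq> G'\<close>]] by blast+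
  moreover have "hconjugate K K'" by (rule lat_hconjugate[OF latK latK' abf])
  ultimately show ?thesis
    using \<open>K \<subseteq> G0\<close> \<open>G \<subseteq> K\<close> \<open>K' \<subseteq> G'\<close> \<open>G2' \<subseteq> K'\<close> by blast
qed

text \<open>Merging the two sequences into one alternating family \<open>A\<close> reduces the
  construction to a single dependent choice, in which every sufficiently large index is
  admissible.\<close>

lemma interlacing_indices:
  assumes \<Gamma>: "nested_lattices \<Gamma>" and \<Gamma>': "nested_lattices \<Gamma>'"
    and S: "S_seq \<Gamma> = S_seq \<Gamma>'" and X: "xi_seq \<Gamma> = xi_seq \<Gamma>'"
  shows "\<exists>n :: nat \<Rightarrow> nat. strict_mono n \<and> (\<forall>i. dominated (\<Gamma>' (n (2 * i + 1))) (\<Gamma> (n (2 * i))) \<and>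
     dominated (\<Gamma> (n (2 * i + 2))) (\<Gamma>' (n (2 * i + 1))))"
proof -
  define A where "A i k = (if even i then \<Gamma> k else \<Gamma>' k)" for i k :: nat
  have "\<exists>n. \<forall>i. True \<and> (n i < n (Suc i) \<and> dominated (A (Suc i) (n (Suc i))) (A i (n i)))"
  proof (rule dependent_nat_choice)
    fix k i :: nat
    have "\<exists>k0. \<forall>k'\<ge>k0. dominated (A (Suc i) k') (A i k)"
      using eventually_dominated[OF \<Gamma> \<Gamma>', of k] eventually_dominated[OF \<Gamma>' \<Gamma>, of k] S X
      by (cases "even i") (simp_all add: A_def)
    then obtain k0 where k0: "\<forall>k'\<ge>k0. dominated (A (Suc i) k') (A i k)" by blast
    show "\<exists>k'. True \<and> (k < k' \<and> dominated (A (Suc i) k') (A i k))"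
      by (rule exI[of _ "max k0 (Suc k)"]) (simp add: k0 less_max_iff_disj)
  qed simp
  then obtain n where n: "\<And>i. n i < n (Suc i)" "\<And>i. dominated (A (Suc i) (n (Suc i))) (A i (n i))" by blast
  have "strict_mono n" using n(1) by (simp add: strict_mono_Suc_iff)
  moreover have "dominated (\<Gamma>' (n (2 * i + 1))) (\<Gamma> (n (2 * i))) \<and>
     dominated (\<Gamma> (n (2 * i + 2))) (\<Gamma>' (n (2 * i + 1)))" for i
    using n(2)[of "2 * i"] n(2)[of "2 * i + 1"] by (simp add: A_def)
  ultimately show ?thesis by blast
qed

theorem theorem5p7:
  fixes \<Gamma> \<Gamma>' :: "nat \<Rightarrow> h3 set"
  assumes "nested_lattices \<Gamma>" and "nested_lattices \<Gamma>'"
  shows "f_isomorphic (odometer \<Gamma>) (odometer \<Gamma>') \<longleftrightarrow>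
           S_seq \<Gamma> = S_seq \<Gamma>' \<and> xi_seq \<Gamma> = xi_seq \<Gamma>'"
proof
  note \<Gamma> = assms(1) and \<Gamma>' = assms(2)
  assume "f_isomorphic (odometer \<Gamma>) (odometer \<Gamma>')"
  then obtain \<Lambda> \<Lambda>' where \<Lambda>: "nested_lattices \<Lambda>" "hsys_iso (odometer \<Gamma>) (odometer \<Lambda>)"
    and \<Lambda>': "nested_lattices \<Lambda>'" "hsys_iso (odometer \<Gamma>') (odometer \<Lambda>')"
    and conj: "\<And>j. hconjugate (\<Lambda> j) (\<Lambda>' j)"
    unfolding f_isomorphic_def associated_def by blast
  have "S_seq \<Lambda>' = S_seq \<Lambda>" "xi_seq \<Lambda>' = xi_seq \<Lambda>"
    using hconjugate_invariants[OF nestedD(1)[OF \<Lambda>(1)] conj] by (simp_all add: S_seq_def xi_seq_def)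
  then show "S_seq \<Gamma> = S_seq \<Gamma>' \<and> xi_seq \<Gamma> = xi_seq \<Gamma>'"
    using hsys_iso_invariants[OF \<Gamma> \<Lambda>] hsys_iso_invariants[OF \<Gamma>' \<Lambda>'] by simp
next
  note \<Gamma> = assms(1) and \<Gamma>' = assms(2)
  assume eq: "S_seq \<Gamma> = S_seq \<Gamma>' \<and> xi_seq \<Gamma> = xi_seq \<Gamma>'"
  obtain n :: "nat \<Rightarrow> nat" where n: "strict_mono n" "\<And>i. dominated (\<Gamma>' (n (2 * i + 1))) (\<Gamma> (n (2 * i)))"
     "\<And>i. dominated (\<Gamma> (n (2 * i + 2))) (\<Gamma>' (n (2 * i + 1)))"
    using interlacing_indices[OF \<Gamma> \<Gamma>'] eq by blast
  have ge: "i \<le> n i" for i using strict_mono_imp_increasing[OF n(1)] .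
  have le: "n i \<le> n j" if "i \<le> j" for i j using n(1) that by (simp add: strict_mono_less_eq)
  \<comment> \<open>The upper bound at step \<open>i + 1\<close> is the lower bound at step
    \<open>i\<close>, which makes the chosen lattices nested and interlaced with the given
    sequences.\<close>
  have ex: "\<exists>K K'. hlattice K \<and> hlattice K' \<and> \<Gamma> (n (2 * i + 2)) \<subseteq> K \<and> K \<subseteq> \<Gamma> (n (2 * i)) \<and>
      \<Gamma>' (n (2 * i + 3)) \<subseteq> K' \<and> K' \<subseteq> \<Gamma>' (n (2 * i + 1)) \<and> hconjugate K K'" for i
  proof (rule intermediate_lattices)
    show "\<Gamma> (n (2 * i + 2)) \<subseteq> \<Gamma> (n (2 * i))" by (intro nestedD(3)[OF \<Gamma>] le) simp
    show "\<Gamma>' (n (2 * i + 3)) \<subseteq> \<Gamma>' (n (2 * i + 1))" by (intro nestedD(3)[OF \<Gamma>'] le) simp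
    show "dominated (\<Gamma>' (n (2 * i + 3))) (\<Gamma> (n (2 * i + 2)))" using n(2)[of "i + 1"] by (simp add: eval_nat_numeral)
  qed (use n nestedD(1)[OF \<Gamma>] nestedD(1)[OF \<Gamma>'] in auto)
  then obtain \<Lambda> \<Lambda>' where \<Lambda>: "\<And>i. hlattice (\<Lambda> i)" "\<And>i. \<Gamma> (n (2 * i + 2)) \<subseteq> \<Lambda> i" "\<And>i. \<Lambda> i \<subseteq> \<Gamma> (n (2 * i))"
    and \<Lambda>': "\<And>i. hlattice (\<Lambda>' i)" "\<And>i. \<Gamma>' (n (2 * i + 3)) \<subseteq> \<Lambda>' i" "\<And>i. \<Lambda>' i \<subseteq> \<Gamma>' (n (2 * i + 1))"
    and conj: "\<And>i. hconjugate (\<Lambda> i) (\<Lambda>' i)" by metis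
  have "\<Lambda> (Suc i) \<subseteq> \<Lambda> i" "\<Lambda>' (Suc i) \<subseteq> \<Lambda>' i" for i
    using \<Lambda>(3)[of "Suc i"] \<Lambda>(2)[of i] \<Lambda>'(3)[of "Suc i"] \<Lambda>'(2)[of i] by (auto simp: eval_nat_numeral)
  then have nest: "nested_lattices \<Lambda>" "nested_lattices \<Lambda>'"
    using \<Lambda>(1) \<Lambda>'(1) by (simp_all add: nested_lattices_def)
  \<comment> \<open>As \<open>n\<close> grows at least as fast as the identity, the identity can be
    the index map in one direction.\<close>
  have sub: "\<Lambda> j \<subseteq> \<Gamma> j" "\<Lambda>' j \<subseteq> \<Gamma>' j" for j
    using \<Lambda>(3)[of j] \<Lambda>'(3)[of j] nestedD(3)[OF \<Gamma>, of j "n (2 * j)"] nestedD(3)[OF \<Gamma>', of j "n (2 * j + 1)"]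
      ge[of "2 * j"] ge[of "2 * j + 1"] by auto
  have "hsys_iso (odometer \<Gamma>) (odometer \<Lambda>)"
    by (rule interlaced_hsys_iso[where J = "\<lambda>i. n (2 * i + 2)" and K = "\<lambda>j. j", OF \<Gamma> nest(1) \<Lambda>(2) sub(1)])
  moreover have "hsys_iso (odometer \<Gamma>') (odometer \<Lambda>')"
    by (rule interlaced_hsys_iso[where J = "\<lambda>i. n (2 * i + 3)" and K = "\<lambda>j. j", OF \<Gamma>' nest(2) \<Lambda>'(2) sub(2)])
  ultimately show "f_isomorphic (odometer \<Gamma>) (odometer \<Gamma>')"
    unfolding f_isomorphic_def associated_def using nest conj by blast
qed

end
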